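(* Let $\mathfrak g=\mathfrak{sl}(2,\mathbb C)$, $\Gamma=\mathrm{SL}(2,\mathbb Z)$ and let $\rho$ be the adjoint action $\rho(\gamma)A=\gamma A\gamma^{-1}$. Then the zero weight automorphic Lie algebra $\mathfrak M^!_0(\mathfrak g,\Gamma,\rho)$ is isomorphic to the Onsager algebra $\mathfrak O$. An isomorphism $\mathfrak O\to\mathfrak M^!_0(\mathfrak g,\Gamma,\rho)$ is determined by $$A_0\mapsto\bar h,\qquad A_1\mapsto\frac{(2j-1728)\bar h-2\bar e+2\bar f}{1728}.$$
   Context: $\mathbb H^2$ is the upper half-plane with the action $\gamma\tau=\frac{a\tau+b}{c\tau+d}$ of $\mathrm{SL}(2,\mathbb Z)$. $\mathfrak M^!_0(\mathfrak g,\Gamma,\rho)$ is the Lie algebra, under the pointwise bracket, of holomorphic maps $f:\mathbb H^2\to\mathfrak g$ with $f(\gamma\tau)=\rho(\gamma)f(\tau)$ for all $\gamma\in\Gamma$, having at most exponential growth at every cusp: for each $s\in\mathbb Q\cup\{\infty\}$ and $g\in\mathrm{SL}(2,\mathbb Z)$ with $gs=\infty$, putting $\tau_s=g\tau$, there are constants $C,M$ with $\|f(\tau)\|<Ce^{M|\tau_s|}$ whenever $\operatorname{Im}\tau_s$ is large enough. The Onsager algebra $\mathfrak O$ is the complex Lie algebra with basis $A_k$ ($k\in\mathbb Z$), $G_m$ ($m\in\mathbb N=\{1,2,\dots\}$) and brackets $[G_m,G_n]=0$, $[G_m,A_k]=2A_{k+m}-2A_{k-m}$, $[A_k,A_\ell]=G_{k-\ell}$,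 with the convention $G_{-m}=-G_m$, $G_0=0$. $E_2,E_4,E_6$ are the Eisenstein series normalised to have constant term $1$ ($E_2=1-24\sum_{n\ge1}\sigma_1(n)q^n$, $q=e^{2\pi i\tau}$), $\Delta=(E_4^3-E_6^2)/1728$, $j=E_4^3/\Delta$. Put $a(\tau)=2\pi i E_2(\tau)/12$ and $\Phi_1(\tau)=\begin{pmatrix} 1+\tau a(\tau) & \tau \\ {} a(\tau) & 1 \end{pmatrix}$. Then $\bar h=\Phi_1\begin{pmatrix} 1 & 0 \\ 0 & -1 \end{pmatrix}\Phi_1^{-1}$, $\bar e=\Delta^{-1}E_4E_6\,\Phi_1\begin{pmatrix} 0 & 1 \\ 0 & 0 \end{pmatrix}\Phi_1^{-1}$, $\bar f=\Delta^{-1}E_4^2E_6\,\Phi_1\begin{pmatrix} 0 & 0 \\ 1 & 0 \end{pmatrix}\Phi_1^{-1}$; these are elements of $\mathfrak M^!_0(\mathfrak g,\Gamma,\rho)$. *)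

theory Defs
  imports
    "HOL-Complex_Analysis.Complex_Analysis"
    "HOL-Library.Poly_Mapping"
    "HOL-Library.Function_Algebras"
begin

section \<open>Complex Lie algebras\<close>

record 'a lie_struct =
  lie_carrier :: "'a set"
  lie_scale :: "complex \<Rightarrow> 'a \<Rightarrow> 'a"
  lie_bracket :: "'a \<Rightarrow> 'a \<Rightarrow> 'a"

text \<open>The carrier is a linear subspace of an ambient complex vector space, from which the
  addition is taken.\<close>

definition lie_algebra :: "'a::ab_group_add lie_struct \<Rightarrow> bool" where
  "lie_algebra L \<longleftrightarrow>
     (let V = lie_carrier L; sc = lie_scale L; br = lie_bracket L in
       vector_space sc \<and> module.subspace sc V \<and>
       (\<forall>x\<in>V. \<forall>y\<in>V. br x y \<in> V) \<and>
       (\<forall>x\<in>V. \<forall>y\<in>V. \<forall>z\<in>V. br (x + y) z = br x z + br y z) \<and>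
       (\<forall>x\<in>V. \<forall>y\<in>V. \<forall>z\<in>V. br x (y + z) = br x y + br x z) \<and>
       (\<forall>c. \<forall>x\<in>V. \<forall>y\<in>V. br (sc c x) y = sc c (br x y)) \<and>
       (\<forall>c. \<forall>x\<in>V. \<forall>y\<in>V. br x (sc c y) = sc c (br x y)) \<and>
       (\<forall>x\<in>V. br x x = 0) \<and>
       (\<forall>x\<in>V. \<forall>y\<in>V. \<forall>z\<in>V. br x (br y z) + br y (br z x) + br z (br x y) = 0))"

definition lie_hom ::
  "'a::ab_group_add lie_struct \<Rightarrow> 'b::ab_group_add lie_struct \<Rightarrow> ('a \<Rightarrow> 'b) \<Rightarrow> bool" where
  "lie_hom L L' \<phi> \<longleftrightarrow>
     lie_algebra L \<and> lie_algebra L' \<and>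
     (\<forall>x\<in>lie_carrier L. \<phi> x \<in> lie_carrier L') \<and>
     (\<forall>x\<in>lie_carrier L. \<forall>y\<in>lie_carrier L. \<phi> (x + y) = \<phi> x + \<phi> y) \<and>
     (\<forall>c. \<forall>x\<in>lie_carrier L. \<phi> (lie_scale L c x) = lie_scale L' c (\<phi> x)) \<and>
     (\<forall>x\<in>lie_carrier L. \<forall>y\<in>lie_carrier L.
        \<phi> (lie_bracket L x y) = lie_bracket L' (\<phi> x) (\<phi> y))"

definition lie_iso ::
  "'a::ab_group_add lie_struct \<Rightarrow> 'b::ab_group_add lie_struct \<Rightarrow> ('a \<Rightarrow> 'b) \<Rightarrow> bool" where
  "lie_iso L L' \<phi> \<longleftrightarrow> lie_hom L L' \<phi> \<and> bij_betw \<phi> (lie_carrier L) (lie_carrier L')"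


section \<open>The Onsager algebra\<close>

text \<open>Index set of the basis. Since \<open>G\<^sub>m\<close> is a basis vector only for \<open>m \<ge> 1\<close>, the index
  \<open>OG n\<close> stands for \<open>G\<^sub>n\<^sub>+\<^sub>1\<close>.\<close>

datatype onsager_index = OA int | OG nat

type_synonym onsager = "onsager_index \<Rightarrow>\<^sub>0 complex"

definition ons_scale :: "complex \<Rightarrow> onsager \<Rightarrow> onsager" where
  "ons_scale c x = Poly_Mapping.map ((*) c) x"

definition ons_A :: "int \<Rightarrow> onsager" where
  "ons_A k = Poly_Mapping.single (OA k) 1"

text \<open>\<open>G\<close> is extended to all integer indices by \<open>G\<^sub>0 = 0\<close> and \<open>G\<^sub>-\<^sub>m = - G\<^sub>m\<close>.\<close>

definition ons_G :: "int \<Rightarrow> onsager" where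
  "ons_G m =
     (if m > 0 then Poly_Mapping.single (OG (nat m - 1)) 1
      else if m < 0 then - Poly_Mapping.single (OG (nat (- m) - 1)) 1
      else 0)"

fun ons_basis_bracket :: "onsager_index \<Rightarrow> onsager_index \<Rightarrow> onsager" where
  "ons_basis_bracket (OA k) (OA l) = ons_G (k - l)"
| "ons_basis_bracket (OG n) (OA k) =
     ons_scale 2 (ons_A (k + (int n + 1))) - ons_scale 2 (ons_A (k - (int n + 1)))"
| "ons_basis_bracket (OA k) (OG n) =
     - (ons_scale 2 (ons_A (k + (int n + 1))) - ons_scale 2 (ons_A (k - (int n + 1))))"
| "ons_basis_bracket (OG m) (OG n) = 0"

definition ons_bracket :: "onsager \<Rightarrow> onsager \<Rightarrow> onsager" where
  "ons_bracket x y =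
     (\<Sum>i\<in>Poly_Mapping.keys x. \<Sum>j\<in>Poly_Mapping.keys y.
        ons_scale (Poly_Mapping.lookup x i * Poly_Mapping.lookup y j) (ons_basis_bracket i j))"

definition onsager_algebra :: "onsager lie_struct" where
  "onsager_algebra =
     \<lparr>lie_carrier = UNIV, lie_scale = ons_scale, lie_bracket = ons_bracket\<rparr>"

lemma ons_scale_0 [simp]: "ons_scale c 0 = 0"
  by (rule poly_mapping_eqI) (simp add: ons_scale_def Poly_Mapping.map.rep_eq)

lemma ons_scale_1 [simp]: "ons_scale 1 x = x"
  by (rule poly_mapping_eqI) (simp add: ons_scale_def Poly_Mapping.map.rep_eq when_def)

lemma ons_bracket_single [simp]:
  "ons_bracket (Poly_Mapping.single i 1) (Poly_Mapping.single j 1) = ons_basis_bracket i j"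
  by (simp add: ons_bracket_def)

lemma onsager_relations:
  "ons_bracket (ons_A k) (ons_A l) = ons_G (k - l)"
  "m > 0 \<Longrightarrow> ons_bracket (ons_G m) (ons_A k) =
     ons_scale 2 (ons_A (k + m)) - ons_scale 2 (ons_A (k - m))"
  "m > 0 \<Longrightarrow> n > 0 \<Longrightarrow> ons_bracket (ons_G m) (ons_G n) = 0"
proof -
  show "ons_bracket (ons_A k) (ons_A l) = ons_G (k - l)"
    by (simp add: ons_A_def)
  show "ons_bracket (ons_G m) (ons_A k) =
     ons_scale 2 (ons_A (k + m)) - ons_scale 2 (ons_A (k - m))" if "m > 0"
  proof -
    have "int (nat m - 1) + 1 = m"
      using that by simp
    then show ?thesis
      using that by (simp add: ons_A_def ons_G_def)
  qed
  show "ons_bracket (ons_G m) (ons_G n) = 0" if "m > 0" "n > 0"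
    using that by (simp add: ons_G_def)
qed


section \<open>Automorphic Lie algebras\<close>

definition upper_half_plane :: "complex set" where
  "upper_half_plane = {\<tau>. Im \<tau> > 0}"

definition SL2Z :: "(int^2^2) set" where
  "SL2Z = {\<gamma>. det \<gamma> = 1}"

definition moebius :: "int^2^2 \<Rightarrow> complex \<Rightarrow> complex" where
  "moebius \<gamma> \<tau> =
     (of_int (\<gamma>$1$1) * \<tau> + of_int (\<gamma>$1$2)) / (of_int (\<gamma>$2$1) * \<tau> + of_int (\<gamma>$2$2))"

datatype cusp = Cusp_Inf | Cusp rat

fun cusp_act :: "int^2^2 \<Rightarrow> cusp \<Rightarrow> cusp" where
  "cusp_act \<gamma> Cusp_Inf =
     (if \<gamma>$2$1 = 0 then Cusp_Inf else Cusp (of_int (\<gamma>$1$1) / of_int (\<gamma>$2$1)))"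
| "cusp_act \<gamma> (Cusp r) =
     (if of_int (\<gamma>$2$1) * r + of_int (\<gamma>$2$2) = 0 then Cusp_Inf
      else Cusp ((of_int (\<gamma>$1$1) * r + of_int (\<gamma>$1$2)) /
                 (of_int (\<gamma>$2$1) * r + of_int (\<gamma>$2$2))))"

definition exp_growth_at_cusps :: "(complex \<Rightarrow> complex^'n^'n) \<Rightarrow> bool" where
  "exp_growth_at_cusps f \<longleftrightarrow>
     (\<forall>s. \<forall>g\<in>SL2Z. cusp_act g s = Cusp_Inf \<longrightarrow>
        (\<exists>C M Y :: real. \<forall>\<tau>\<in>upper_half_plane.
           Im (moebius g \<tau>) > Y \<longrightarrow> norm (f \<tau>) < C * exp (M * cmod (moebius g \<tau>))))"

definition mscale :: "complex \<Rightarrow> complex^'n^'m \<Rightarrow> complex^'n^'m" where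
  "mscale c A = map_matrix ((*) c) A"

definition commutator :: "complex^'n^'n \<Rightarrow> complex^'n^'n \<Rightarrow> complex^'n^'n" where
  "commutator A B = A ** B - B ** A"

definition sl :: "(complex^'n^'n) set" where
  "sl = {A. trace A = 0}"

text \<open>A map on the upper half-plane is represented by its extension by zero to the complex
  plane, so that equality of the representing functions is equality of the maps. Holomorphy of
  a matrix-valued map is holomorphy of its entries.\<close>

definition automorphic_lie_algebra ::
  "(complex^'n^'n) set \<Rightarrow> (int^2^2) set \<Rightarrow> (int^2^2 \<Rightarrow> complex^'n^'n \<Rightarrow> complex^'n^'n)
     \<Rightarrow> (complex \<Rightarrow> complex^'n^'n) lie_struct" where
  "automorphic_lie_algebra \<gg> \<Gamma> \<rho> =
     \<lparr>lie_carrier =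
        {f. (\<forall>\<tau>. \<tau> \<notin> upper_half_plane \<longrightarrow> f \<tau> = 0) \<and>
            (\<forall>\<tau>\<in>upper_half_plane. f \<tau> \<in> \<gg>) \<and>
            (\<forall>i j. (\<lambda>\<tau>. f \<tau> $ i $ j) holomorphic_on upper_half_plane) \<and>
            (\<forall>\<gamma>\<in>\<Gamma>. \<forall>\<tau>\<in>upper_half_plane. f (moebius \<gamma> \<tau>) = \<rho> \<gamma> (f \<tau>)) \<and>
            exp_growth_at_cusps f},
      lie_scale = (\<lambda>c f \<tau>. mscale c (f \<tau>)),
      lie_bracket = (\<lambda>f g \<tau>. commutator (f \<tau>) (g \<tau>))\<rparr>"

definition Ad :: "int^2^2 \<Rightarrow> complex^2^2 \<Rightarrow> complex^2^2" where
  "Ad \<gamma> A = map_matrix of_int \<gamma> ** A ** matrix_inv (map_matrix of_int \<gamma>)"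


section \<open>Eisenstein series and the generators\<close>

definition divisor_sigma :: "nat \<Rightarrow> nat \<Rightarrow> nat" where
  "divisor_sigma k n = (\<Sum>d | d dvd n. d ^ k)"

definition nome :: "complex \<Rightarrow> complex" where
  "nome \<tau> = exp (2 * of_real pi * \<i> * \<tau>)"

text \<open>The constants are \<open>-2k/B\<^sub>k\<close> for \<open>k = 2, 4, 6\<close>. The summation index is shifted to start
  at \<open>n = 1\<close>.\<close>

definition E2 :: "complex \<Rightarrow> complex" where
  "E2 \<tau> = 1 - 24 * (suminf (\<lambda>n. of_nat (divisor_sigma 1 (Suc n)) * nome \<tau> ^ Suc n))"

definition E4 :: "complex \<Rightarrow> complex" where
  "E4 \<tau> = 1 + 240 * (suminf (\<lambda>n. of_nat (divisor_sigma 3 (Suc n)) * nome \<tau> ^ Suc n))"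

definition E6 :: "complex \<Rightarrow> complex" where
  "E6 \<tau> = 1 - 504 * (suminf (\<lambda>n. of_nat (divisor_sigma 5 (Suc n)) * nome \<tau> ^ Suc n))"

definition mod_discr :: "complex \<Rightarrow> complex" where
  "mod_discr \<tau> = (E4 \<tau> ^ 3 - E6 \<tau> ^ 2) / 1728"

definition klein_j :: "complex \<Rightarrow> complex" where
  "klein_j \<tau> = E4 \<tau> ^ 3 / mod_discr \<tau>"

definition a_fun :: "complex \<Rightarrow> complex" where
  "a_fun \<tau> = 2 * of_real pi * \<i> * E2 \<tau> / 12"

definition Phi1 :: "complex \<Rightarrow> complex^2^2" where
  "Phi1 \<tau> = vector [vector [1 + \<tau> * a_fun \<tau>, \<tau>], vector [a_fun \<tau>, 1]]"

definition h_bar :: "complex \<Rightarrow> complex^2^2" where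
  "h_bar \<tau> =
     (if \<tau> \<in> upper_half_plane
      then Phi1 \<tau> ** vector [vector [1, 0], vector [0, -1]] ** matrix_inv (Phi1 \<tau>)
      else 0)"

definition e_bar :: "complex \<Rightarrow> complex^2^2" where
  "e_bar \<tau> =
     (if \<tau> \<in> upper_half_plane
      then mscale (inverse (mod_discr \<tau>) * E4 \<tau> * E6 \<tau>)
             (Phi1 \<tau> ** vector [vector [0, 1], vector [0, 0]] ** matrix_inv (Phi1 \<tau>))
      else 0)"

definition f_bar :: "complex \<Rightarrow> complex^2^2" where
  "f_bar \<tau> =
     (if \<tau> \<in> upper_half_plane
      then mscale (inverse (mod_discr \<tau>) * E4 \<tau> ^ 2 * E6 \<tau>)
             (Phi1 \<tau> ** vector [vector [0, 0], vector [1, 0]] ** matrix_inv (Phi1 \<tau>))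
      else 0)"

definition A1_bar :: "complex \<Rightarrow> complex^2^2" where
  "A1_bar \<tau> =
     mscale (1 / 1728)
       (mscale (2 * klein_j \<tau> - 1728) (h_bar \<tau>) - mscale 2 (e_bar \<tau>) + mscale 2 (f_bar \<tau>))"

end

theory Submission
  imports Defs "HOL-Real_Asymp.Real_Asymp"
begin

notation upper_half_plane ("\<H>")

text \<open>The series \<open>E\<^sub>2, E\<^sub>4, E\<^sub>6\<close> are the Taylor coefficients of a zeta function with simple poles at
  the lattice \<open>\<int> + \<int>\<tau>\<close>. Comparing it with the rescaled zeta function of \<open>- 1 / \<tau>\<close> by Liouville's
  argument yields the three transformation laws at once. The law for \<open>E\<^sub>2\<close> makes the product form of
  the discriminant modular, so it equals \<open>\<Delta>\<close> and \<open>\<Delta>\<close> has no zeros. Conjugation by \<open>\<Phi>\<^sub>1\<close> turns an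
  equivariant map into a triple of weakly holomorphic forms of weights \<open>0, - 2, 2\<close>, and these are
  polynomials in \<open>j\<close> times \<open>1, E\<^sub>4 E\<^sub>6 / \<Delta>, E\<^sub>4\<^sup>2 E\<^sub>6 / \<Delta>\<close>.

  On the other side, \<open>h = A\<^sub>0\<close> and \<open>a = A\<^sub>1\<close> are pointwise involutions. With \<open>U = a h\<close> the assignment
  \<open>A\<^sub>k \<mapsto> U\<^sup>k h\<close>, \<open>G\<^sub>m \<mapsto> U\<^sup>m - U\<^sup>-\<^sup>m\<close> is a homomorphism by computation in the infinite dihedral group.
  Its image is closed under multiplication by \<open>j\<close> because \<open>U + U\<^sup>-\<^sup>1\<close> is scalar and affine in \<open>j\<close>,
  which gives surjectivity. Injectivity follows by evaluation on eigenvectors of \<open>U\<close>, whose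
  eigenvalues take infinitely many values, and the Jacobi identity of the Onsager algebra is
  inherited from the matrices.\<close>

text \<open>Each of the two zeta functions is periodic in one lattice direction and jumps by a
  constant in the other, and inversion exchanges the two directions. A single multiple of z absorbs
  both jumps. It has degree one in z, so among the Taylor coefficients it disturbs only the law for
  \<open>E2\<close>. Vanishing of forms rests on a maximum principle for |f|^2 (Im \<tau>)^k instead
  of a count of zeros. With the cut-off height 1/2 it reaches only weights k < 2 pi m, where m is
  the order of vanishing at the cusp. Weight 12 is out of reach for m = 1 but not for m = 2, since
  12 < 4 pi; this is why the two forms of the discriminant have to agree modulo q^2 before they can
  be identified. The constants in \<open>A1_bar\<close> come from the elliptic points: s = (2j -
  1728) / 1728 sends the values 0 and 1728 of j to -1 and 1, so s^2 - 1 = j (j - 1728) / 864^2. This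
  identity makes a an involution, and 2s is the trace of the rotation U.\<close>

section \<open>Eisenstein series as Lambert series\<close>

lemma divisor_sigma_le: "divisor_sigma k (Suc n) \<le> Suc n ^ Suc k"
proof -
  have "{d. d dvd Suc n} \<subseteq> {1..Suc n}"
  proof (rule subsetI)
    fix d assume "d \<in> {d. d dvd Suc n}"
    then have "d dvd Suc n" by simp
    with dvd_pos_nat[OF _ this] dvd_imp_le[OF this] show "d \<in> {1..Suc n}" by simp
  qed
  then have "divisor_sigma k (Suc n) \<le> (\<Sum>d\<in>{1..Suc n}. d ^ k)"
    unfolding divisor_sigma_def by (intro sum_mono2) auto
  also have "\<dots> \<le> (\<Sum>d\<in>{1..Suc n}. Suc n ^ k)"
    by (intro sum_mono power_mono) auto
  finally show ?thesis by simp
qed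

lemma summable_polynomial_geometric:
  fixes x :: real
  assumes "0 \<le> x" "x < 1"
  shows "summable (\<lambda>n. real (Suc n ^ k) * x ^ n)"
proof (cases "x = 0")
  case True
  have "summable (\<lambda>n. if n = 0 then 1 else (0::real))" by (rule summable_single)
  then show ?thesis using True by (simp add: power_0_left if_distrib cong: if_cong)
next
  case False
  with assms have x: "0 < x" by simp
  have "conv_radius (\<lambda>n. real (Suc n ^ k)) = 1"
  proof (rule conv_radius_ratio_limit_nonzero)
    show "(\<lambda>n. norm (real (Suc n ^ k)) / norm (real (Suc (Suc n) ^ k))) \<longlonglongrightarrow> 1"
    proof -
      have "(\<lambda>n. (real (Suc n) / real (Suc (Suc n))) ^ k) \<longlonglongrightarrow> 1 ^ k"
        by (intro tendsto_power LIMSEQ_Suc[OF LIMSEQ_n_over_Suc_n])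
      then show ?thesis by (simp add: power_divide norm_power flip: of_nat_Suc)
    qed
  qed auto
  then show ?thesis
    using assms by (intro summable_in_conv_radius) (auto simp: one_ereal_def)
qed

text \<open>One factor \<open>q\<close> is taken out of the Eisenstein sum. The remaining power
  series has value 1 at 0, which supplies the leading coefficients needed for the discriminant; for
  \<open>k = 1\<close> it is also the function whose primitive enters the product form.\<close>

definition sigma_series :: "nat \<Rightarrow> complex \<Rightarrow> complex" where
  "sigma_series k q = suminf (\<lambda>n. of_nat (divisor_sigma k (Suc n)) * q ^ n)"

definition eisen_series :: "nat \<Rightarrow> complex \<Rightarrow> complex" where
  "eisen_series k q = suminf (\<lambda>n. of_nat (divisor_sigma k (Suc n)) * q ^ Suc n)"

lemma summable_sigma:
  assumes "cmod q < 1"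
  shows "summable (\<lambda>n. of_nat (divisor_sigma k (Suc n)) * q ^ n)"
proof (rule summable_comparison_test')
  show "summable (\<lambda>n. real (Suc n ^ Suc k) * cmod q ^ n)"
    using assms by (intro summable_polynomial_geometric) auto
  show "norm (of_nat (divisor_sigma k (Suc n)) * q ^ n) \<le> real (Suc n ^ Suc k) * cmod q ^ n" if "n \<ge> 0" for n
    using divisor_sigma_le[of k n]
    by (auto simp: norm_mult norm_power intro!: mult_right_mono simp del: of_nat_power power_Suc)
qed

lemma sigma_series_holomorphic: "sigma_series k holomorphic_on ball 0 1"
proof (rule power_series_holomorphic)
  fix w :: complex assume "w \<in> ball 0 1"
  then have "cmod w < 1" by simp
  from summable_sums[OF summable_sigma[OF this, of k]]
  show "(\<lambda>n. of_nat (divisor_sigma k (Suc n)) * (w - 0) ^ n) sums sigma_series k w"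
    by (simp add: sigma_series_def)
qed

lemma sigma_series_0: "sigma_series k 0 = 1"
proof -
  have "{d :: nat. d dvd Suc 0} = {1}" by auto
  then have "divisor_sigma k (Suc 0) = 1" unfolding divisor_sigma_def by simp
  then show ?thesis unfolding sigma_series_def powser_zero by simp
qed

lemma eisen_series_factor:
  assumes "cmod q < 1"
  shows "eisen_series k q = q * sigma_series k q"
  unfolding eisen_series_def sigma_series_def
  by (subst suminf_mult[OF summable_sigma[OF assms], symmetric]) (simp add: algebra_simps)

lemma eisen_series_holomorphic: "eisen_series k holomorphic_on ball 0 1"
proof -
  have "(\<lambda>q. q * sigma_series k q) holomorphic_on ball 0 1"
    by (intro holomorphic_intros sigma_series_holomorphic)
  then show ?thesis
    by (rule holomorphic_transform) (auto simp: eisen_series_factor)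
qed

lemma norm_nome: "cmod (nome \<tau>) = exp (- 2 * pi * Im \<tau>)"
  by (simp add: nome_def)

lemma norm_nome_less_1: "\<tau> \<in> \<H> \<Longrightarrow> cmod (nome \<tau>) < 1"
  by (simp add: norm_nome upper_half_plane_def)

lemma nome_nonzero [simp]: "nome \<tau> \<noteq> 0"
  by (simp add: nome_def)

lemma E2_eq: "E2 \<tau> = 1 - 24 * eisen_series 1 (nome \<tau>)"
  and E4_eq: "E4 \<tau> = 1 + 240 * eisen_series 3 (nome \<tau>)"
  and E6_eq: "E6 \<tau> = 1 - 504 * eisen_series 5 (nome \<tau>)"
  by (simp_all add: E2_def E4_def E6_def eisen_series_def)

lemma nome_plus_1 [simp]: "nome (\<tau> + 1) = nome \<tau>"
proof -
  have "nome (\<tau> + 1) = nome \<tau> * exp (2 * of_real pi * \<i>)"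
    unfolding nome_def exp_add[symmetric] by (rule arg_cong[of _ _ exp]) (simp add: algebra_simps)
  then show ?thesis by (simp add: exp_two_pi_i)
qed

lemma nome_holomorphic [holomorphic_intros]: "nome holomorphic_on S"
  unfolding nome_def by (intro holomorphic_intros)

lemma open_upper_half_plane [simp]: "open \<H>"
  unfolding upper_half_plane_def by (rule open_halfspace_Im_gt)

lemma upper_half_plane_convex: "convex \<H>"
  unfolding upper_half_plane_def by (rule convex_halfspace_Im_gt)

lemma upper_half_plane_connected: "connected \<H>"
  by (rule convex_connected[OF upper_half_plane_convex])

lemma eisen_series_nome_holomorphic:
  "(\<lambda>\<tau>. eisen_series k (nome \<tau>)) holomorphic_on \<H>"
proof -
  have "(eisen_series k \<circ> nome) holomorphic_on \<H>"
    by (rule holomorphic_on_compose_gen[OF nome_holomorphic eisen_series_holomorphic])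
       (auto simp: norm_nome_less_1)
  then show ?thesis by (simp add: o_def)
qed

lemma E2_holomorphic [holomorphic_intros]: "E2 holomorphic_on \<H>"
  and E4_holomorphic [holomorphic_intros]: "E4 holomorphic_on \<H>"
  and E6_holomorphic [holomorphic_intros]: "E6 holomorphic_on \<H>"
  unfolding E2_eq[abs_def] E4_eq[abs_def] E6_eq[abs_def]
  by (intro holomorphic_intros eisen_series_nome_holomorphic)+

text \<open>Each \<open>q ^ m / (1 - q ^ m)\<close> is a geometric series in \<open>q ^ m\<close>.
  The double sum over \<open>(m, n)\<close> is regrouped by the product \<open>N = m * n\<close>,
  where the divisors \<open>m\<close> of \<open>N\<close> contribute
  \<open>divisor_sigma k N\<close>. The polynomial bound for \<open>divisor_sigma\<close> gives the
  absolute convergence that permits this.\<close>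

lemma lambert_series:
  assumes q: "cmod q < 1"
  shows "(\<lambda>m. of_nat (Suc m) ^ k * (q ^ Suc m / (1 - q ^ Suc m))) sums eisen_series k q"
proof -
  define f :: "nat \<Rightarrow> nat \<Rightarrow> complex" where "f = (\<lambda>m n. of_nat m ^ k * q ^ (m * n))"
  have geo: "(f m has_sum (of_nat m ^ k * (q ^ m / (1 - q ^ m)))) {1..}" if m: "m \<ge> 1" for m
  proof -
    have "cmod (q ^ m) < 1" using q m by (simp add: norm_power power_less_one_iff)
    then have "((\<lambda>n. (q ^ m) ^ n) has_sum (q ^ m / (1 - q ^ m))) {1..}"
      by (rule has_sum_geometric_from_1)
    then show ?thesis unfolding f_def
      by (intro has_sum_cmult_right) (simp add: power_mult)
  qed
  define D where "D = Sigma {1::nat..} (\<lambda>N. {d. d dvd N})"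
  define F :: "nat \<times> nat \<Rightarrow> complex" where "F = (\<lambda>(N, d). of_nat d ^ k * q ^ N)"
  have fin: "finite {d. d dvd N}" if "N \<in> {1..}" for N :: nat
    using that by (intro finite_divisors_nat) auto
  have Suc_range: "{1..} = range Suc"
    by (auto simp: image_iff dest: Suc_le_D)
  have "(\<lambda>x. norm (F x)) summable_on D" unfolding D_def
  proof (rule summable_on_SigmaI)
    fix N :: nat assume N: "N \<in> {1..}"
    have "((\<lambda>d. norm (F (N, d))) has_sum (\<Sum>d | d dvd N. norm (F (N, d)))) {d. d dvd N}"
      by (intro has_sum_finite fin N)
    also have "(\<Sum>d | d dvd N. norm (F (N, d))) = of_nat (divisor_sigma k N) * cmod q ^ N"
      by (simp add: F_def divisor_sigma_def norm_mult norm_power sum_distrib_right)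
    finally show "((\<lambda>d. norm (F (N, d))) has_sum of_nat (divisor_sigma k N) * cmod q ^ N) {d. d dvd N}" .
  next
    have "summable (\<lambda>n. cmod q * norm (of_nat (divisor_sigma k (Suc n)) * of_real (cmod q) ^ n :: complex))"
    proof (intro summable_mult, rule summable_comparison_test')
      show "summable (\<lambda>n. real (Suc n ^ Suc k) * cmod q ^ n)"
        using assms by (intro summable_polynomial_geometric) auto
      show "norm (norm (of_nat (divisor_sigma k (Suc n)) * of_real (cmod q) ^ n :: complex)) \<le> real (Suc n ^ Suc k) * cmod q ^ n" if "n \<ge> 0" for n
        using divisor_sigma_le[of k n]
        by (auto simp: norm_mult norm_power intro!: mult_right_mono simp del: of_nat_power power_Suc)
    qed
    then have "summable (\<lambda>n. real (divisor_sigma k (Suc n)) * cmod q ^ Suc n)"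
      by (simp add: norm_mult norm_power mult_ac)
    then have "(\<lambda>n. real (divisor_sigma k (Suc n)) * cmod q ^ Suc n) summable_on UNIV"
      by (subst summable_on_UNIV_nonneg_real_iff) auto
    then show "(\<lambda>N. real (divisor_sigma k N) * cmod q ^ N) summable_on {1..}"
      by (subst Suc_range, subst summable_on_reindex) (auto simp: o_def)
  qed auto
  then have sumF: "F summable_on D"
    by (rule abs_summable_summable)
  have "(F has_sum (infsum F D)) D" using sumF by (rule has_sum_infsum)
  then have tot1: "((\<lambda>N. of_nat (divisor_sigma k N) * q ^ N) has_sum (infsum F D)) {1..}"
    unfolding D_def
  proof (rule has_sum_SigmaD)
    fix N :: nat assume N: "N \<in> {1..}"
    have "((\<lambda>d. F (N, d)) has_sum (\<Sum>d | d dvd N. F (N, d))) {d. d dvd N}"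
      by (intro has_sum_finite fin N)
    also have "(\<Sum>d | d dvd N. F (N, d)) = of_nat (divisor_sigma k N) * q ^ N"
      by (simp add: F_def divisor_sigma_def sum_distrib_right)
    finally show "((\<lambda>d. F (N, d)) has_sum of_nat (divisor_sigma k N) * q ^ N) {d. d dvd N}" .
  qed
  then have "((\<lambda>n. of_nat (divisor_sigma k (Suc n)) * q ^ Suc n) has_sum (infsum F D)) UNIV"
    by (subst (asm) Suc_range, subst (asm) has_sum_reindex) (auto simp: o_def)
  then have D_eq: "infsum F D = eisen_series k q"
    unfolding eisen_series_def by (intro sums_unique has_sum_imp_sums)
  have "((\<lambda>(m, n). f m n) has_sum eisen_series k q) ({1..} \<times> {1..}) \<longleftrightarrow> (F has_sum eisen_series k q) D"
    unfolding D_def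
  proof (rule has_sum_reindex_bij_witness[of _ "\<lambda>(N, d). (d, N div d)" "\<lambda>(m, n). (m * n, m)"])
    fix b assume "b \<in> Sigma {1::nat..} (\<lambda>N. {d. d dvd N})"
    then obtain d n where b: "b = (d * n, d)" "d * n \<ge> 1" by (auto elim!: dvdE)
    then have "d \<ge> 1" "n \<ge> 1" by (cases d; cases n; simp)+
    with b show "(case b of (N, d) \<Rightarrow> (d, N div d)) \<in> {1..} \<times> {1..}"
      "(case case b of (N, d) \<Rightarrow> (d, N div d) of (m, n) \<Rightarrow> (m * n, m)) = b" by auto
  qed (auto simp: f_def F_def)
  with \<open>(F has_sum (infsum F D)) D\<close> D_eq
  have "((\<lambda>(m, n). f m n) has_sum eisen_series k q) ({1..} \<times> {1..})" by simp
  then have "((\<lambda>m. of_nat m ^ k * (q ^ m / (1 - q ^ m))) has_sum eisen_series k q) {1..}"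
    by (rule has_sum_SigmaD) (use geo in auto)
  then have "((\<lambda>m. of_nat (Suc m) ^ k * (q ^ Suc m / (1 - q ^ Suc m))) has_sum eisen_series k q) UNIV"
    by (subst (asm) Suc_range, subst (asm) has_sum_reindex) (auto simp: o_def)
  then show ?thesis by (rule has_sum_imp_sums)
qed

text \<open>The summand with \<open>m = 0\<close> vanishes because its denominator is \<open>0\<close>.\<close>

definition lambert :: "nat \<Rightarrow> complex \<Rightarrow> complex \<Rightarrow> complex" where
  "lambert k q w = suminf (\<lambda>m. of_nat m ^ k * (q ^ m / (1 - q ^ m)) * w ^ m)"

text \<open>The coefficients decay like \<open>q ^ m\<close>, so the series converges beyond the
  unit disc. With \<open>w = nome z\<close> and \<open>w = nome (- z)\<close> this margin yields the
  strip |Im z| < Im \<tau> around the real axis.\<close>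

lemma summable_lambert:
  assumes q: "cmod q < 1" and w: "cmod (q * w) < 1"
  shows "summable (\<lambda>m. of_nat m ^ k * (q ^ m / (1 - q ^ m)) * w ^ m)"
proof -
  have "summable (\<lambda>m. of_nat (Suc m) ^ k * (q ^ Suc m / (1 - q ^ Suc m)) * w ^ Suc m)"
  proof (rule summable_comparison_test')
    show "summable (\<lambda>n. cmod (q * w) / (1 - cmod q) * (real (Suc n ^ k) * cmod (q * w) ^ n))"
      using w by (intro summable_mult summable_polynomial_geometric) auto
    fix n :: nat
    have "cmod (q ^ Suc n) \<le> cmod q"
      using q by (simp add: norm_mult norm_power mult_left_le power_le_one)
    then have "1 - cmod q \<le> cmod (1 - q ^ Suc n)"
      using norm_triangle_ineq2[of 1 "q ^ Suc n"] by simp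
    with q have "inverse (cmod (1 - q ^ Suc n)) \<le> inverse (1 - cmod q)"
      by (intro le_imp_inverse_le) auto
    then have "cmod (q * w) ^ Suc n * real (Suc n ^ k) * inverse (cmod (1 - q ^ Suc n)) \<le>
        cmod (q * w) ^ Suc n * real (Suc n ^ k) * inverse (1 - cmod q)"
      by (intro mult_left_mono) auto
    then show "cmod (of_nat (Suc n) ^ k * (q ^ Suc n / (1 - q ^ Suc n)) * w ^ Suc n) \<le>
        cmod (q * w) / (1 - cmod q) * (real (Suc n ^ k) * cmod (q * w) ^ n)"
      by (simp add: norm_mult norm_power norm_divide power_mult_distrib divide_simps mult_ac
               del: of_nat_Suc)
  qed
  then show ?thesis by (subst (asm) summable_Suc_iff)
qed

lemma lambert_1:
  assumes "cmod q < 1"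
  shows "lambert k q 1 = eisen_series k q"
proof -
  have "(\<lambda>m. of_nat m ^ k * (q ^ m / (1 - q ^ m))) sums eisen_series k q"
    using lambert_series[OF assms, of k] by (subst (asm) sums_Suc_iff) simp
  then show ?thesis by (simp add: lambert_def sums_iff)
qed

text \<open>Replacing \<open>w\<close> by \<open>q * w\<close> multiplies the m-th term by
  \<open>q ^ m\<close>; in the difference the factor \<open>1 - q ^ m\<close> cancels the
  denominator and a geometric series remains. This produces the jump of the zeta function in the
  direction \<tau>.\<close>

lemma lambert_shift:
  assumes q: "cmod q < 1" and w: "cmod (q * w) < 1"
  shows "lambert 0 q (q * w) = lambert 0 q w - q * w / (1 - q * w)"
proof -
  let ?a = "\<lambda>m. q ^ m / (1 - q ^ m)"
  have "cmod (q * (q * w)) < 1"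
    using mult_strict_mono'[of "cmod q" 1 "cmod (q * w)" 1] q w by (simp add: norm_mult)
  then have "lambert 0 q w - lambert 0 q (q * w) =
      suminf (\<lambda>m. of_nat m ^ 0 * ?a m * w ^ m - of_nat m ^ 0 * ?a m * (q * w) ^ m)"
    unfolding lambert_def using assms by (intro suminf_diff summable_lambert)
  also have "(\<lambda>m. of_nat m ^ 0 * ?a m * w ^ m - of_nat m ^ 0 * ?a m * (q * w) ^ m) =
      (\<lambda>m. if m = 0 then 0 else (q * w) ^ m)" (is "?l = ?r")
  proof
    fix m
    show "?l m = ?r m"
    proof (cases "m = 0")
      case False
      then have "cmod (q ^ m) < 1" using q by (simp add: norm_power power_less_one_iff)
      then have "1 - q ^ m \<noteq> 0" by auto
      then obtain a where a: "a = ?a m" "a * (1 - q ^ m) = q ^ m" by simp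
      have "?l m = a * w ^ m - a * (q ^ m * w ^ m)"
        by (simp add: a(1) power_mult_distrib)
      also have "\<dots> = a * (1 - q ^ m) * w ^ m" by (simp add: algebra_simps)
      also note a(2)
      finally have "?l m = q ^ m * w ^ m" .
      with False show ?thesis
        by (simp add: power_mult_distrib)
    qed simp
  qed
  also have "suminf ?r = q * w / (1 - q * w)"
  proof -
    have "(\<lambda>m. (q * w) ^ Suc m) sums (q * w * (1 / (1 - q * w)))"
      unfolding power_Suc by (intro sums_mult geometric_sums w)
    then have "(\<lambda>m. ?r (Suc m)) sums (q * w / (1 - q * w))" by simp
    then have "?r sums (q * w / (1 - q * w))"
      by (subst (asm) sums_Suc_iff) simp
    then show ?thesis by (simp add: sums_iff)
  qed
  finally show ?thesis by (simp add: algebra_simps)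
qed

text \<open>Each derivative in \<open>z\<close> brings down a factor \<open>c * m\<close> and
  thereby raises \<open>k\<close> by one. Starting from \<open>k = 0\<close>, the successive
  derivatives of one function at 0 run through the Lambert series behind \<open>E2\<close>,
  \<open>E4\<close> and \<open>E6\<close>.\<close>

lemma lambert_exp_has_field_derivative:
  assumes q: "cmod q < 1" "q \<noteq> 0" and z: "cmod (q * exp (c * z)) < 1"
  shows "((\<lambda>z. lambert k q (exp (c * z))) has_field_derivative
           c * lambert (Suc k) q (exp (c * z))) (at z)"
proof -
  let ?a = "\<lambda>m. of_nat m ^ k * (q ^ m / (1 - q ^ m))"
  define w where "w = exp (c * z)"
  have bound: "cmod (q * w) < 1 \<longleftrightarrow> cmod w < 1 / cmod q" for w
    using q by (simp add: norm_mult field_simps)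
  have D: "((\<lambda>w. suminf (\<lambda>m. ?a m * w ^ m)) has_field_derivative suminf (\<lambda>m. diffs ?a m * w ^ m)) (at w)"
    using z unfolding w_def[symmetric]
    by (intro termdiffs_strong'[where K = "1 / cmod q"] summable_lambert q)
       (simp_all add: bound)
  have "(\<lambda>m. of_nat m ^ Suc k * (q ^ m / (1 - q ^ m)) * w ^ m) sums lambert (Suc k) q w"
    unfolding lambert_def using q z w_def by (intro summable_sums summable_lambert) auto
  then have "(\<lambda>m. of_nat (Suc m) ^ Suc k * (q ^ Suc m / (1 - q ^ Suc m)) * w ^ Suc m) sums lambert (Suc k) q w"
    by (subst sums_Suc_iff) simp
  then have "(\<lambda>m. of_nat (Suc m) ^ Suc k * (q ^ Suc m / (1 - q ^ Suc m)) * w ^ Suc m / w) sums (lambert (Suc k) q w / w)"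
    by (rule sums_divide)
  also have "(\<lambda>m. of_nat (Suc m) ^ Suc k * (q ^ Suc m / (1 - q ^ Suc m)) * w ^ Suc m / w) = (\<lambda>m. diffs ?a m * w ^ m)"
    by (simp add: diffs_def w_def fun_eq_iff)
  finally have "suminf (\<lambda>m. diffs ?a m * w ^ m) = lambert (Suc k) q w / w"
    by (simp add: sums_iff)
  with D have D': "(lambert k q has_field_derivative lambert (Suc k) q w / w) (at w)"
    by (simp add: lambert_def[abs_def])
  show ?thesis
  proof (rule DERIV_cong)
    show "((\<lambda>z. lambert k q (exp (c * z))) has_field_derivative
        lambert (Suc k) q w / w * (w * c)) (at z)"
      by (rule DERIV_chain2[where f = "lambert k q" and g = "\<lambda>z. exp (c * z)"])
         (use D' in \<open>auto intro!: derivative_eq_intros simp: w_def\<close>)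
  qed (auto simp: w_def)
qed

text \<open>This is \<open>1 / (exp u - 1) - 1 / u\<close> with its limit at 0 inserted; the Taylor
  coefficients are the Bernoulli numbers \<open>B_(n+1) / (n+1)!\<close>. Written as one fraction it
  is a quotient of two power series of order two, to which division of expansions applies.\<close>

definition bern :: "complex \<Rightarrow> complex" where
  "bern u = (if u = 0 then -1/2 else (u - (exp u - 1)) / (u * (exp u - 1)))"

definition bern_fps :: "complex fps" where
  "bern_fps = (fps_X - (fps_exp 1 - 1)) / (fps_X * (fps_exp 1 - 1))"

lemma bern_denominator_subdegree: "subdegree (fps_X * (fps_exp 1 - 1) :: complex fps) = 2"
  by (rule subdegreeI) (auto simp: fps_mult_nth numeral_2_eq_2 less_Suc_eq)

lemma bern_numerator_subdegree: "subdegree (fps_X - (fps_exp 1 - 1) :: complex fps) = 2"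
  by (rule subdegreeI) (auto simp: numeral_2_eq_2 less_Suc_eq)

lemma bern_has_fps_expansion: "bern has_fps_expansion bern_fps"
proof -
  have "(\<lambda>u. if u = 0 then -1/2 else (u - (exp u - 1)) / (u * (exp u - 1))) has_fps_expansion bern_fps"
    unfolding bern_fps_def
  proof (rule has_fps_expansion_divide)
    show "(\<lambda>u::complex. u - (exp u - 1)) has_fps_expansion fps_X - (fps_exp 1 - 1)"
      "(\<lambda>u::complex. u * (exp u - 1)) has_fps_expansion fps_X * (fps_exp 1 - 1)"
      by (intro fps_expansion_intros)+
    show "(fps_X * (fps_exp 1 - 1) :: complex fps) \<noteq> 0"
      using bern_denominator_subdegree by auto
  qed (auto simp: bern_denominator_subdegree bern_numerator_subdegree fps_mult_nth numeral_2_eq_2)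
  then show ?thesis by (simp add: bern_def[abs_def])
qed

lemma bern_fps_mult: "bern_fps * (fps_X * (fps_exp 1 - 1)) = fps_X - (fps_exp 1 - 1)"
  unfolding bern_fps_def
proof (rule dvd_div_mult_self)
  show "fps_X * (fps_exp 1 - 1) dvd (fps_X - (fps_exp 1 - 1) :: complex fps)"
  proof (subst fps_dvd_iff)
    show "(fps_X * (fps_exp 1 - 1) :: complex fps) \<noteq> 0" "(fps_X - (fps_exp 1 - 1) :: complex fps) \<noteq> 0"
      using bern_denominator_subdegree bern_numerator_subdegree by auto
  qed (simp add: bern_denominator_subdegree bern_numerator_subdegree)
qed

text \<open>Clearing the denominator gives a recursion that can be solved for coefficient
  \<open>n\<close>, because the linear coefficient of \<open>exp u - 1\<close> is 1. The odd entries
  1/12, -1/720 and 1/30240 become the normalising factors of \<open>E2\<close>, \<open>E4\<close>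
  and \<open>E6\<close>.\<close>

lemma bern_fps_nth:
  "fps_nth bern_fps 0 = -1/2" "fps_nth bern_fps 1 = 1/12" "fps_nth bern_fps 2 = 0"
  "fps_nth bern_fps 3 = -1/720" "fps_nth bern_fps 4 = 0" "fps_nth bern_fps 5 = 1/30240"
proof -
  have eq: "fps_nth (bern_fps * (fps_exp 1 - 1)) (Suc n) = fps_nth (fps_X - (fps_exp 1 - 1)) (Suc (Suc n))" for n
    unfolding bern_fps_mult[symmetric] by (simp add: mult.left_commute[of _ fps_X])
  have rec: "fps_nth bern_fps n = - 1 / fact (Suc (Suc n)) - (\<Sum>i<n. fps_nth bern_fps i / fact (Suc n - i))" for n
  proof -
    have "- 1 / fact (Suc (Suc n)) = (\<Sum>i\<le>Suc n. fps_nth bern_fps i * fps_nth (fps_exp 1 - 1) (Suc n - i))"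
      using eq[of n] by (simp add: fps_mult_nth atMost_atLeast0 del: fact_Suc)
    also have "\<dots> = (\<Sum>i\<le>n. fps_nth bern_fps i * fps_nth (fps_exp 1 - 1) (Suc n - i))"
      by simp
    also have "\<dots> = (\<Sum>i\<le>n. fps_nth bern_fps i / fact (Suc n - i))"
      by (intro sum.cong) auto
    also have "\<dots> = (\<Sum>i<n. fps_nth bern_fps i / fact (Suc n - i)) + fps_nth bern_fps n"
      by (simp flip: lessThan_Suc_atMost)
    finally show ?thesis by (simp add: algebra_simps)
  qed
  note simps = lessThan_Suc eval_nat_numeral
  have 0: "fps_nth bern_fps 0 = -1/2" by (subst rec) (simp add: simps)
  have 1: "fps_nth bern_fps (Suc 0) = 1/12" by (subst rec) (simp add: simps 0)
  have 2: "fps_nth bern_fps (Suc (Suc 0)) = 0" by (subst rec) (simp add: simps 0 1)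
  have 3: "fps_nth bern_fps (Suc (Suc (Suc 0))) = -1/720" by (subst rec) (simp add: simps 0 1 2)
  have 4: "fps_nth bern_fps (Suc (Suc (Suc (Suc 0)))) = 0"
    by (subst rec) (simp add: simps 0 1 2 3)
  have 5: "fps_nth bern_fps (Suc (Suc (Suc (Suc (Suc 0))))) = 1/30240"
    by (subst rec) (simp add: simps 0 1 2 3 4)
  from 0 1 2 3 4 5 show "fps_nth bern_fps 0 = -1/2" "fps_nth bern_fps 1 = 1/12" "fps_nth bern_fps 2 = 0"
    "fps_nth bern_fps 3 = -1/720" "fps_nth bern_fps 4 = 0" "fps_nth bern_fps 5 = 1/30240"
    by (simp_all add: eval_nat_numeral)
qed

lemma bern_analytic_at: "exp u \<noteq> 1 \<or> u = 0 \<Longrightarrow> bern analytic_on {u}"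
proof (cases "u = 0")
  case True
  then show ?thesis using has_fps_expansion_imp_analytic_0[OF bern_has_fps_expansion] by simp
next
  case False
  assume "exp u \<noteq> 1 \<or> u = 0"
  with False have u: "exp u \<noteq> 1" by simp
  have "eventually (\<lambda>v. v \<in> - {0}) (nhds u)"
    using False by (intro eventually_nhds_in_open) auto
  then have "eventually (\<lambda>v. bern v = (v - (exp v - 1)) / (v * (exp v - 1))) (nhds u)"
    by eventually_elim (simp add: bern_def)
  then have "bern analytic_on {u} \<longleftrightarrow> (\<lambda>v. (v - (exp v - 1)) / (v * (exp v - 1))) analytic_on {u}"
    by (rule analytic_at_cong) simp
  also have \<dots> using False u by (intro analytic_intros) auto
  finally show ?thesis .
qed

section \<open>The transformation laws under inversion\<close>

lemma nome_add: "nome (z + w) = nome z * nome w"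
  by (simp add: nome_def exp_add algebra_simps flip: exp_add)

lemma nome_minus: "nome (- z) = inverse (nome z)"
  by (simp add: nome_def exp_minus)

lemma nome_1 [simp]: "nome 1 = 1"
  by (simp add: nome_def)

lemma nome_eq_1_iff: "nome z = 1 \<longleftrightarrow> z \<in> \<int>"
proof
  assume "nome z = 1"
  then obtain n where "Re (2 * of_real pi * \<i> * z) = 0" "Im (2 * of_real pi * \<i> * z) = of_int (2 * n) * pi"
    by (auto simp: nome_def exp_eq_1)
  then have "z = of_int n" by (simp add: complex_eq_iff)
  then show "z \<in> \<int>" by simp
next
  assume "z \<in> \<int>"
  then obtain n where z: "z = of_int n" by (auto elim: Ints_cases)
  show "nome z = 1"
    unfolding nome_def exp_eq_1 z by (auto intro!: exI[of _ n])
qed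

text \<open>With q = \<open>nome \<tau>\<close> this is 4 pi times the sum of q^m / (1 - q^m) sin(2
  pi m z): the Weierstrass zeta function of the lattice without its cotangent and linear
  terms.\<close>

definition strip_part :: "complex \<Rightarrow> complex \<Rightarrow> complex" where
  "strip_part \<tau> z = - 2 * of_real pi * \<i> * (lambert 0 (nome \<tau>) (nome z) - lambert 0 (nome \<tau>) (nome (- z)))"

text \<open>The function pi cot(pi z) - 1/z, with the singularity at 0 filled in.\<close>

definition cot_part :: "complex \<Rightarrow> complex" where
  "cot_part z = 2 * of_real pi * \<i> * (1/2 + bern (2 * of_real pi * \<i> * z))"

lemma cot_part_eq:
  assumes "z \<noteq> 0" "nome z \<noteq> 1"
  shows "cot_part z = of_real pi * \<i> * (1 + 2 / (nome z - 1)) - 1 / z"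
proof -
  define u where "u = 2 * of_real pi * \<i> * z"
  have u: "u \<noteq> 0" "exp u \<noteq> 1" using assms by (auto simp: u_def nome_def)
  have "bern u = 1 / (exp u - 1) - 1 / u"
    using u by (simp add: bern_def divide_simps)
  then have "cot_part z = 2 * of_real pi * \<i> * (1/2 + 1 / (exp u - 1) - 1 / u)"
    unfolding cot_part_def u_def[symmetric] by (simp only: add_diff_eq)
  also have "\<dots> = of_real pi * \<i> * (1 + 2 / (exp u - 1)) - 2 * of_real pi * \<i> / u"
    by (simp add: ring_distribs)
  also have "2 * of_real pi * \<i> / u = 1 / z" using assms by (simp add: u_def)
  finally show ?thesis by (simp add: u_def nome_def)
qed

text \<open>Differentiation stays within this family of Lambert series, with a sign from the
  reflected argument. The formula is proved on the whole open strip because the induction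
  differentiates an identity and so needs it on a neighbourhood, although only the value at 0 is
  wanted.\<close>

lemma strip_part_analytic:
  assumes "Im \<tau> > 0"
  shows "strip_part \<tau> holomorphic_on {z. \<bar>Im z\<bar> < Im \<tau>}"
    and "z \<in> {z. \<bar>Im z\<bar> < Im \<tau>} \<Longrightarrow> (deriv ^^ n) (strip_part \<tau>) z =
           - 2 * of_real pi * \<i> * (2 * of_real pi * \<i>) ^ n *
             (lambert n (nome \<tau>) (nome z) - (-1) ^ n * lambert n (nome \<tau>) (nome (- z)))"
proof -
  let ?S = "{z. \<bar>Im z\<bar> < Im \<tau>}" and ?c = "2 * of_real pi * \<i> :: complex"
  define F where "F n z = - ?c * ?c ^ n *
             (lambert n (nome \<tau>) (nome z) - (-1) ^ n * lambert n (nome \<tau>) (nome (- z)))" for n z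
  have opn: "open ?S"
  proof -
    have "?S = {z. Im z < Im \<tau>} \<inter> {z. Im z > - Im \<tau>}" by auto
    then show ?thesis by (simp add: open_halfspace_Im_lt open_halfspace_Im_gt open_Int)
  qed
  have q: "cmod (nome \<tau>) < 1" using assms by (simp add: norm_nome)
  have lt: "cmod (nome \<tau> * nome z) < 1" "cmod (nome \<tau> * nome (- z)) < 1" if "z \<in> ?S" for z
    using that by (auto simp: norm_nome abs_less_iff simp flip: nome_add)
  have D: "(F n has_field_derivative F (Suc n) z) (at z)" if z: "z \<in> ?S" for n z
  proof -
    have 1: "((\<lambda>z. lambert n (nome \<tau>) (nome z)) has_field_derivative ?c * lambert (Suc n) (nome \<tau>) (nome z)) (at z)"
      using lt[OF z] unfolding nome_def by (intro lambert_exp_has_field_derivative q[unfolded nome_def]) auto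
    have 2: "((\<lambda>z. lambert n (nome \<tau>) (nome (- z))) has_field_derivative - ?c * lambert (Suc n) (nome \<tau>) (nome (- z))) (at z)"
      using lambert_exp_has_field_derivative[of "nome \<tau>" "- ?c" z n] lt[OF z] q unfolding nome_def by simp
    show ?thesis unfolding F_def
      by (rule derivative_eq_intros 1 2 refl)+ (simp add: algebra_simps)
  qed
  have F0: "strip_part \<tau> = F 0" by (simp add: F_def strip_part_def fun_eq_iff)
  show "strip_part \<tau> holomorphic_on ?S"
    unfolding F0 using D holomorphic_on_open[OF opn] by blast
  show "(deriv ^^ n) (strip_part \<tau>) z =
           - 2 * of_real pi * \<i> * (2 * of_real pi * \<i>) ^ n *
             (lambert n (nome \<tau>) (nome z) - (-1) ^ n * lambert n (nome \<tau>) (nome (- z)))"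
    if "z \<in> ?S" for z
  proof -
    have "(deriv ^^ n) (strip_part \<tau>) z = F n z" using that
    proof (induction n arbitrary: z)
      case 0
      then show ?case by (simp add: F0)
    next
      case (Suc n)
      have "eventually (\<lambda>z. z \<in> ?S) (nhds z)"
        using opn Suc.prems by (rule eventually_nhds_in_open)
      then have ev: "eventually (\<lambda>z. (deriv ^^ n) (strip_part \<tau>) z = F n z) (nhds z)"
        by eventually_elim (use Suc.IH in auto)
      have "(deriv ^^ Suc n) (strip_part \<tau>) z = deriv (F n) z"
        using deriv_cong_ev[OF ev refl] by simp
      also have "\<dots> = F (Suc n) z" by (rule DERIV_imp_deriv[OF D[OF Suc.prems]])
      finally show ?case .
    qed
    then show ?thesis by (simp add: F_def)
  qed
qed

text \<open>The Weierstrass zeta function minus its linear term; the first summand is pi cot(pi z).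
  Without the linear term the period 1 is exact, and the whole failure of periodicity sits in the
  direction \<tau>.\<close>

definition zeta_fun :: "complex \<Rightarrow> complex \<Rightarrow> complex" where
  "zeta_fun \<tau> z = of_real pi * \<i> * (1 + 2 / (nome z - 1)) + strip_part \<tau> z"

lemma zeta_fun_plus_1: "zeta_fun \<tau> (z + 1) = zeta_fun \<tau> z"
  unfolding zeta_fun_def strip_part_def by (simp only: nome_minus nome_add nome_1 mult_1_right)

text \<open>Both \<open>z\<close> and \<open>z + \<tau>\<close> have to lie in the strip where the
  Lambert series converge, which places \<open>z\<close> below the real axis and within distance Im
  \<tau> of it.\<close>

lemma zeta_fun_plus_period:
  assumes "Im z < 0" "- Im \<tau> < Im z"
  shows "zeta_fun \<tau> (z + \<tau>) = zeta_fun \<tau> z - 2 * of_real pi * \<i>"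
proof -
  define q w where "q = nome \<tau>" and "w = nome z"
  have q: "cmod q < 1" "q \<noteq> 0" using assms by (auto simp: q_def norm_nome)
  have w: "cmod w > 1" using assms by (simp add: w_def norm_nome mult_pos_neg)
  have qw: "cmod (q * w) < 1"
    using assms by (simp add: q_def w_def norm_nome flip: nome_add)
  have ne: "w \<noteq> 0" "w \<noteq> 1" "q * w \<noteq> 1" using w qw by auto
  have "cmod (inverse w) < 1" using w by (simp add: norm_inverse inverse_less_1_iff)
  have 1: "lambert 0 q (q * w) = lambert 0 q w - q * w / (1 - q * w)"
    using q qw by (intro lambert_shift)
  \<comment> \<open>The reflected series moves in the opposite direction: its new argument is
    \<open>inverse (q * w)\<close>, and the shift leads from there back to
    \<open>inverse w\<close>.\<close>
  have 2: "lambert 0 q (q * (inverse (q * w))) = lambert 0 q (inverse (q * w)) - q * inverse (q * w) / (1 - q * inverse (q * w))"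
    using q ne \<open>cmod (inverse w) < 1\<close> by (intro lambert_shift) (simp_all add: inverse_mult_distrib mult.assoc[symmetric])
  then have 2: "lambert 0 q (inverse (q * w)) = lambert 0 q (inverse w) + 1 / (w - 1)"
    using q ne by (simp add: field_simps)
  have "zeta_fun \<tau> (z + \<tau>) = of_real pi * \<i> * (1 + 2 / (q * w - 1)) - 2 * of_real pi * \<i> *
      (lambert 0 q w - q * w / (1 - q * w) - (lambert 0 q (inverse w) + 1 / (w - 1)))"
    unfolding 1[symmetric] 2[symmetric]
    unfolding zeta_fun_def strip_part_def nome_minus nome_add q_def w_def by (simp add: mult.commute)
  also have "\<dots> = of_real pi * \<i> * (1 + 2 * (1 / (w - 1))) - 2 * of_real pi * \<i> *
      (lambert 0 q w - lambert 0 q (inverse w)) + 2 * of_real pi * \<i> * (1 / (q * w - 1) + q * w / (1 - q * w))"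
    by (simp add: algebra_simps)
  also have "1 / (q * w - 1) + q * w / (1 - q * w) = -1"
    using ne by (simp add: divide_simps) (simp add: algebra_simps)
  finally show ?thesis
    by (simp add: zeta_fun_def strip_part_def nome_minus q_def w_def)
qed

section \<open>Comparison of the zeta functions of a lattice point and its inversion\<close>

lemma uhp_nonzero: "\<tau> \<in> \<H> \<Longrightarrow> \<tau> \<noteq> 0"
  by (auto simp: upper_half_plane_def)

lemma Im_inverse_uhp: "Im \<tau> > 0 \<Longrightarrow> Im (- 1 / \<tau>) > 0"
  by (simp add: Im_divide complex_eq_iff sum_power2_gt_zero_iff zero_less_divide_iff)

text \<open>The difference of the two zeta functions on the open parallelogram spanned by \<open>\<plusminus> 1\<close> and
  \<open>\<plusminus> \<tau>\<close>, where both series converge: \<open>\<bar>Im z\<bar> < Im \<tau>\<close> bounds the \<open>\<tau>\<close>-coordinate and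
  \<open>\<bar>Im (z / \<tau>)\<bar> < Im (- 1 / \<tau>)\<close> bounds the \<open>1\<close>-coordinate.\<close>

definition zeta_diff :: "complex \<Rightarrow> complex \<Rightarrow> complex" where
  "zeta_diff \<tau> z = cot_part z + strip_part \<tau> z
     - (1 / \<tau>) * (cot_part (z / \<tau>) + strip_part (- 1 / \<tau>) (z / \<tau>)) + 2 * of_real pi * \<i> / \<tau> * z"

definition pgram :: "complex \<Rightarrow> complex set" where
  "pgram \<tau> = {z. \<bar>Im z\<bar> < Im \<tau>} \<inter> {z. \<bar>Im (z / \<tau>)\<bar> < Im (- 1 / \<tau>)}"

text \<open>An integer multiple of 1 or of \<tau> in the parallelogram has its coefficient strictly
  between -1 and 1, so it is 0. Hence neither cotangent term has a pole there other than the one at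
  0, which \<open>cot_part\<close> removes.\<close>

lemma pgram_nome:
  assumes \<tau>: "Im \<tau> > 0" and z: "z \<in> pgram \<tau>" "z \<noteq> 0"
  shows "nome z \<noteq> 1" "nome (z / \<tau>) \<noteq> 1"
proof -
  have b: "Im (- 1 / \<tau>) > 0" by (rule Im_inverse_uhp[OF \<tau>])
  show "nome z \<noteq> 1"
  proof
    assume "nome z = 1"
    then obtain n where n: "z = of_int n" by (auto simp: nome_eq_1_iff elim: Ints_cases)
    then have "Im (z / \<tau>) = - (of_int n * Im (- 1 / \<tau>))"
      by (simp add: Im_divide)
    then have "\<bar>of_int n\<bar> * Im (- 1 / \<tau>) < 1 * Im (- 1 / \<tau>)"
      using z b by (simp add: pgram_def abs_mult)
    then have "\<bar>of_int n :: real\<bar> < 1" using b by (subst (asm) mult_less_cancel_right) auto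
    then show False using n z by auto
  qed
  show "nome (z / \<tau>) \<noteq> 1"
  proof
    assume "nome (z / \<tau>) = 1"
    then obtain n where "z / \<tau> = of_int n" by (auto simp: nome_eq_1_iff elim: Ints_cases)
    moreover have "\<tau> \<noteq> 0" using \<tau> by auto
    ultimately have n: "z = of_int n * \<tau>" by (simp add: field_simps)
    then have "\<bar>of_int n\<bar> * Im \<tau> < 1 * Im \<tau>"
      using z \<tau> by (simp add: pgram_def abs_mult)
    then have "\<bar>of_int n :: real\<bar> < 1" using \<tau> by (subst (asm) mult_less_cancel_right) auto
    then show False using n z by auto
  qed
qed

text \<open>The poles removed in the two cotangent parts are equal, since \<open>1 / \<tau>\<close>
  times the reciprocal of \<open>z / \<tau>\<close> is \<open>1 / z\<close>. So the definition by
  regular parts extends the difference of the zeta functions to 0, while the translation laws are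
  read off from the zeta functions themselves.\<close>

lemma zeta_diff_eq:
  assumes \<tau>: "Im \<tau> > 0" and z: "z \<in> pgram \<tau>" "z \<noteq> 0"
  shows "zeta_diff \<tau> z = zeta_fun \<tau> z - (1 / \<tau>) * zeta_fun (- 1 / \<tau>) (z / \<tau>) + 2 * of_real pi * \<i> / \<tau> * z"
proof -
  have ne: "z / \<tau> \<noteq> 0" "\<tau> \<noteq> 0" using z \<tau> by auto
  have cancel: "t * y = x \<Longrightarrow> (a - x + r) - t * (b - y + r') + l = (a + r) - t * (b + r') + l"
    for a b r r' l t x y :: complex
    by (simp add: algebra_simps)
  show ?thesis
    unfolding zeta_diff_def zeta_fun_def cot_part_eq[OF z(2) pgram_nome(1)[OF assms]]
      cot_part_eq[OF ne(1) pgram_nome(2)[OF assms]]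
    by (rule cancel) (use ne in simp)
qed

lemma open_pgram: "open (pgram \<tau>)"
proof (cases "\<tau> = 0")
  case True
  then show ?thesis by (simp add: pgram_def)
next
  case False
  then have "open {z. \<bar>Im z\<bar> < Im \<tau>}" "open {z. \<bar>Im (z / \<tau>)\<bar> < Im (- 1 / \<tau>)}"
    by (intro open_Collect_less continuous_intros; simp)+
  then show ?thesis unfolding pgram_def by (rule open_Int)
qed

lemma convex_pgram: "convex (pgram \<tau>)"
proof -
  have lin: "linear (\<lambda>z. z / \<tau>)" by (intro linearI) (auto simp: add_divide_distrib scaleR_conv_of_real)
  have eq: "{z. \<bar>Im z\<bar> < c} = {z. Im z < c} \<inter> {z. Im z > - c}" for c by auto
  have cv: "convex {z. \<bar>Im z\<bar> < c}" for c unfolding eq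
    by (intro convex_Int convex_halfspace_Im_lt convex_halfspace_Im_gt)
  have "pgram \<tau> = {z. \<bar>Im z\<bar> < Im \<tau>} \<inter> ((\<lambda>z. z / \<tau>) -` {z. \<bar>Im z\<bar> < Im (- 1 / \<tau>)})"
    by (auto simp: pgram_def)
  then show ?thesis by (simp only: convex_Int convex_linear_vimage cv lin)
qed

lemma zeta_diff_holomorphic:
  assumes \<tau>: "Im \<tau> > 0"
  shows "zeta_diff \<tau> holomorphic_on pgram \<tau>"
proof -
  have ne: "\<tau> \<noteq> 0" using \<tau> by auto
  have s1: "strip_part \<tau> holomorphic_on pgram \<tau>"
    by (rule holomorphic_on_subset[OF strip_part_analytic(1)[OF \<tau>]]) (auto simp: pgram_def)
  have "(strip_part (- 1 / \<tau>) \<circ> (\<lambda>z. z / \<tau>)) holomorphic_on pgram \<tau>"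
    by (rule holomorphic_on_compose_gen[OF _ strip_part_analytic(1)[OF Im_inverse_uhp[OF \<tau>]]])
       (use ne in \<open>auto simp: pgram_def intro!: holomorphic_intros\<close>)
  then have s2: "(\<lambda>z. strip_part (- 1 / \<tau>) (z / \<tau>)) holomorphic_on pgram \<tau>" by (simp add: o_def)
  have "(\<lambda>z. bern (2 * of_real pi * \<i> * z)) analytic_on {z}" if "z \<in> pgram \<tau>" for z
  proof -
    have "(bern \<circ> (\<lambda>z. 2 * of_real pi * \<i> * z)) analytic_on {z}"
      by (intro analytic_on_compose analytic_intros)
         (use bern_analytic_at[of "2 * of_real pi * \<i> * z"] pgram_nome(1)[OF \<tau> that] in \<open>auto simp: nome_def\<close>)
    then show ?thesis by (simp add: o_def)
  qed
  then have c1: "(\<lambda>z. bern (2 * of_real pi * \<i> * z)) holomorphic_on pgram \<tau>"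
    by (meson analytic_imp_holomorphic analytic_on_analytic_at)
  have "(\<lambda>z. bern (2 * of_real pi * \<i> * (z / \<tau>))) analytic_on {z}" if "z \<in> pgram \<tau>" for z
  proof -
    have "(bern \<circ> (\<lambda>z. 2 * of_real pi * \<i> * (z / \<tau>))) analytic_on {z}"
      by (intro analytic_on_compose analytic_intros)
         (use bern_analytic_at[of "2 * of_real pi * \<i> * (z / \<tau>)"] pgram_nome(2)[OF \<tau> that] ne in \<open>auto simp: nome_def\<close>)
    then show ?thesis by (simp add: o_def)
  qed
  then have c2: "(\<lambda>z. bern (2 * of_real pi * \<i> * (z / \<tau>))) holomorphic_on pgram \<tau>"
    by (meson analytic_imp_holomorphic analytic_on_analytic_at)
  show ?thesis unfolding zeta_diff_def cot_part_def
    by (intro holomorphic_intros s1 s2 c1 c2) (use ne in auto)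
qed

text \<open>Adding 1 to \<open>z\<close> moves \<open>z / \<tau>\<close> backwards by the period
  \<open>- 1 / \<tau>\<close>, so the second zeta function gains 2 pi i. Its weight
  \<open>1 / \<tau>\<close> turns this into exactly the increment of the linear term.\<close>

lemma zeta_diff_plus_1:
  assumes \<tau>: "Im \<tau> > 0" and z: "z \<in> pgram \<tau>" "Im (z / \<tau>) > 0"
  shows "z + 1 \<in> pgram \<tau>" "zeta_diff \<tau> (z + 1) = zeta_diff \<tau> z"
proof -
  have ne: "\<tau> \<noteq> 0" using \<tau> by auto
  have e: "(z + 1) / \<tau> = z / \<tau> - (- 1 / \<tau>)" using ne by (simp add: field_simps)
  have Im: "Im ((z + 1) / \<tau>) = Im (z / \<tau>) - Im (- 1 / \<tau>)" unfolding e by simp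
  show z1: "z + 1 \<in> pgram \<tau>" using z Im by (auto simp: pgram_def)
  have "z \<noteq> 0" using z by auto
  have "z + 1 \<noteq> 0"
  proof
    assume "z + 1 = 0"
    then have "Im ((z + 1) / \<tau>) = 0" by simp
    with Im z show False by (auto simp: pgram_def)
  qed
  have "zeta_fun (- 1 / \<tau>) ((z + 1) / \<tau> + - 1 / \<tau>) = zeta_fun (- 1 / \<tau>) ((z + 1) / \<tau>) - 2 * of_real pi * \<i>"
    by (rule zeta_fun_plus_period) (use z Im in \<open>auto simp: pgram_def\<close>)
  then have "zeta_fun (- 1 / \<tau>) ((z + 1) / \<tau>) = zeta_fun (- 1 / \<tau>) (z / \<tau>) + 2 * of_real pi * \<i>"
    by (simp add: add_divide_distrib)
  then show "zeta_diff \<tau> (z + 1) = zeta_diff \<tau> z"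
    unfolding zeta_diff_eq[OF \<tau> z(1) \<open>z \<noteq> 0\<close>] zeta_diff_eq[OF \<tau> z1 \<open>z + 1 \<noteq> 0\<close>] zeta_fun_plus_1
    by (simp add: ring_distribs)
qed

lemma zeta_diff_plus_period:
  assumes \<tau>: "Im \<tau> > 0" and z: "z \<in> pgram \<tau>" "Im z < 0"
  shows "z + \<tau> \<in> pgram \<tau>" "zeta_diff \<tau> (z + \<tau>) = zeta_diff \<tau> z"
proof -
  have ne: "\<tau> \<noteq> 0" using \<tau> by auto
  have e: "(z + \<tau>) / \<tau> = z / \<tau> + 1" using ne by (simp add: field_simps)
  show z1: "z + \<tau> \<in> pgram \<tau>" using z \<tau> by (auto simp: pgram_def e)
  have "z \<noteq> 0" "z + \<tau> \<noteq> 0" using z by (auto simp: pgram_def complex_eq_iff)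
  have "zeta_fun \<tau> (z + \<tau>) = zeta_fun \<tau> z - 2 * of_real pi * \<i>"
    by (rule zeta_fun_plus_period) (use z in \<open>auto simp: pgram_def\<close>)
  then show "zeta_diff \<tau> (z + \<tau>) = zeta_diff \<tau> z"
    using zeta_diff_eq[OF \<tau> z(1) \<open>z \<noteq> 0\<close>] zeta_diff_eq[OF \<tau> z1 \<open>z + \<tau> \<noteq> 0\<close>] ne
    by (simp add: zeta_fun_plus_1 e ring_distribs)
qed

text \<open>No extension to the plane is made. Shifts by 1 and \<tau>, with either sign, bring each
  point of the open parallelogram into the closed one \<open>K\<close> of half the size without
  leaving the former. So the maximum over \<open>K\<close> is a maximum over an open connected set,
  and the maximum modulus principle applies. A shift by \<tau> fixes \<open>Im (z / \<tau>)\<close>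
  and a shift by 1 fixes \<open>Im z\<close>, so the two coordinates are reduced one after the
  other.\<close>

lemma zeta_diff_constant:
  assumes \<tau>: "Im \<tau> > 0"
  shows "zeta_diff \<tau> constant_on pgram \<tau>"
proof -
  define b where "b = Im (- 1 / \<tau>)"
  have b: "b > 0" unfolding b_def by (rule Im_inverse_uhp[OF \<tau>])
  have ne: "\<tau> \<noteq> 0" using \<tau> by auto
  define K where "K = {z. \<bar>Im z\<bar> \<le> Im \<tau> / 2} \<inter> {z. \<bar>Im (z / \<tau>)\<bar> \<le> b / 2}"
  have sub: "K \<subseteq> pgram \<tau>" using \<tau> b by (auto simp: K_def pgram_def b_def)
  have "compact K"
  proof -
    have "closed K" unfolding K_def
      by (intro closed_Int closed_Collect_le continuous_intros) (use ne in auto)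
    moreover have "bounded K"
    proof (rule boundedI)
      fix z assume z: "z \<in> K"
      have 1: "Im (z / \<tau>) = (Im z * Re \<tau> - Re z * Im \<tau>) / (cmod \<tau>)\<^sup>2"
        by (simp add: Im_divide cmod_power2)
      have "Re z = (Im z * Re \<tau> - Im (z / \<tau>) * (cmod \<tau>)\<^sup>2) / Im \<tau>"
        unfolding 1 using \<tau> ne by (simp add: field_simps)
      then have "\<bar>Re z\<bar> = \<bar>Im z * Re \<tau> - Im (z / \<tau>) * (cmod \<tau>)\<^sup>2\<bar> / Im \<tau>"
        using \<tau> by simp
      also have "\<dots> \<le> (\<bar>Im z * Re \<tau>\<bar> + \<bar>Im (z / \<tau>) * (cmod \<tau>)\<^sup>2\<bar>) / Im \<tau>"
        using \<tau> by (intro divide_right_mono abs_triangle_ineq4) auto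
      also have "\<dots> \<le> (Im \<tau> / 2 * \<bar>Re \<tau>\<bar> + b / 2 * (cmod \<tau>)\<^sup>2) / Im \<tau>"
        using \<tau> z unfolding abs_mult K_def
        by (intro divide_right_mono add_mono mult_mono) auto
      finally have "\<bar>Re z\<bar> \<le> (Im \<tau> / 2 * \<bar>Re \<tau>\<bar> + b / 2 * (cmod \<tau>)\<^sup>2) / Im \<tau>" .
      then show "cmod z \<le> (Im \<tau> / 2 * \<bar>Re \<tau>\<bar> + b / 2 * (cmod \<tau>)\<^sup>2) / Im \<tau> + Im \<tau> / 2"
        using z cmod_le[of z] by (auto simp: K_def)
    qed
    ultimately show ?thesis by (simp add: compact_eq_bounded_closed)
  qed
  moreover have "0 \<in> K" using \<tau> b by (auto simp: K_def)
  moreover have "continuous_on K (\<lambda>z. cmod (zeta_diff \<tau> z))"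
    using zeta_diff_holomorphic[OF \<tau>] sub
    by (intro continuous_on_norm holomorphic_on_imp_continuous_on) (rule holomorphic_on_subset)
  ultimately obtain \<xi> where \<xi>: "\<xi> \<in> K" "\<And>z. z \<in> K \<Longrightarrow> cmod (zeta_diff \<tau> z) \<le> cmod (zeta_diff \<tau> \<xi>)"
    using continuous_attains_sup[of K "\<lambda>z. cmod (zeta_diff \<tau> z)"] by auto
  have strip: "cmod (zeta_diff \<tau> z) \<le> cmod (zeta_diff \<tau> \<xi>)"
    if z: "z \<in> pgram \<tau>" "\<bar>Im (z / \<tau>)\<bar> \<le> b / 2" for z
  proof -
    have "(z + \<tau>) / \<tau> = z / \<tau> + 1" "(z - \<tau>) / \<tau> = z / \<tau> - 1" using ne by (simp_all add: field_simps)
    then have Im: "Im ((z + \<tau>) / \<tau>) = Im (z / \<tau>)" "Im ((z - \<tau>) / \<tau>) = Im (z / \<tau>)" by simp_all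
    consider "\<bar>Im z\<bar> \<le> Im \<tau> / 2" | "Im z < - (Im \<tau> / 2)" | "Im z > Im \<tau> / 2" by linarith
    then show ?thesis
    proof cases
      case 1
      then show ?thesis using z by (intro \<xi>) (auto simp: K_def)
    next
      case 2
      then have "Im z < 0" using \<tau> by linarith
      from zeta_diff_plus_period[OF \<tau> z(1) this] have "z + \<tau> \<in> K" "zeta_diff \<tau> (z + \<tau>) = zeta_diff \<tau> z"
        using 2 z Im by (auto simp: K_def pgram_def)
      then show ?thesis using \<xi>(2)[of "z + \<tau>"] by simp
    next
      case 3
      have w: "z - \<tau> \<in> pgram \<tau>" "Im (z - \<tau>) < 0"
        using 3 z Im \<tau> by (auto simp: pgram_def)
      from zeta_diff_plus_period[OF \<tau> w] have "z - \<tau> \<in> K" "zeta_diff \<tau> (z - \<tau>) = zeta_diff \<tau> z"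
        using 3 z w Im by (auto simp: K_def pgram_def)
      then show ?thesis using \<xi>(2)[of "z - \<tau>"] by simp
    qed
  qed
  have max: "cmod (zeta_diff \<tau> z) \<le> cmod (zeta_diff \<tau> \<xi>)" if z: "z \<in> pgram \<tau>" for z
  proof -
    have "(z + 1) / \<tau> = z / \<tau> - (- 1 / \<tau>)" "(z - 1) / \<tau> = z / \<tau> + (- 1 / \<tau>)"
      using ne by (simp_all add: field_simps)
    then have Im: "Im ((z + 1) / \<tau>) = Im (z / \<tau>) - b" "Im ((z - 1) / \<tau>) = Im (z / \<tau>) + b"
      unfolding b_def by simp_all
    consider "\<bar>Im (z / \<tau>)\<bar> \<le> b / 2" | "Im (z / \<tau>) < - (b / 2)" | "Im (z / \<tau>) > b / 2" by linarith
    then show ?thesis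
    proof cases
      case 1
      then show ?thesis using z by (intro strip)
    next
      case 3
      then have "Im (z / \<tau>) > 0" using b by linarith
      from zeta_diff_plus_1[OF \<tau> z this] show ?thesis
        using strip[of "z + 1"] 3 z Im by (auto simp: pgram_def b_def)
    next
      case 2
      have w: "z - 1 \<in> pgram \<tau>" "Im ((z - 1) / \<tau>) > 0"
        using 2 z Im b unfolding pgram_def b_def[symmetric] by auto
      from zeta_diff_plus_1[OF \<tau> w] show ?thesis
        using strip[of "z - 1"] 2 z w Im by (auto simp: pgram_def b_def)
    qed
  qed
  show ?thesis
    by (rule maximum_modulus_principle[OF zeta_diff_holomorphic[OF \<tau>] open_pgram
          convex_connected[OF convex_pgram] open_pgram subset_refl])
       (use \<xi>(1) sub max in auto)
qed

text \<open>A constant has no Taylor coefficients in degrees \<open>n \<ge> 1\<close>. Here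
  \<open>A \<tau>\<close> is the coefficient of \<open>cot_part\<close> plus
  \<open>strip_part\<close>; the substitution \<open>z / \<tau>\<close> and the prefactor
  \<open>1 / \<tau>\<close> combine to the exponent \<open>Suc n\<close>, the weight. The linear
  term is visible only for \<open>n = 1\<close>.\<close>

lemma zeta_diff_fps_nth:
  assumes \<tau>: "Im \<tau> > 0" and n: "n \<ge> 1"
  defines "c \<equiv> 2 * of_real pi * \<i>"
  defines "A \<equiv> \<lambda>\<tau>. c ^ Suc n * (fps_nth bern_fps n - (1 - (-1) ^ n) * eisen_series n (nome \<tau>) / fact n)"
  shows "A \<tau> - (1 / \<tau>) ^ Suc n * A (- 1 / \<tau>) + (if n = 1 then c / \<tau> else 0) = 0"
proof -
  have ne: "\<tau> \<noteq> 0" using \<tau> by auto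
  have zero: "0 \<in> pgram \<tau>" using \<tau> Im_inverse_uhp[OF \<tau>] by (auto simp: pgram_def)
  define C where "C = fps_const c * (fps_const (1/2) + (bern_fps oo (fps_const c * fps_X)))"
  have C: "cot_part has_fps_expansion C"
  proof -
    have "(\<lambda>z. c * (1/2 + (bern \<circ> (\<lambda>z. c * z)) z)) has_fps_expansion C" unfolding C_def
      by (intro fps_expansion_intros bern_has_fps_expansion) simp
    then show ?thesis by (simp add: cot_part_def[abs_def] c_def)
  qed
  define R where "R t = fps_expansion (strip_part t) 0" for t
  have R: "strip_part t has_fps_expansion R t" if "Im t > 0" for t
  proof -
    have "{z. \<bar>Im z\<bar> < Im t} = {z. Im z < Im t} \<inter> {z. Im z > - Im t}" by auto
    then have "open {z. \<bar>Im z\<bar> < Im t}" by (simp add: open_halfspace_Im_lt open_halfspace_Im_gt open_Int)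
    then show ?thesis unfolding R_def
      by (rule has_fps_expansion_fps_expansion[OF _ _ strip_part_analytic(1)[OF that]]) (use that in auto)
  qed
  have coeff: "fps_nth (C + R t) n = A t" if "Im t > 0" for t
  proof -
    have "fps_nth C n = c ^ Suc n * fps_nth bern_fps n"
      using n by (simp add: C_def fps_compose_linear)
    moreover have "fps_nth (R t) n = - (c ^ Suc n) * ((1 - (-1) ^ n) * eisen_series n (nome t) / fact n)"
    proof -
      have "(deriv ^^ n) (strip_part t) 0 = - (c ^ Suc n) * ((1 - (-1) ^ n) * eisen_series n (nome t))"
        using that by (simp add: strip_part_analytic(2)[OF that] c_def nome_def[of 0]
            lambert_1 norm_nome algebra_simps)
      then show ?thesis unfolding R_def by (simp add: fps_expansion_def)
    qed
    ultimately show ?thesis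
      unfolding A_def fps_add_nth by (simp only: right_diff_distrib mult_minus_left add_uminus_conv_diff)
  qed
  let ?t = "- 1 / \<tau>"
  have t: "Im ?t > 0" by (rule Im_inverse_uhp[OF \<tau>])
  define G where "G = C + R \<tau> - fps_const (1 / \<tau>) * ((C + R ?t) oo (fps_const (1 / \<tau>) * fps_X)) + fps_const (c / \<tau>) * fps_X"
  have "(\<lambda>z. cot_part z + strip_part \<tau> z - (1 / \<tau>) * (((\<lambda>z. cot_part z + strip_part ?t z) \<circ> (\<lambda>z. (1 / \<tau>) * z)) z) + c / \<tau> * z)
      has_fps_expansion G" unfolding G_def
    by (intro fps_expansion_intros C R \<tau> t) simp
  then have G: "zeta_diff \<tau> has_fps_expansion G"
    by (simp add: zeta_diff_def[abs_def] c_def)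
  obtain k where k: "\<And>z. z \<in> pgram \<tau> \<Longrightarrow> zeta_diff \<tau> z = k"
    using zeta_diff_constant[OF \<tau>] by (auto simp: constant_on_def)
  have "eventually (\<lambda>z. z \<in> pgram \<tau>) (nhds 0)"
    using open_pgram zero by (rule eventually_nhds_in_open)
  then have "eventually (\<lambda>z. zeta_diff \<tau> z = k) (nhds 0)"
    by eventually_elim (rule k)
  then have "(deriv ^^ n) (zeta_diff \<tau>) 0 = (deriv ^^ n) (\<lambda>_. k) 0"
    by (intro higher_deriv_cong_ev refl)
  then have "fps_nth G n = 0"
    using n by (simp add: fps_nth_fps_expansion[OF G] higher_deriv_const)
  moreover have "fps_nth G n = A \<tau> - (1 / \<tau>) ^ Suc n * A ?t + (if n = 1 then c / \<tau> else 0)"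
    using n coeff[OF \<tau>] coeff[OF t] unfolding G_def by (simp add: fps_compose_linear)
  ultimately show ?thesis by simp
qed

text \<open>In degree 1 the linear term survives as \<open>c / \<tau>\<close>; division by
  \<open>c\<^sup>2 / 12\<close>, the factor in front of \<open>E2\<close>, and multiplication by
  \<open>\<tau>\<^sup>2\<close> turn it into the anomalous summand.\<close>

lemma E2_inverse:
  assumes "\<tau> \<in> \<H>"
  shows "E2 (- 1 / \<tau>) = \<tau>\<^sup>2 * E2 \<tau> + 12 * \<tau> / (2 * of_real pi * \<i>)"
proof -
  have \<tau>: "Im \<tau> > 0" "\<tau> \<noteq> 0" using assms by (auto simp: upper_half_plane_def)
  define c where "c = (2 * of_real pi * \<i> :: complex)"
  have c: "c \<noteq> 0" by (simp add: c_def)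
  have e: "1/12 - 2 * eisen_series 1 (nome t) = E2 t / 12" for t
    by (simp add: E2_eq algebra_simps)
  have "c\<^sup>2 * (1/12 - 2 * eisen_series 1 (nome \<tau>)) - (1 / \<tau>)\<^sup>2 *
      (c\<^sup>2 * (1/12 - 2 * eisen_series 1 (nome (- 1 / \<tau>)))) + c / \<tau> = 0"
    using zeta_diff_fps_nth[OF \<tau>(1), of 1] unfolding bern_fps_nth c_def[symmetric]
    by (simp add: power2_eq_square)
  then have "c\<^sup>2 / 12 * E2 \<tau> - c\<^sup>2 / 12 * E2 (- 1 / \<tau>) / \<tau>\<^sup>2 + c / \<tau> = 0"
    unfolding e by (simp add: power_divide mult_ac)
  then have k: "c\<^sup>2 / 12 * E2 (- 1 / \<tau>) / \<tau>\<^sup>2 = c\<^sup>2 / 12 * E2 \<tau> + c / \<tau>"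
    by (simp add: algebra_simps)
  have "E2 (- 1 / \<tau>) = 12 * \<tau>\<^sup>2 / c\<^sup>2 * (c\<^sup>2 / 12 * E2 (- 1 / \<tau>) / \<tau>\<^sup>2)"
    using c \<tau> by simp
  also note k
  also have "12 * \<tau>\<^sup>2 / c\<^sup>2 * (c\<^sup>2 / 12 * E2 \<tau> + c / \<tau>) = \<tau>\<^sup>2 * E2 \<tau> + 12 * \<tau> / c"
    using c \<tau> by (simp add: distrib_left power2_eq_square)
  finally show ?thesis by (simp add: c_def)
qed

text \<open>For odd \<open>n\<close> the two Lambert series reinforce each other instead of
  cancelling, and \<open>n > 1\<close> avoids the linear term. The premises on \<open>b\<close>
  express that the Bernoulli coefficient is the factor that normalises \<open>E\<close> to constant
  term 1.\<close>

lemma eisenstein_inverse: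
  assumes \<tau>: "\<tau> \<in> \<H>" and n: "odd n" "n > 1"
    and b: "fps_nth bern_fps n = b" "b \<noteq> 0" "\<And>t. b - 2 * eisen_series n (nome t) / fact n = b * E t"
  shows "E (- 1 / \<tau>) = \<tau> ^ Suc n * E \<tau>"
proof -
  define c where "c = (2 * of_real pi * \<i> :: complex)"
  have c: "c \<noteq> 0" by (simp add: c_def)
  have "c ^ Suc n * (b * E \<tau>) - (1 / \<tau>) ^ Suc n * (c ^ Suc n * (b * E (- 1 / \<tau>))) = 0"
    using zeta_diff_fps_nth[of \<tau> n] \<tau> n
    unfolding c_def[symmetric] b(1) b(3)[symmetric] by (simp add: upper_half_plane_def)
  then have "(c ^ Suc n * b) * (E \<tau> - (1 / \<tau>) ^ Suc n * E (- 1 / \<tau>)) = 0"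
    by (simp only: right_diff_distrib mult_ac)
  then have "E \<tau> = (1 / \<tau>) ^ Suc n * E (- 1 / \<tau>)"
    using c b(2) by simp
  then show ?thesis using uhp_nonzero[OF \<tau>] by (simp add: power_one_over)
qed

lemma E4_inverse: "\<tau> \<in> \<H> \<Longrightarrow> E4 (- 1 / \<tau>) = \<tau> ^ 4 * E4 \<tau>"
  using eisenstein_inverse[of \<tau> 3 "-1/720" E4] bern_fps_nth(4)
  by (simp add: E4_eq fact_numeral field_simps)

lemma E6_inverse: "\<tau> \<in> \<H> \<Longrightarrow> E6 (- 1 / \<tau>) = \<tau> ^ 6 * E6 \<tau>"
  using eisenstein_inverse[of \<tau> 5 "1/30240" E6] bern_fps_nth(6)
  by (simp add: E6_eq fact_numeral field_simps)

section \<open>Vanishing of cusp forms of small weight\<close>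

lemma uhp_plus_1 [simp]: "\<tau> + 1 \<in> \<H> \<longleftrightarrow> \<tau> \<in> \<H>"
  by (simp add: upper_half_plane_def)

lemma uhp_inverse: "\<tau> \<in> \<H> \<Longrightarrow> - 1 / \<tau> \<in> \<H>"
  unfolding upper_half_plane_def using Im_inverse_uhp by simp

lemma Im_inverse: "Im (- 1 / \<tau>) = Im \<tau> / (cmod \<tau>)\<^sup>2"
  by (simp add: Im_divide cmod_power2)

lemma periodic_int:
  assumes "\<And>\<tau>. \<tau> \<in> \<H> \<Longrightarrow> u (\<tau> + 1) = u \<tau>" "\<tau> \<in> \<H>"
  shows "u (\<tau> + of_int n) = u \<tau>"
proof (induction n rule: int_induct[where k = 0])
  case (step1 i)
  then show ?case using assms(1)[of "\<tau> + of_int i"] assms(2)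
    by (simp add: upper_half_plane_def add_ac)
next
  case (step2 i)
  then show ?case using assms(1)[of "\<tau> + of_int (i - 1)"] assms(2)
    by (simp add: upper_half_plane_def add_ac)
qed simp

lemma translate_to_strip:
  assumes "\<And>\<tau>. \<tau> \<in> \<H> \<Longrightarrow> u (\<tau> + 1) = u \<tau>" "\<tau> \<in> \<H>"
  obtains \<tau>' where "\<tau>' \<in> \<H>" "\<bar>Re \<tau>'\<bar> \<le> 1 / 2" "Im \<tau>' = Im \<tau>" "u \<tau>' = u \<tau>"
proof -
  define n where "n = - round (Re \<tau>)"
  have "\<bar>Re \<tau> - of_int (round (Re \<tau>))\<bar> \<le> 1 / 2"
    using of_int_round_abs_le[of "Re \<tau>"] by (simp add: abs_minus_commute)
  then show ?thesis
    using assms(2) periodic_int[of u, OF assms, of n]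
    by (intro that[of "\<tau> + of_int n"]) (auto simp: upper_half_plane_def n_def)
qed

text \<open>Stopping at height \<open>1 / 2\<close> instead of in the fundamental domain makes termination
  obvious, since every inversion below that height at least doubles the imaginary part.\<close>

lemma reduce_to_half:
  assumes u: "\<And>\<tau>. \<tau> \<in> \<H> \<Longrightarrow> u (\<tau> + 1) = u \<tau>"
      "\<And>\<tau>. \<tau> \<in> \<H> \<Longrightarrow> u (- 1 / \<tau>) = u \<tau>"
    and \<tau>: "\<tau> \<in> \<H>"
  obtains \<tau>' where "\<bar>Re \<tau>'\<bar> \<le> 1 / 2" "Im \<tau>' \<ge> 1 / 2" "u \<tau>' = u \<tau>"
proof -
  have *: "\<exists>\<tau>'. \<bar>Re \<tau>'\<bar> \<le> 1 / 2 \<and> Im \<tau>' \<ge> 1 / 2 \<and> u \<tau>' = u \<tau>"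
    if "Im \<tau> \<ge> (1 / 2) ^ n" "\<tau> \<in> \<H>" for n \<tau>
    using that
  proof (induction n arbitrary: \<tau>)
    case 0
    obtain \<tau>1 where "\<bar>Re \<tau>1\<bar> \<le> 1 / 2" "Im \<tau>1 = Im \<tau>" "u \<tau>1 = u \<tau>"
      using translate_to_strip[of u, OF u(1) 0(2)] by blast
    then show ?case using 0 by (intro exI[of _ \<tau>1]) auto
  next
    case (Suc n)
    obtain \<tau>1 where t1: "\<tau>1 \<in> \<H>" "\<bar>Re \<tau>1\<bar> \<le> 1 / 2" "Im \<tau>1 = Im \<tau>" "u \<tau>1 = u \<tau>"
      using translate_to_strip[of u, OF u(1) Suc.prems(2)] by blast
    show ?case
    proof (cases "Im \<tau>1 \<ge> 1 / 2")
      case True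
      then show ?thesis using t1 by blast
    next
      case False
      have pos: "Im \<tau>1 > 0" using t1 by (simp add: upper_half_plane_def)
      have "(Re \<tau>1)\<^sup>2 \<le> (1 / 2)\<^sup>2" "(Im \<tau>1)\<^sup>2 \<le> (1 / 2)\<^sup>2"
        using t1 False pos by (intro abs_le_square_iff[THEN iffD1]; simp)+
      then have "(cmod \<tau>1)\<^sup>2 \<le> 1 / 2" unfolding cmod_power2 by (simp add: power2_eq_square)
      moreover have "(cmod \<tau>1)\<^sup>2 > 0" using pos by auto
      ultimately have "Im \<tau>1 / (cmod \<tau>1)\<^sup>2 \<ge> 2 * Im \<tau>1" using pos
        by (simp add: field_simps)
      then have "Im (- 1 / \<tau>1) \<ge> (1 / 2) ^ n"
        using Suc.prems(1) t1(3) unfolding Im_inverse by simp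
      from Suc.IH[OF this uhp_inverse[OF t1(1)]] show ?thesis
        using u(2)[OF t1(1)] t1(4) by simp
    qed
  qed
  obtain n where "(1 / 2 :: real) ^ n < Im \<tau>"
    using real_arch_pow_inv[of "Im \<tau>" "1 / 2"] \<tau> by (auto simp: upper_half_plane_def)
  with *[of n \<tau>] \<tau> that show ?thesis by auto
qed

lemma holomorphic_divide_zero:
  assumes "g holomorphic_on ball 0 r" "g 0 = 0"
  obtains h where "h holomorphic_on ball 0 r" "\<And>q. cmod q < r \<Longrightarrow> g q = q * h q"
  using Schwarz3[OF assms] by blast

lemma exp_decay_power:
  fixes a C e :: real
  assumes "a > 0" "e > 0"
  shows "\<exists>Y. \<forall>y\<ge>Y. C * (y ^ k * exp (- a * y)) < e"
proof -
  have "((\<lambda>y. C * (y ^ k * exp (- a * y))) \<longlongrightarrow> 0) at_top"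
    using assms(1) by real_asymp
  then have "eventually (\<lambda>y. C * (y ^ k * exp (- a * y)) < e) at_top"
    using assms(2) by (rule order_tendstoD)
  then show ?thesis by (simp add: eventually_at_top_linorder)
qed

text \<open>The function \<open>u\<close>, that is |f|^2 (Im \<tau>)^k, is invariant and small near
  the cusp, so it attains its maximum at some \<open>t1\<close> of height at least 1/2. At height y
  one has |g|^2 = u exp(4 pi m y) / y^k. The maximum principle for \<open>g\<close> bounds this
  value at \<open>t1\<close> by its counterpart at a smaller height, although the factor exp(4 pi m
  y) / y^k is smaller there. The bound on \<open>k\<close> says that this factor already increases
  from height 1/2 on.\<close>

lemma modular_vanishing:
  assumes hol: "f holomorphic_on \<H>"
    and T: "\<And>\<tau>. \<tau> \<in> \<H> \<Longrightarrow> f (\<tau> + 1) = f \<tau>"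
    and S: "\<And>\<tau>. \<tau> \<in> \<H> \<Longrightarrow> f (- 1 / \<tau>) = \<tau> ^ k * f \<tau>"
    and g: "g holomorphic_on ball 0 1" "\<And>\<tau>. \<tau> \<in> \<H> \<Longrightarrow> f \<tau> = nome \<tau> ^ m * g (nome \<tau>)"
    and k: "real k < 2 * pi * real m"
    and \<tau>: "\<tau> \<in> \<H>"
  shows "f \<tau> = 0"
proof (rule ccontr)
  assume nz: "f \<tau> \<noteq> 0"
  define u where "u \<tau> = (cmod (f \<tau>))\<^sup>2 * Im \<tau> ^ k" for \<tau>
  have m: "m > 0" using k by (cases "m = 0") auto
  have uT: "u (\<tau> + 1) = u \<tau>" if "\<tau> \<in> \<H>" for \<tau>
    using T[OF that] by (simp add: u_def)
  have uS: "u (- 1 / \<tau>) = u \<tau>" if "\<tau> \<in> \<H>" for \<tau>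
  proof -
    have "cmod \<tau> \<noteq> 0" using that by (auto simp: upper_half_plane_def)
    have "u (- 1 / \<tau>) = (cmod \<tau> ^ k * cmod (f \<tau>))\<^sup>2 * (Im \<tau> / (cmod \<tau>)\<^sup>2) ^ k"
      unfolding u_def Im_inverse S[OF that] by (simp add: norm_mult norm_power)
    also have "\<dots> = (cmod \<tau> ^ k)\<^sup>2 * (cmod (f \<tau>))\<^sup>2 * Im \<tau> ^ k / (cmod \<tau> ^ k)\<^sup>2"
      by (simp add: power_mult_distrib power_divide flip: power_mult) (simp add: mult.commute)
    also have "\<dots> = u \<tau>" using \<open>cmod \<tau> \<noteq> 0\<close> by (simp add: u_def)
    finally show ?thesis .
  qed
  have upos: "u \<tau> > 0" using nz \<tau> by (auto simp: u_def upper_half_plane_def)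
  have uq: "u t = (cmod (g (nome t)))\<^sup>2 * (Im t ^ k * exp (- (4 * pi * m) * Im t))"
    if "t \<in> \<H>" for t
  proof -
    have "(cmod (nome t) ^ m)\<^sup>2 = exp (- (4 * pi * m) * Im t)"
      by (simp add: norm_nome flip: exp_of_nat_mult power_mult)
    then show ?thesis by (simp add: u_def g(2)[OF that] norm_mult norm_power power_mult_distrib)
  qed
  obtain B where B: "\<And>t. Im t \<ge> 1 \<Longrightarrow> cmod (g (nome t)) \<le> B"
  proof -
    have lt: "cball (0::complex) (exp (- 2 * pi)) \<subseteq> ball 0 1" by (simp add: cball_subset_ball_iff)
    have "compact (cball (0::complex) (exp (- 2 * pi)))" by simp
    moreover have "continuous_on (cball 0 (exp (- 2 * pi))) g"
      by (rule holomorphic_on_imp_continuous_on[OF holomorphic_on_subset[OF g(1)]])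
         (rule lt)
    ultimately have "bounded (g ` cball 0 (exp (- 2 * pi)))"
      by (intro compact_imp_bounded compact_continuous_image)
    then obtain B where "\<forall>q\<in>cball 0 (exp (- 2 * pi)). cmod (g q) \<le> B"
      by (auto simp: bounded_iff)
    then show ?thesis by (intro that[of B]) (auto simp: norm_nome)
  qed
  obtain Y0 where Y0: "\<And>y. y \<ge> Y0 \<Longrightarrow> B\<^sup>2 * (y ^ k * exp (- (4 * pi * m) * y)) < u \<tau>"
    using exp_decay_power[of "4 * pi * m" "u \<tau>" "B\<^sup>2" k] m upos by auto
  define Y where "Y = max 1 Y0"
  have high: "u t < u \<tau>" if "Im t \<ge> Y" for t
  proof -
    have "t \<in> \<H>" "Im t \<ge> 1" using that by (auto simp: upper_half_plane_def Y_def)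
    then have "u t \<le> B\<^sup>2 * (Im t ^ k * exp (- (4 * pi * m) * Im t))"
      unfolding uq[OF \<open>t \<in> \<H>\<close>]
      using B[of t] by (intro mult_right_mono power_mono) auto
    also have "\<dots> < u \<tau>" using that by (intro Y0) (auto simp: Y_def)
    finally show ?thesis .
  qed
  define K where "K = cbox (Complex (-1/2) (1/2)) (Complex (1/2) Y)"
  have K: "t \<in> K \<longleftrightarrow> \<bar>Re t\<bar> \<le> 1 / 2 \<and> Im t \<ge> 1 / 2 \<and> Im t \<le> Y" for t
    by (auto simp: K_def in_cbox_complex_iff)
  have KH: "K \<subseteq> \<H>" by (auto simp: K upper_half_plane_def)
  have red: "\<exists>t'\<in>K. u t' = u t" if t: "t \<in> \<H>" "u t \<ge> u \<tau>" for t
  proof -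
    obtain t' where t': "\<bar>Re t'\<bar> \<le> 1 / 2" "Im t' \<ge> 1 / 2" "u t' = u t"
      using reduce_to_half[of u, OF uT uS t(1)] by blast
    with high[of t'] t(2) have "Im t' < Y" by (cases "Y \<le> Im t'") auto
    with t' show ?thesis by (intro bexI[of _ t']) (auto simp: K)
  qed
  have "K \<noteq> {}" using red[OF \<tau>] by auto
  moreover have "continuous_on K u"
    unfolding u_def
    by (intro continuous_intros holomorphic_on_imp_continuous_on holomorphic_on_subset[OF hol] KH)
  ultimately obtain t1 where t1: "t1 \<in> K" "\<And>t. t \<in> K \<Longrightarrow> u t \<le> u t1"
    using continuous_attains_sup[of K u] by (auto simp: K_def)
  have t1H: "t1 \<in> \<H>" using t1 KH by auto
  have ge: "u t1 \<ge> u \<tau>" using red[OF \<tau>] t1(2) by (metis order_refl)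
  have max: "u t \<le> u t1" if "t \<in> \<H>" for t
    using red[OF that] t1(2) ge by (metis linear order_trans)
  define y0 where "y0 = Im t1"
  have y0: "y0 \<ge> 1 / 2" using t1 by (simp add: K y0_def)
  have "real k < 4 * pi * m * y0"
  proof -
    have "2 * pi * m * 1 \<le> 2 * pi * m * (2 * y0)"
      using y0 by (intro mult_left_mono) auto
    also have "\<dots> = 4 * pi * m * y0" by simp
    finally show ?thesis using k by linarith
  qed
  then have "real k / (4 * pi * m) < y0" using m by (simp add: field_simps)
  \<comment> \<open>A height below that of \<open>t1\<close>, but still in the range where exp(4 pi
    m y) / y^k increases.\<close>
  then obtain y where y: "max 0 (real k / (4 * pi * m)) < y" "y < y0"
    using dense[of "max 0 (real k / (4 * pi * m))" y0] y0 by auto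
  have ky: "real k < 4 * pi * m * y" using y m by (simp add: field_simps)
  have ypos: "y > 0" using y(1) by (metis max_less_iff_conj)
  define r where "r = exp (- 2 * pi * y)"
  have r: "0 < r" "r < 1" using ypos by (auto simp: r_def)
  define W where "W = u t1 / y ^ k * exp (4 * pi * m * y)"
  have W0: "W \<ge> 0" using upos ge ypos by (simp add: W_def)
  \<comment> \<open>The circle of radius \<open>r\<close> consists of the nomes of points at height
    \<open>y\<close>, encloses \<open>nome t1\<close>, and \<open>u\<close> is at most
    \<open>u t1\<close> on it.\<close>
  have "cmod (g (nome t1)) \<le> sqrt W"
  proof (rule maximum_modulus_frontier[where f = g and S = "cball 0 r"])
    show "g holomorphic_on interior (cball 0 r)"
      by (rule holomorphic_on_subset[OF g(1)]) (use r in auto)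
    show "continuous_on (closure (cball 0 r)) g"
      by (rule holomorphic_on_imp_continuous_on[OF holomorphic_on_subset[OF g(1)]]) (use r in auto)
    show "nome t1 \<in> cball 0 r" using y by (simp add: norm_nome r_def y0_def)
  next
    fix q assume "q \<in> frontier (cball (0::complex) r)"
    then have qr: "cmod q = r" using r by (simp add: frontier_cball)
    then have q0: "q \<noteq> 0" using r by auto
    define t where "t = Ln q / (2 * of_real pi * \<i>)"
    have nt: "nome t = q" using q0 by (simp add: nome_def t_def)
    then have "exp (- 2 * pi * Im t) = exp (- 2 * pi * y)" using qr norm_nome[of t] by (simp add: r_def)
    then have Imt: "Im t = y" by simp
    then have tH: "t \<in> \<H>" using ypos by (simp add: upper_half_plane_def)
    have "(cmod (g q))\<^sup>2 = u t / y ^ k * exp (4 * pi * m * y)"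
      using uq[OF tH] ypos unfolding nt Imt by (simp add: exp_minus field_simps)
    also have "\<dots> \<le> W" unfolding W_def
      using max[OF tH] ypos by (intro mult_right_mono divide_right_mono) auto
    finally show "cmod (g q) \<le> sqrt W" by (simp add: real_le_rsqrt)
  qed simp
  then have "(cmod (g (nome t1)))\<^sup>2 \<le> W" using W0
    by (metis norm_ge_zero power_mono real_sqrt_pow2)
  moreover have "(cmod (g (nome t1)))\<^sup>2 = u t1 / y0 ^ k * exp (4 * pi * m * y0)"
    using uq[OF t1H] y0 by (simp add: exp_minus field_simps flip: y0_def)
  ultimately have "u t1 / y0 ^ k * exp (4 * pi * m * y0) \<le> u t1 / y ^ k * exp (4 * pi * m * y)"
    by (simp add: W_def)
  then have "u t1 * (exp (4 * pi * m * y0) / y0 ^ k) \<le> u t1 * (exp (4 * pi * m * y) / y ^ k)"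
    by simp
  then have "exp (4 * pi * m * y0) / y0 ^ k \<le> exp (4 * pi * m * y) / y ^ k"
    by (rule mult_left_le_imp_le) (use ge upos in linarith)
  then have "ln (exp (4 * pi * m * y0) / y0 ^ k) \<le> ln (exp (4 * pi * m * y) / y ^ k)"
    using ypos y0 by (subst ln_le_cancel_iff) auto
  then have "4 * pi * m * y0 - k * ln y0 \<le> 4 * pi * m * y - k * ln y"
    using ypos y0 by (simp add: ln_div ln_realpow)
  \<comment> \<open>The monotonicity of exp(4 pi m y) / y^k is used in logarithmic form, with ln x
    \<le> x - 1 in place of a derivative.\<close>
  then have "4 * pi * m * (y0 - y) \<le> k * (ln y0 - ln y)" by (simp add: algebra_simps)
  also have "ln y0 - ln y \<le> (y0 - y) / y"
    using ln_le_minus_one[of "y0 / y"] ypos y0 by (simp add: ln_div diff_divide_distrib)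
  finally have "4 * pi * m * (y0 - y) \<le> k * ((y0 - y) / y)"
    by (simp add: mult_left_mono)
  then have "4 * pi * m * y * (y0 - y) \<le> k * (y0 - y)"
    using ypos by (simp add: field_simps)
  then show False using ky y by (simp add: mult_le_cancel_right)
qed

section \<open>Expansions and growth at infinity\<close>

lemma nome_log:
  assumes "exp w = q" "q \<noteq> 0" "cmod q < 1"
  shows "w / (2 * of_real pi * \<i>) \<in> \<H>" "nome (w / (2 * of_real pi * \<i>)) = q"
proof -
  show n: "nome (w / (2 * of_real pi * \<i>)) = q" using assms by (simp add: nome_def)
  have "exp (- 2 * pi * Im (w / (2 * of_real pi * \<i>))) < exp 0"
    using assms(3) norm_nome[of "w / (2 * of_real pi * \<i>)"] unfolding n by simp
  then have "- 2 * pi * Im (w / (2 * of_real pi * \<i>)) < 0" unfolding exp_less_cancel_iff .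
  then show "w / (2 * of_real pi * \<i>) \<in> \<H>"
    by (simp add: upper_half_plane_def zero_less_mult_iff)
qed

lemma nome_eq_imp_periodic_eq:
  assumes "\<And>\<tau>. \<tau> \<in> \<H> \<Longrightarrow> f (\<tau> + 1) = f \<tau>"
    and "\<tau> \<in> \<H>" "nome \<tau> = nome \<tau>'"
  shows "f \<tau> = f \<tau>'"
proof -
  have "nome (\<tau>' - \<tau>) = 1"
    using assms(3) nome_add[of \<tau> "\<tau>' - \<tau>"] by simp
  then obtain n where "\<tau>' - \<tau> = of_int n" by (auto simp: nome_eq_1_iff elim: Ints_cases)
  then have "\<tau>' = \<tau> + of_int n" by (simp add: algebra_simps)
  then show ?thesis using periodic_int[of f, OF assms(1,2)] by simp
qed

text \<open>The principal logarithm jumps across the negative axis, where holomorphy of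
  \<open>F\<close> is not evident. Periodicity makes \<open>F\<close> independent of the branch, so
  the branch \<open>Ln (- q) + of_real pi * \<i>\<close> serves there; the two slit discs together
  cover the punctured disc.\<close>

lemma periodic_q_expansion:
  assumes hol: "f holomorphic_on \<H>"
    and T: "\<And>\<tau>. \<tau> \<in> \<H> \<Longrightarrow> f (\<tau> + 1) = f \<tau>"
  obtains F where "F holomorphic_on ball 0 1 - {0}" "\<And>\<tau>. \<tau> \<in> \<H> \<Longrightarrow> f \<tau> = F (nome \<tau>)"
proof -
  define l where "l q = Ln q / (2 * of_real pi * \<i>)" for q
  define F where "F q = f (l q)" for q
  have l: "l q \<in> \<H>" "nome (l q) = q" if "q \<in> ball 0 1 - {0}" for q
    using nome_log[of "Ln q" q] that by (auto simp: l_def)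
  have F: "f \<tau> = F (nome \<tau>)" if "\<tau> \<in> \<H>" for \<tau>
  proof -
    have "nome \<tau> \<in> ball 0 1 - {0}" using norm_nome_less_1[OF that] by simp
    from l(2)[OF this] show ?thesis unfolding F_def
      by (intro nome_eq_imp_periodic_eq[of f, OF T that]) simp_all
  qed
  have branch: "F holomorphic_on S" if S: "S \<subseteq> ball 0 1 - {0}"
      and w: "w holomorphic_on S" "\<And>q. q \<in> S \<Longrightarrow> exp (w q) = q" for S w
  proof -
    have "(f \<circ> (\<lambda>q. w q / (2 * of_real pi * \<i>))) holomorphic_on S"
      using S by (intro holomorphic_on_compose_gen[OF _ hol] holomorphic_intros w)
        (auto intro!: nome_log(1)[OF w(2)])
    moreover have "(f \<circ> (\<lambda>q. w q / (2 * of_real pi * \<i>))) q = F q" if q: "q \<in> S" for q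
    proof -
      have "q \<noteq> 0" "cmod q < 1" using q S by auto
      from nome_log[OF w(2)[OF q] this] F show ?thesis by simp
    qed
    ultimately show ?thesis by (rule holomorphic_transform)
  qed
  let ?B = "ball (0::complex) 1 - {0}"
  have "F holomorphic_on (?B - \<real>\<^sub>\<le>\<^sub>0)"
    by (rule branch[where w = Ln]) (auto intro!: holomorphic_intros)
  moreover have "F holomorphic_on (?B - \<real>\<^sub>\<ge>\<^sub>0)"
  proof (rule branch[where w = "\<lambda>q. Ln (- q) + of_real pi * \<i>"])
    show "(\<lambda>q. Ln (- q) + of_real pi * \<i>) holomorphic_on ?B - \<real>\<^sub>\<ge>\<^sub>0"
      by (intro holomorphic_intros) (auto simp: complex_nonneg_Reals_iff complex_nonpos_Reals_iff)
  qed (auto simp: exp_add)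
  moreover have "open (?B - \<real>\<^sub>\<le>\<^sub>0)" "open (?B - \<real>\<^sub>\<ge>\<^sub>0)"
    by (auto intro!: open_Diff)
  ultimately have "F holomorphic_on (?B - \<real>\<^sub>\<le>\<^sub>0) \<union> (?B - \<real>\<^sub>\<ge>\<^sub>0)"
    by (intro holomorphic_on_Un)
  also have "(?B - \<real>\<^sub>\<le>\<^sub>0) \<union> (?B - \<real>\<^sub>\<ge>\<^sub>0) = ?B"
    by (auto simp: complex_nonneg_Reals_iff complex_nonpos_Reals_iff complex_eq_iff)
  finally show ?thesis using that F by blast
qed

text \<open>The exponent contains the modulus of \<tau> rather than its imaginary part. Thus \<tau>
  itself is admissible, and with it the entries of \<open>Phi1\<close>, which are not periodic. The
  value type is general so that matrices and their entries are treated alike.\<close>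

definition exp_bounded :: "(complex \<Rightarrow> 'a :: real_normed_vector) \<Rightarrow> bool" where
  "exp_bounded f \<longleftrightarrow> (\<exists>C M Y. \<forall>\<tau>. Im \<tau> > 0 \<and> Im \<tau> > Y \<longrightarrow> norm (f \<tau>) \<le> C * exp (M * cmod \<tau>))"

lemma exp_boundedI:
  assumes "\<And>\<tau>. Im \<tau> > 0 \<Longrightarrow> Im \<tau> > Y \<Longrightarrow> norm (f \<tau>) \<le> C * exp (M * cmod \<tau>)"
  shows "exp_bounded f"
  using assms unfolding exp_bounded_def by blast

lemma exp_boundedE:
  assumes "exp_bounded f"
  obtains C M Y where "C \<ge> 0" "M \<ge> 0" "Y \<ge> 0"
    "\<And>\<tau>. Im \<tau> > Y \<Longrightarrow> norm (f \<tau>) \<le> C * exp (M * cmod \<tau>)"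
proof -
  obtain C M Y where *: "\<And>\<tau>. Im \<tau> > 0 \<Longrightarrow> Im \<tau> > Y \<Longrightarrow> norm (f \<tau>) \<le> C * exp (M * cmod \<tau>)"
    using assms unfolding exp_bounded_def by blast
  show ?thesis
  proof (rule that[of "max C 0" "max M 0" "max Y 0"])
    fix \<tau> assume "Im \<tau> > max Y 0"
    then have "norm (f \<tau>) \<le> C * exp (M * cmod \<tau>)" by (intro *) auto
    also have "\<dots> \<le> max C 0 * exp (max M 0 * cmod \<tau>)"
      by (intro mult_mono) (auto intro!: mult_right_mono)
    finally show "norm (f \<tau>) \<le> max C 0 * exp (max M 0 * cmod \<tau>)" .
  qed auto
qed

lemma exp_bounded_add:
  assumes "exp_bounded f" "exp_bounded g"
  shows "exp_bounded (\<lambda>\<tau>. f \<tau> + g \<tau>)"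
proof -
  obtain C M Y where f: "C \<ge> 0" "M \<ge> 0" "Y \<ge> 0" "\<And>\<tau>. Im \<tau> > Y \<Longrightarrow> norm (f \<tau>) \<le> C * exp (M * cmod \<tau>)"
    using exp_boundedE[OF assms(1)] by blast
  obtain C' M' Y' where g: "C' \<ge> 0" "M' \<ge> 0" "Y' \<ge> 0" "\<And>\<tau>. Im \<tau> > Y' \<Longrightarrow> norm (g \<tau>) \<le> C' * exp (M' * cmod \<tau>)"
    using exp_boundedE[OF assms(2)] by blast
  show ?thesis
  proof (rule exp_boundedI[of "max Y Y'"])
    fix \<tau> assume "Im \<tau> > max Y Y'"
    then have "norm (f \<tau> + g \<tau>) \<le> C * exp (M * cmod \<tau>) + C' * exp (M' * cmod \<tau>)"
      by (intro norm_triangle_le add_mono f g) auto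
    also have "\<dots> \<le> C * exp ((M + M') * cmod \<tau>) + C' * exp ((M + M') * cmod \<tau>)"
      using f g by (intro add_mono mult_left_mono) (auto intro!: mult_right_mono)
    finally show "norm (f \<tau> + g \<tau>) \<le> (C + C') * exp ((M + M') * cmod \<tau>)"
      by (simp add: algebra_simps)
  qed
qed

lemma exp_bounded_mult:
  fixes f g :: "complex \<Rightarrow> complex"
  assumes "exp_bounded f" "exp_bounded g"
  shows "exp_bounded (\<lambda>\<tau>. f \<tau> * g \<tau>)"
proof -
  obtain C M Y where f: "C \<ge> 0" "M \<ge> 0" "Y \<ge> 0" "\<And>\<tau>. Im \<tau> > Y \<Longrightarrow> norm (f \<tau>) \<le> C * exp (M * cmod \<tau>)"
    using exp_boundedE[OF assms(1)] by blast
  obtain C' M' Y' where g: "C' \<ge> 0" "M' \<ge> 0" "Y' \<ge> 0" "\<And>\<tau>. Im \<tau> > Y' \<Longrightarrow> norm (g \<tau>) \<le> C' * exp (M' * cmod \<tau>)"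
    using exp_boundedE[OF assms(2)] by blast
  show ?thesis
  proof (rule exp_boundedI[of "max Y Y'"])
    fix \<tau> assume "Im \<tau> > max Y Y'"
    then have "norm (f \<tau> * g \<tau>) \<le> (C * exp (M * cmod \<tau>)) * (C' * exp (M' * cmod \<tau>))"
      unfolding norm_mult using f(1) by (intro mult_mono f g) auto
    then show "norm (f \<tau> * g \<tau>) \<le> (C * C') * exp ((M + M') * cmod \<tau>)"
      by (simp add: algebra_simps exp_add)
  qed
qed

lemma exp_bounded_const: "exp_bounded (\<lambda>_. c)"
  by (rule exp_boundedI[where C = "norm c" and M = 0]) simp

lemma exp_bounded_id: "exp_bounded (\<lambda>\<tau>. \<tau>)"
proof (rule exp_boundedI[where C = 1 and M = 1])
  fix \<tau> :: complex
  show "cmod \<tau> \<le> 1 * exp (1 * cmod \<tau>)"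
    using exp_ge_add_one_self[of "cmod \<tau>"] unfolding mult_1 by linarith
qed

lemma exp_bounded_minus: "exp_bounded f \<Longrightarrow> exp_bounded (\<lambda>\<tau>. - f \<tau>)"
  by (simp add: exp_bounded_def)

lemma exp_bounded_diff: "exp_bounded f \<Longrightarrow> exp_bounded g \<Longrightarrow> exp_bounded (\<lambda>\<tau>. f \<tau> - g \<tau>)"
  using exp_bounded_add[OF _ exp_bounded_minus, of f g] by simp

lemma exp_bounded_power: "exp_bounded f \<Longrightarrow> exp_bounded (\<lambda>\<tau>. f \<tau> ^ n)" for f :: "complex \<Rightarrow> complex"
  by (induction n) (auto intro: exp_bounded_const exp_bounded_mult)

lemmas exp_bounded_intros = exp_bounded_const exp_bounded_id exp_bounded_add exp_bounded_diff
  exp_bounded_minus exp_bounded_mult exp_bounded_power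

lemma exp_bounded_norm_le:
  assumes "exp_bounded g" "\<And>\<tau>. Im \<tau> > 0 \<Longrightarrow> norm (f \<tau>) \<le> K * norm (g \<tau>)"
  shows "exp_bounded f"
proof -
  obtain C M Y where g: "C \<ge> 0" "M \<ge> 0" "Y \<ge> 0" "\<And>\<tau>. Im \<tau> > Y \<Longrightarrow> norm (g \<tau>) \<le> C * exp (M * cmod \<tau>)"
    using exp_boundedE[OF assms(1)] by blast
  show ?thesis
  proof (rule exp_boundedI[of Y])
    fix \<tau> assume "Im \<tau> > 0" "Im \<tau> > Y"
    then have "norm (f \<tau>) \<le> \<bar>K\<bar> * norm (g \<tau>)"
      using assms(2)[of \<tau>] by (meson abs_ge_self mult_right_mono norm_ge_zero order_trans)
    also have "\<dots> \<le> \<bar>K\<bar> * (C * exp (M * cmod \<tau>))" using g \<open>Im \<tau> > Y\<close> by (intro mult_left_mono) auto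
    finally show "norm (f \<tau>) \<le> \<bar>K\<bar> * C * exp (M * cmod \<tau>)" by (simp add: mult.assoc)
  qed
qed

lemma exp_bounded_q_series:
  assumes "g holomorphic_on ball 0 1"
  shows "exp_bounded (\<lambda>\<tau>. g (nome \<tau>))"
proof -
  have lt: "cball (0::complex) (exp (- 2 * pi)) \<subseteq> ball 0 1" by (simp add: cball_subset_ball_iff)
  have "continuous_on (cball 0 (exp (- 2 * pi))) g"
    by (rule holomorphic_on_imp_continuous_on[OF holomorphic_on_subset[OF assms]])
       (rule lt)
  then have "bounded (g ` cball 0 (exp (- 2 * pi)))"
    by (intro compact_imp_bounded compact_continuous_image) auto
  then obtain B where "\<forall>q\<in>cball 0 (exp (- 2 * pi)). cmod (g q) \<le> B"
    by (auto simp: bounded_iff)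
  then show ?thesis
    by (intro exp_boundedI[of 1 _ B 0]) (auto simp: norm_nome)
qed

lemma exp_bounded_inverse_nome: "exp_bounded (\<lambda>\<tau>. inverse (nome \<tau>))"
proof (rule exp_boundedI[where C = 1 and M = "2 * pi"])
  fix \<tau> :: complex
  show "norm (inverse (nome \<tau>)) \<le> 1 * exp (2 * pi * cmod \<tau>)"
    using abs_Im_le_cmod[of \<tau>] by (simp add: norm_inverse norm_nome flip: exp_minus)
qed

text \<open>Every small \<open>q\<close> is the nome of a point with real part at most 1/2 in
  modulus, whose modulus is at most 1 plus its imaginary part. On such points the exponential bound
  becomes a power of 1/|q|, and multiplication by a sufficient power of \<open>q\<close> leaves a
  removable singularity.\<close>

lemma periodic_meromorphic_at_infinity:
  assumes hol: "f holomorphic_on \<H>"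
    and T: "\<And>\<tau>. \<tau> \<in> \<H> \<Longrightarrow> f (\<tau> + 1) = f \<tau>"
    and bd: "exp_bounded f"
  obtains N g where "g holomorphic_on ball 0 1"
    "\<And>\<tau>. \<tau> \<in> \<H> \<Longrightarrow> f \<tau> * nome \<tau> ^ N = g (nome \<tau>)"
proof -
  obtain F where F: "F holomorphic_on ball 0 1 - {0}" "\<And>\<tau>. \<tau> \<in> \<H> \<Longrightarrow> f \<tau> = F (nome \<tau>)"
    using periodic_q_expansion[OF hol T] by blast
  obtain C M Y where CMY: "C \<ge> 0" "M \<ge> 0" "Y \<ge> 0" "\<And>\<tau>. Im \<tau> > Y \<Longrightarrow> norm (f \<tau>) \<le> C * exp (M * cmod \<tau>)"
    using exp_boundedE[OF bd] by blast
  define N where "N = nat \<lceil>M\<rceil>"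
  have N: "M \<le> 2 * pi * real N"
  proof -
    have "M \<le> 1 * real N" unfolding N_def using CMY(2) by linarith
    also have "\<dots> \<le> 2 * pi * real N" using pi_gt3 by (intro mult_right_mono) auto
    finally show ?thesis .
  qed
  have bound: "cmod (F q * q ^ N) \<le> C * exp M" if q: "q \<noteq> 0" "cmod q < exp (- 2 * pi * Y)" for q
  proof -
    have q1: "cmod q < 1" using q(2) CMY(3) by (auto elim!: less_le_trans)
    define \<tau>0 where "\<tau>0 = Ln q / (2 * of_real pi * \<i>)"
    have t0: "\<tau>0 \<in> \<H>" "nome \<tau>0 = q"
      using nome_log[of "Ln q" q] q q1 by (auto simp: \<tau>0_def)
    obtain \<tau> where t: "\<tau> \<in> \<H>" "\<bar>Re \<tau>\<bar> \<le> 1 / 2" "nome \<tau> = q"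
      using translate_to_strip[of nome \<tau>0] t0 by (metis nome_plus_1)
    have "exp (- 2 * pi * Im \<tau>) < exp (- 2 * pi * Y)" using q(2) t(3) norm_nome[of \<tau>] by simp
    then have Im: "Im \<tau> > Y" by simp
    have "cmod (F q * q ^ N) = cmod (f \<tau>) * cmod q ^ N"
      using F(2)[OF t(1)] t(3) by (simp add: norm_mult norm_power)
    also have "\<dots> \<le> C * exp (M * cmod \<tau>) * cmod q ^ N"
      by (intro mult_right_mono CMY Im) auto
    also have "cmod q ^ N = exp (- (2 * pi * N * Im \<tau>))"
      using t(3) norm_nome[of \<tau>] by (simp flip: exp_of_nat_mult add: mult_ac)
    also have "C * exp (M * cmod \<tau>) * exp (- (2 * pi * N * Im \<tau>)) = C * exp (M * cmod \<tau> - 2 * pi * N * Im \<tau>)"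
      by (simp flip: exp_add add: mult.assoc exp_diff exp_minus field_simps)
    also have "\<dots> \<le> C * exp M"
    proof (intro mult_left_mono CMY)
      have "cmod \<tau> \<le> \<bar>Re \<tau>\<bar> + \<bar>Im \<tau>\<bar>" by (rule cmod_le)
      also have "\<dots> \<le> 1 + Im \<tau>" using t(1,2) by (simp add: upper_half_plane_def)
      finally have "M * cmod \<tau> \<le> M * (1 + Im \<tau>)" using CMY by (intro mult_left_mono)
      also have "\<dots> = M + M * Im \<tau>" by (simp add: algebra_simps)
      also have "M * Im \<tau> \<le> 2 * pi * N * Im \<tau>"
        using N t(1) by (intro mult_right_mono) (auto simp: upper_half_plane_def)
      finally show "exp (M * cmod \<tau> - 2 * pi * N * Im \<tau>) \<le> exp M" by simp
    qed
    finally show ?thesis .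
  qed
  have "(\<lambda>q. F q * q ^ N) holomorphic_on ball 0 1 - {0}"
    by (intro holomorphic_intros F)
  moreover have "\<exists>B. eventually (\<lambda>q. norm (F q * q ^ N) \<le> B) (at 0)"
    unfolding eventually_at using bound
    by (intro exI[of _ "C * exp M"] exI[of _ "exp (- 2 * pi * Y)"]) auto
  ultimately obtain g where "g holomorphic_on ball 0 1" "\<And>q. q \<in> ball 0 1 - {0} \<Longrightarrow> g q = F q * q ^ N"
    using holomorphic_on_extend_bounded[of "\<lambda>q. F q * q ^ N" "ball 0 1" 0] by auto
  then show ?thesis using F(2) norm_nome_less_1 by (intro that[of g N]) auto
qed

section \<open>The discriminant and the \<open>j\<close>-invariant\<close>

lemma E2_plus_1: "E2 (\<tau> + 1) = E2 \<tau>"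
  and E4_plus_1: "E4 (\<tau> + 1) = E4 \<tau>"
  and E6_plus_1: "E6 (\<tau> + 1) = E6 \<tau>"
  by (simp_all add: E2_eq E4_eq E6_eq)

lemma mod_discr_plus_1: "mod_discr (\<tau> + 1) = mod_discr \<tau>"
  by (simp add: mod_discr_def E4_plus_1 E6_plus_1)

lemma mod_discr_inverse:
  assumes "\<tau> \<in> \<H>"
  shows "mod_discr (- 1 / \<tau>) = \<tau> ^ 12 * mod_discr \<tau>"
  unfolding mod_discr_def E4_inverse[OF assms] E6_inverse[OF assms]
  by (simp add: power_mult_distrib algebra_simps flip: power_mult)

lemma mod_discr_holomorphic [holomorphic_intros]: "mod_discr holomorphic_on \<H>"
  unfolding mod_discr_def[abs_def] by (intro holomorphic_intros) auto

text \<open>The function \<open>q exp (- 24 l(q))\<close> with \<open>q l'(q) = \<Sum>\<sigma>\<^sub>1(n) q\<^sup>n\<close> is the infinite product for the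
  discriminant. Its logarithmic derivative is \<open>2\<pi>i E\<^sub>2\<close>, so the law for \<open>E\<^sub>2\<close> makes it modular of
  weight 12, the constant of integration being fixed by evaluation at \<open>\<i>\<close>. It agrees with
  \<open>\<Delta>\<close> up to \<open>O(q\<^sup>2)\<close>.\<close>

lemma mod_discr_q_product:
  obtains d where "d holomorphic_on ball 0 1" "d 0 = 1" "\<And>q. d q \<noteq> 0"
    "\<And>\<tau>. \<tau> \<in> \<H> \<Longrightarrow> mod_discr \<tau> = nome \<tau> * d (nome \<tau>)"
proof -
  obtain l0 where l0: "\<And>q. q \<in> ball 0 1 \<Longrightarrow> (l0 has_field_derivative sigma_series 1 q) (at q within ball 0 1)"
    using holomorphic_convex_primitive'[OF convex_ball open_ball sigma_series_holomorphic[of 1]] by blast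
  define d where "d q = exp (- 24 * (l0 q - l0 0))" for q
  have d': "(d has_field_derivative - 24 * sigma_series 1 q * d q) (at q)" if "cmod q < 1" for q
  proof -
    have "(l0 has_field_derivative sigma_series 1 q) (at q)"
      using l0[of q] that by (simp add: at_within_open[of q "ball 0 1"])
    then show ?thesis unfolding d_def
      by (auto intro!: derivative_eq_intros)
  qed
  have dhol: "d holomorphic_on ball 0 1"
    unfolding holomorphic_on_open[OF open_ball] by (intro ballI exI, rule d') simp
  define P where "P \<tau> = nome \<tau> * d (nome \<tau>)" for \<tau>
  define c where "c = (2 * of_real pi * \<i> :: complex)"
  have c: "c \<noteq> 0" by (simp add: c_def)
  have P_nz: "P \<tau> \<noteq> 0" for \<tau> by (simp add: P_def d_def)
  have P': "(P has_field_derivative c * E2 \<tau> * P \<tau>) (at \<tau>)" if "\<tau> \<in> \<H>" for \<tau>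
  proof -
    have n: "(nome has_field_derivative c * nome \<tau>) (at \<tau>)"
      unfolding nome_def c_def by (auto intro!: derivative_eq_intros)
    have "((\<lambda>\<tau>. d (nome \<tau>)) has_field_derivative (- 24 * sigma_series 1 (nome \<tau>) * d (nome \<tau>)) * (c * nome \<tau>)) (at \<tau>)"
      by (rule DERIV_chain2[OF d'[OF norm_nome_less_1[OF that]] n])
    from DERIV_mult[OF n this] show ?thesis
      unfolding P_def[abs_def] E2_eq eisen_series_factor[OF norm_nome_less_1[OF that]]
      by (rule DERIV_cong) (simp add: algebra_simps)
  qed
  have P_inv: "P (- 1 / \<tau>) = \<tau> ^ 12 * P \<tau>" if \<tau>: "\<tau> \<in> \<H>" for \<tau>
  proof -
    define R where "R \<tau> = P (- 1 / \<tau>) / (\<tau> ^ 12 * P \<tau>)" for \<tau>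
    have "(R has_field_derivative 0) (at t within \<H>)" if t: "t \<in> \<H>" for t
    proof -
      have t0: "t \<noteq> 0" using t by (auto simp: upper_half_plane_def)
      define N where "N = P (- 1 / t)"
      define D where "D = t ^ 12 * P t"
      have i: "((\<lambda>t. - 1 / t) has_field_derivative 1 / t\<^sup>2) (at t)"
        using t0 by (auto intro!: derivative_eq_intros simp: power2_eq_square)
      have "((\<lambda>t. P (- 1 / t)) has_field_derivative (c * E2 (- 1 / t) * P (- 1 / t)) * (1 / t\<^sup>2)) (at t)"
        by (rule DERIV_chain2[where g = "\<lambda>t. - 1 / t", OF P'[OF uhp_inverse[OF t]] i])
      also have "(c * E2 (- 1 / t) * P (- 1 / t)) * (1 / t\<^sup>2) = N * (c * E2 t + 12 / t)"
        using t0 c unfolding E2_inverse[OF t] N_def c_def[symmetric] by (simp add: field_simps power2_eq_square)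
      finally have 1: "((\<lambda>t. P (- 1 / t)) has_field_derivative N * (c * E2 t + 12 / t)) (at t)" .
      have "((\<lambda>t. t ^ 12 * P t) has_field_derivative D * (c * E2 t + 12 / t)) (at t)"
        by (rule derivative_eq_intros P'[OF t] refl)+ (use t0 in \<open>simp add: D_def field_simps power_numeral_reduce\<close>)
      from DERIV_divide[OF 1 this] have "(R has_field_derivative 0) (at t)"
        unfolding R_def[abs_def] N_def D_def using t0 P_nz[of t] by (simp add: mult_ac)
      then show ?thesis by (rule has_field_derivative_at_within)
    qed
    then obtain k where k: "\<And>t. t \<in> \<H> \<Longrightarrow> R t = k"
      using has_field_derivative_zero_constant[OF upper_half_plane_convex, of R] by blast
    have iH: "\<i> \<in> \<H>" by (simp add: upper_half_plane_def)
    have "\<i> ^ 12 = (1 :: complex)" by (simp add: power_numeral_reduce)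
    then have "R \<i> = 1" using P_nz by (simp add: R_def)
    then have "R \<tau> = 1" using k[OF iH] k[OF \<tau>] by simp
    then show ?thesis using \<tau> P_nz[of \<tau>] by (auto simp: R_def upper_half_plane_def)
  qed
  \<comment> \<open>The coefficient of q in E4^3 - E6^2 is 3 * 240 + 2 * 504 = 720 + 1008 = 1728,
    hence the value 0 of \<open>g0\<close> at 0.\<close>
  define g0 where "g0 q = (720 * sigma_series 3 q + 1008 * sigma_series 5 q) / 1728 - d q" for q
  have "g0 holomorphic_on ball 0 1" unfolding g0_def
    by (intro holomorphic_intros sigma_series_holomorphic dhol) auto
  moreover have "g0 0 = 0" by (simp add: g0_def sigma_series_0 d_def)
  ultimately obtain h where h: "h holomorphic_on ball 0 1" "\<And>q. cmod q < 1 \<Longrightarrow> g0 q = q * h q"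
    using holomorphic_divide_zero by blast
  \<comment> \<open>The remaining terms of the expansions of the cube and the square: 172800 = 3 *
    240^2, 13824000 = 240^3 and 254016 = 504^2.\<close>
  define g where "g q = h q + (172800 * (sigma_series 3 q)\<^sup>2 + 13824000 * q * sigma_series 3 q ^ 3
      - 254016 * (sigma_series 5 q)\<^sup>2) / 1728" for q
  have ghol: "g holomorphic_on ball 0 1" unfolding g_def
    by (intro holomorphic_intros sigma_series_holomorphic h) auto
  have g: "mod_discr \<tau> - P \<tau> = nome \<tau> ^ 2 * g (nome \<tau>)" if "\<tau> \<in> \<H>" for \<tau>
  proof -
    define q s t where "q = nome \<tau>" and "s = sigma_series 3 q" and "t = sigma_series 5 q"
    have q: "cmod q < 1" using norm_nome_less_1[OF that] by (simp add: q_def)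
    have "mod_discr \<tau> - P \<tau> = ((1 + 240 * (q * s)) ^ 3 - (1 - 504 * (q * t)) ^ 2) / 1728 - q * d q"
      by (simp add: mod_discr_def E4_eq E6_eq P_def q_def[symmetric] eisen_series_factor[OF q] s_def t_def)
    also have "\<dots> = q * ((720 * s + 1008 * t) / 1728 - d q)
        + q\<^sup>2 * ((172800 * s\<^sup>2 + 13824000 * q * s ^ 3 - 254016 * t\<^sup>2) / 1728)"
      by (simp add: field_simps power2_eq_square power3_eq_cube)
    also have "(720 * s + 1008 * t) / 1728 - d q = q * h q"
      using h(2)[OF q] by (simp add: g0_def s_def t_def)
    finally show ?thesis by (simp add: g_def q_def s_def t_def power2_eq_square algebra_simps)
  qed
  \<comment> \<open>Here the agreement to second order is spent: 12 < 2 pi * 2.\<close>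
  have "mod_discr \<tau> - P \<tau> = 0" if \<tau>: "\<tau> \<in> \<H>" for \<tau>
  proof (rule modular_vanishing[where f = "\<lambda>\<tau>. mod_discr \<tau> - P \<tau>" and k = 12 and m = 2 and g = g])
    show "(\<lambda>\<tau>. mod_discr \<tau> - P \<tau>) holomorphic_on \<H>"
    proof (intro holomorphic_intros)
      show "P holomorphic_on \<H>"
        unfolding holomorphic_on_open[OF open_upper_half_plane] using P' by blast
    qed
    show "real 12 < 2 * pi * real 2" using pi_gt3 by simp
  qed (use g ghol \<tau> P_inv mod_discr_inverse in \<open>auto simp: mod_discr_plus_1 P_def algebra_simps\<close>)
  then show ?thesis
    using dhol by (intro that[of d]) (auto simp: d_def P_def)
qed

lemma mod_discr_nonzero [holomorphic_intros]: "\<tau> \<in> \<H> \<Longrightarrow> mod_discr \<tau> \<noteq> 0"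
  using mod_discr_q_product by (metis mult_eq_0_iff nome_nonzero)

section \<open>Growth of the Eisenstein series and of the inverse discriminant\<close>

lemma exp_bounded_cong:
  assumes "\<And>\<tau>. \<tau> \<in> \<H> \<Longrightarrow> f \<tau> = g \<tau>"
  shows "exp_bounded f \<longleftrightarrow> exp_bounded g"
  using assms unfolding exp_bounded_def upper_half_plane_def by auto

lemma exp_bounded_inverse_mod_discr: "exp_bounded (\<lambda>\<tau>. inverse (mod_discr \<tau>))"
proof -
  obtain d where d: "d holomorphic_on ball 0 1" "d 0 = 1" "\<And>q. d q \<noteq> 0"
    "\<And>\<tau>. \<tau> \<in> \<H> \<Longrightarrow> mod_discr \<tau> = nome \<tau> * d (nome \<tau>)"
    using mod_discr_q_product by blast
  have "exp_bounded (\<lambda>\<tau>. inverse (nome \<tau>) * (\<lambda>q. inverse (d q)) (nome \<tau>))"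
    using d by (intro exp_bounded_mult exp_bounded_inverse_nome exp_bounded_q_series holomorphic_intros) auto
  then show ?thesis
    by (subst exp_bounded_cong[of _ "\<lambda>\<tau>. inverse (nome \<tau>) * inverse (d (nome \<tau>))"]) (auto simp: d)
qed

lemma exp_bounded_eisen_series: "exp_bounded (\<lambda>\<tau>. eisen_series k (nome \<tau>))"
  by (intro exp_bounded_q_series eisen_series_holomorphic)

lemma exp_bounded_E2: "exp_bounded E2"
  and exp_bounded_E4: "exp_bounded E4"
  and exp_bounded_E6: "exp_bounded E6"
  unfolding E2_eq[abs_def] E4_eq[abs_def] E6_eq[abs_def]
  by (intro exp_bounded_intros exp_bounded_eisen_series)+

section \<open>The \<open>j\<close>-invariant and modular functions of weight 0\<close>

lemma klein_j_holomorphic [holomorphic_intros]: "klein_j holomorphic_on \<H>"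
  unfolding klein_j_def[abs_def]
  by (intro holomorphic_intros)

lemma klein_j_plus_1: "klein_j (\<tau> + 1) = klein_j \<tau>"
  by (simp add: klein_j_def E4_plus_1 mod_discr_plus_1)

lemma klein_j_inverse:
  assumes "\<tau> \<in> \<H>"
  shows "klein_j (- 1 / \<tau>) = klein_j \<tau>"
proof -
  have "\<tau> \<noteq> 0" by (rule uhp_nonzero[OF assms])
  then show ?thesis
    unfolding klein_j_def E4_inverse[OF assms] mod_discr_inverse[OF assms]
    by (simp add: power_mult_distrib flip: power_mult)
qed

lemma klein_j_minus_1728:
  assumes "\<tau> \<in> \<H>"
  shows "klein_j \<tau> - 1728 = E6 \<tau> ^ 2 / mod_discr \<tau>"
proof -
  have "E4 \<tau> ^ 3 = 1728 * mod_discr \<tau> + E6 \<tau> ^ 2" by (simp add: mod_discr_def field_simps)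
  then show ?thesis using mod_discr_nonzero[OF assms] by (simp add: klein_j_def field_simps)
qed

lemma exp_bounded_klein_j: "exp_bounded klein_j"
  unfolding klein_j_def[abs_def] divide_inverse
  by (intro exp_bounded_intros exp_bounded_E4 exp_bounded_inverse_mod_discr)

lemma klein_j_q_expansion:
  obtains J where "J holomorphic_on ball 0 1" "J 0 = 1"
    "\<And>\<tau>. \<tau> \<in> \<H> \<Longrightarrow> klein_j \<tau> * nome \<tau> = J (nome \<tau>)"
proof -
  obtain d where d: "d holomorphic_on ball 0 1" "d 0 = 1" "\<And>q. d q \<noteq> 0"
    "\<And>\<tau>. \<tau> \<in> \<H> \<Longrightarrow> mod_discr \<tau> = nome \<tau> * d (nome \<tau>)"
    using mod_discr_q_product by blast
  define J where "J q = (1 + 240 * eisen_series 3 q) ^ 3 / d q" for q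
  show ?thesis
  proof (rule that)
    show "J holomorphic_on ball 0 1" unfolding J_def
      by (intro holomorphic_intros eisen_series_holomorphic d)
    show "J 0 = 1" by (simp add: J_def d eisen_series_factor)
    show "klein_j \<tau> * nome \<tau> = J (nome \<tau>)" if "\<tau> \<in> \<H>" for \<tau>
      by (simp add: J_def klein_j_def d(4)[OF that] E4_eq)
  qed
qed

text \<open>Induction on the pole order \<open>N\<close> at the cusp. As \<open>klein_j\<close>
  times \<open>nome\<close> takes the value 1 at the cusp, subtracting \<open>g 0\<close> times the
  matching power of \<open>klein_j\<close> lowers the order. In order 0 the difference from the
  value at the cusp vanishes there, and weight 0 with \<open>m = 1\<close> is within the range of
  \<open>modular_vanishing\<close>.\<close>

lemma weight_0_polynomial:
  assumes hol: "f holomorphic_on \<H>"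
    and T: "\<And>\<tau>. \<tau> \<in> \<H> \<Longrightarrow> f (\<tau> + 1) = f \<tau>"
    and S: "\<And>\<tau>. \<tau> \<in> \<H> \<Longrightarrow> f (- 1 / \<tau>) = f \<tau>"
    and bd: "exp_bounded f"
  obtains p where "\<And>\<tau>. \<tau> \<in> \<H> \<Longrightarrow> f \<tau> = poly p (klein_j \<tau>)"
proof -
  obtain J where J: "J holomorphic_on ball 0 1" "J 0 = 1"
    "\<And>\<tau>. \<tau> \<in> \<H> \<Longrightarrow> klein_j \<tau> * nome \<tau> = J (nome \<tau>)"
    using klein_j_q_expansion by blast
  have *: "\<exists>p. \<forall>\<tau>\<in>\<H>. f \<tau> = poly p (klein_j \<tau>)"
    if "f holomorphic_on \<H>" "\<And>\<tau>. \<tau> \<in> \<H> \<Longrightarrow> f (\<tau> + 1) = f \<tau>"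
      "\<And>\<tau>. \<tau> \<in> \<H> \<Longrightarrow> f (- 1 / \<tau>) = f \<tau>"
      "g holomorphic_on ball 0 1" "\<And>\<tau>. \<tau> \<in> \<H> \<Longrightarrow> f \<tau> * nome \<tau> ^ N = g (nome \<tau>)"
    for f g N
    using that
  proof (induction N arbitrary: f g)
    case 0
    have "(\<lambda>q. g q - g 0) holomorphic_on ball 0 1" by (intro holomorphic_intros 0)
    then obtain h where h: "h holomorphic_on ball 0 1" "\<And>q. cmod q < 1 \<Longrightarrow> g q - g 0 = q * h q"
      using holomorphic_divide_zero[of "\<lambda>q. g q - g 0" 1] by auto
    have "f \<tau> - g 0 = 0" if "\<tau> \<in> \<H>" for \<tau>
    proof (rule modular_vanishing[where f = "\<lambda>\<tau>. f \<tau> - g 0" and k = 0 and m = 1 and g = h])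
      show "f \<tau> - g 0 = nome \<tau> ^ 1 * h (nome \<tau>)" if "\<tau> \<in> \<H>" for \<tau>
        using 0(5)[OF that] h(2)[OF norm_nome_less_1[OF that]] by simp
    qed (use 0 h that in \<open>auto intro!: holomorphic_intros\<close>)
    then show ?case by (intro exI[of _ "[:g 0:]"]) simp
  next
    case (Suc N)
    define f' where "f' \<tau> = f \<tau> - g 0 * klein_j \<tau> ^ Suc N" for \<tau>
    have "(\<lambda>q. g q - g 0 * J q ^ Suc N) holomorphic_on ball 0 1"
      by (intro holomorphic_intros Suc J)
    then obtain h where h: "h holomorphic_on ball 0 1" "\<And>q. cmod q < 1 \<Longrightarrow> g q - g 0 * J q ^ Suc N = q * h q"
      using holomorphic_divide_zero[of "\<lambda>q. g q - g 0 * J q ^ Suc N" 1] J(2) by auto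
    have "\<exists>p. \<forall>\<tau>\<in>\<H>. f' \<tau> = poly p (klein_j \<tau>)"
    proof (rule Suc.IH)
      show "f' holomorphic_on \<H>" unfolding f'_def
        by (intro holomorphic_intros Suc klein_j_holomorphic)
      show "h holomorphic_on ball 0 1" by (rule h)
      fix \<tau> assume \<tau>: "\<tau> \<in> \<H>"
      show "f' (\<tau> + 1) = f' \<tau>" "f' (- 1 / \<tau>) = f' \<tau>"
        using Suc.prems(2,3)[OF \<tau>] klein_j_inverse[OF \<tau>] by (simp_all add: f'_def klein_j_plus_1)
      have "nome \<tau> * (f' \<tau> * nome \<tau> ^ N) = f \<tau> * nome \<tau> ^ Suc N - g 0 * (klein_j \<tau> * nome \<tau>) ^ Suc N"
        unfolding power_mult_distrib by (simp add: f'_def algebra_simps)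
      also have "\<dots> = nome \<tau> * h (nome \<tau>)"
        using h(2)[OF norm_nome_less_1[OF \<tau>]] Suc.prems(5)[OF \<tau>] J(3)[OF \<tau>] by simp
      finally show "f' \<tau> * nome \<tau> ^ N = h (nome \<tau>)" by simp
    qed
    then obtain p where "\<forall>\<tau>\<in>\<H>. f' \<tau> = poly p (klein_j \<tau>)" by blast
    then show ?case
      by (intro exI[of _ "p + monom (g 0) (Suc N)"]) (auto simp: f'_def poly_monom algebra_simps)
  qed
  obtain N g where "g holomorphic_on ball 0 1"
    "\<And>\<tau>. \<tau> \<in> \<H> \<Longrightarrow> f \<tau> * nome \<tau> ^ N = g (nome \<tau>)"
    using periodic_meromorphic_at_infinity[OF hol T bd] by blast
  from *[OF hol T S this] that show ?thesis by blast
qed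

section \<open>Values at the elliptic points and forms of weights -2 and 2\<close>

lemma E6_at_i: "E6 \<i> = 0"
  using E6_inverse[of \<i>] by (simp add: upper_half_plane_def power_numeral_reduce)

lemma klein_j_at_i: "klein_j \<i> = 1728"
proof -
  have "\<i> \<in> \<H>" by (simp add: upper_half_plane_def)
  from klein_j_minus_1728[OF this] show ?thesis by (simp add: E6_at_i)
qed

definition rho :: complex where "rho = Complex (-1/2) (sqrt 3 / 2)"

lemma rho_uhp: "rho \<in> \<H>"
  by (simp add: rho_def upper_half_plane_def)

text \<open>For this cube root of unity inversion and translation by 1 agree, so the two laws give
  \<open>E4 rho = rho ^ 4 * E4 rho\<close>, where \<open>rho ^ 4 = rho\<close> is not 1.\<close>

lemma E4_at_rho: "E4 rho = 0"
proof -
  have sq: "rho\<^sup>2 + rho + 1 = 0" by (simp add: rho_def complex_eq_iff power2_eq_square)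
  have ne: "rho \<noteq> 0" "rho \<noteq> 1" by (auto simp: rho_def complex_eq_iff)
  have "rho * (rho + 1) = - 1" using sq by (simp add: power2_eq_square algebra_simps add_eq_0_iff)
  then have "- 1 / rho = rho + 1" using ne by (simp add: field_simps)
  then have "E4 rho = rho ^ 4 * E4 rho"
    using E4_inverse[OF rho_uhp] E4_plus_1[of rho] by simp
  moreover have "rho ^ 4 = rho"
    using sq by algebra
  ultimately have "(rho - 1) * E4 rho = 0" by (simp add: algebra_simps)
  then show ?thesis using ne by simp
qed

lemma klein_j_at_rho: "klein_j rho = 0"
  by (simp add: klein_j_def E4_at_rho)

text \<open>By the identity theorem a factor that is nonzero at a single point may be cancelled.
  This allows division by Eisenstein series without locating their zeros.\<close>

lemma holomorphic_mult_eq_0: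
  assumes f: "f holomorphic_on \<H>" and g: "g holomorphic_on \<H>"
    and fg: "\<And>\<tau>. \<tau> \<in> \<H> \<Longrightarrow> f \<tau> * g \<tau> = 0"
    and t: "t \<in> \<H>" "f t \<noteq> 0" and \<tau>: "\<tau> \<in> \<H>"
  shows "g \<tau> = 0"
proof -
  have "continuous_on \<H> f" using f by (rule holomorphic_on_imp_continuous_on)
  then have "open (\<H> \<inter> f -` (- {0}))"
    by (intro continuous_open_preimage) auto
  then show ?thesis
    using fg t by (intro analytic_continuation_open[where g = "\<lambda>_. 0" and f = g,
        OF _ open_upper_half_plane _ upper_half_plane_connected _ g _ _ \<tau>]) auto
qed

text \<open>Both constant terms are 1, so the product is nonzero for small \<open>q\<close>, and
  every such \<open>q\<close> other than 0 is a nome.\<close>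

lemma E4_E6_not_identically_0: "\<exists>\<tau>\<in>\<H>. E4 \<tau> \<noteq> 0 \<and> E6 \<tau> \<noteq> 0"
proof -
  define f where "f q = (1 + 240 * eisen_series 3 q) * (1 - 504 * eisen_series 5 q)" for q
  have "f holomorphic_on ball 0 1" unfolding f_def by (intro holomorphic_intros eisen_series_holomorphic)
  then have "isCont f 0"
    by (intro continuous_on_interior[OF holomorphic_on_imp_continuous_on]) auto
  moreover have "f 0 \<noteq> 0" by (simp add: f_def eisen_series_factor)
  ultimately have "eventually (\<lambda>q. f q \<noteq> 0) (at 0)"
    by (simp add: isCont_def tendsto_imp_eventually_ne)
  moreover have "eventually (\<lambda>q. q \<in> ball 0 1 - {0}) (at (0::complex))"
    by (rule eventually_at_in_open) auto
  ultimately have "eventually (\<lambda>q. f q \<noteq> 0 \<and> q \<in> ball 0 1 - {0}) (at 0)"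
    by (rule eventually_conj)
  then obtain q where q: "f q \<noteq> 0" "q \<noteq> 0" "cmod q < 1"
    using eventually_happens'[of "at (0::complex)"] by auto
  have "Ln q / (2 * of_real pi * \<i>) \<in> \<H>" "nome (Ln q / (2 * of_real pi * \<i>)) = q"
    using nome_log[of "Ln q" q] q by auto
  then show ?thesis using q(1)
    by (intro bexI[of _ "Ln q / (2 * of_real pi * \<i>)"]) (auto simp: f_def E4_eq E6_eq)
qed

text \<open>This divisibility replaces counting the zeros of \<open>E\<^sub>4\<close> and \<open>E\<^sub>6\<close>.\<close>

lemma weight_0_vanishing_at_elliptic_points:
  assumes "f holomorphic_on \<H>"
    and "\<And>\<tau>. \<tau> \<in> \<H> \<Longrightarrow> f (\<tau> + 1) = f \<tau>"
    and "\<And>\<tau>. \<tau> \<in> \<H> \<Longrightarrow> f (- 1 / \<tau>) = f \<tau>"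
    and "exp_bounded f" and z: "f \<i> = 0" "f rho = 0"
  obtains Q where "\<And>\<tau>. \<tau> \<in> \<H> \<Longrightarrow>
    f \<tau> = E4 \<tau> ^ 3 * E6 \<tau> ^ 2 / mod_discr \<tau> ^ 2 * poly Q (klein_j \<tau>)"
proof -
  obtain p where p: "\<And>\<tau>. \<tau> \<in> \<H> \<Longrightarrow> f \<tau> = poly p (klein_j \<tau>)"
    using weight_0_polynomial[OF assms(1-4)] by blast
  have "poly p 0 = 0" using p[OF rho_uhp] z by (simp add: klein_j_at_rho)
  then obtain p1 where p1: "p = [:- 0, 1:] * p1" unfolding poly_eq_0_iff_dvd by (elim dvdE)
  have "poly p 1728 = 0" using p[of \<i>] z by (simp add: klein_j_at_i upper_half_plane_def)
  then have "poly p1 1728 = 0" by (simp add: p1)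
  then obtain Q where Q: "p1 = [:- 1728, 1:] * Q" unfolding poly_eq_0_iff_dvd by (elim dvdE)
  show ?thesis
  proof (rule that)
    fix \<tau> assume \<tau>: "\<tau> \<in> \<H>"
    have "f \<tau> = klein_j \<tau> * (klein_j \<tau> - 1728) * poly Q (klein_j \<tau>)"
      by (simp add: p[OF \<tau>] p1 Q algebra_simps)
    also have "\<dots> = (E4 \<tau> ^ 3 / mod_discr \<tau>) * (E6 \<tau> ^ 2 / mod_discr \<tau>) * poly Q (klein_j \<tau>)"
      unfolding klein_j_minus_1728[OF \<tau>] by (simp add: klein_j_def)
    finally show "f \<tau> = E4 \<tau> ^ 3 * E6 \<tau> ^ 2 / mod_discr \<tau> ^ 2 * poly Q (klein_j \<tau>)"
      by (simp add: power2_eq_square)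
  qed
qed

text \<open>The premise on inversion expresses weight 6 - 4m without negative powers. The product
  with E4^m E6 / \<Delta> has weight 0 and vanishes at both elliptic points, hence it is E4^3 E6^2 /
  \<Delta>^2 times a polynomial in j. Cancelling E4^m E6 leaves the exponent n = 3 - m; as these
  factors have zeros, the cancellation goes through the identity theorem.\<close>

lemma weight_polynomial:
  assumes hol: "f holomorphic_on \<H>"
    and T: "\<And>\<tau>. \<tau> \<in> \<H> \<Longrightarrow> f (\<tau> + 1) = f \<tau>"
    and S: "\<And>\<tau>. \<tau> \<in> \<H> \<Longrightarrow> f (- 1 / \<tau>) * \<tau> ^ (4 * m + 6) = \<tau> ^ 12 * f \<tau>"
    and bd: "exp_bounded f" and mn: "m + n = 3" "m > 0"
  obtains Q where "\<And>\<tau>. \<tau> \<in> \<H> \<Longrightarrow>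
    f \<tau> = poly Q (klein_j \<tau>) * (inverse (mod_discr \<tau>) * E4 \<tau> ^ n * E6 \<tau>)"
proof -
  let ?F = "\<lambda>\<tau>. f \<tau> * (E4 \<tau> ^ m * E6 \<tau> * inverse (mod_discr \<tau>))"
  obtain Q where Q: "\<And>\<tau>. \<tau> \<in> \<H> \<Longrightarrow>
    ?F \<tau> = E4 \<tau> ^ 3 * E6 \<tau> ^ 2 / mod_discr \<tau> ^ 2 * poly Q (klein_j \<tau>)"
  proof (rule weight_0_vanishing_at_elliptic_points[of ?F])
    show "?F holomorphic_on \<H>"
      by (intro holomorphic_intros hol)
    show "exp_bounded ?F"
      by (intro exp_bounded_intros bd exp_bounded_E4 exp_bounded_E6 exp_bounded_inverse_mod_discr)
    fix \<tau> assume \<tau>: "\<tau> \<in> \<H>"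
    then show "?F (\<tau> + 1) = ?F \<tau>" by (simp add: T E4_plus_1 E6_plus_1 mod_discr_plus_1)
    have nz: "\<tau> \<noteq> 0" by (rule uhp_nonzero[OF \<tau>])
    have "?F (- 1 / \<tau>) = (f (- 1 / \<tau>) * \<tau> ^ (4 * m + 6)) * (E4 \<tau> ^ m * E6 \<tau> * inverse (\<tau> ^ 12 * mod_discr \<tau>))"
      unfolding E4_inverse[OF \<tau>] E6_inverse[OF \<tau>] mod_discr_inverse[OF \<tau>] power_add power_mult
      by (simp add: power_mult_distrib mult_ac)
    also have "\<dots> = ?F \<tau>" unfolding S[OF \<tau>] using nz by simp
    finally show "?F (- 1 / \<tau>) = ?F \<tau>" .
  qed (use mn in \<open>auto simp: E4_at_rho E6_at_i\<close>)
  let ?R = "\<lambda>\<tau>. poly Q (klein_j \<tau>) * (inverse (mod_discr \<tau>) * E4 \<tau> ^ n * E6 \<tau>)"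
  obtain t where t: "t \<in> \<H>" "E4 t \<noteq> 0" "E6 t \<noteq> 0" using E4_E6_not_identically_0 by blast
  have "f \<tau> - ?R \<tau> = 0" if \<tau>: "\<tau> \<in> \<H>" for \<tau>
  proof (rule holomorphic_mult_eq_0[of "\<lambda>\<tau>. E4 \<tau> ^ m * E6 \<tau>" "\<lambda>\<tau>. f \<tau> - ?R \<tau>", OF _ _ _ t(1) _ \<tau>])
    fix \<tau> assume \<tau>: "\<tau> \<in> \<H>"
    have "E4 \<tau> ^ m * E6 \<tau> * (f \<tau> - ?R \<tau>) = mod_discr \<tau> * ?F \<tau> - E4 \<tau> ^ m * E6 \<tau> * ?R \<tau>"
      using mod_discr_nonzero[OF \<tau>] by (simp add: algebra_simps)
    also have "E4 \<tau> ^ m * E6 \<tau> * ?R \<tau> = E4 \<tau> ^ (m + n) * E6 \<tau> ^ 2 * poly Q (klein_j \<tau>) / mod_discr \<tau>"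
      by (simp add: power_add power2_eq_square divide_inverse mult_ac)
    also have "mod_discr \<tau> * ?F \<tau> - \<dots> = 0"
      unfolding Q[OF \<tau>] mn(1) using mod_discr_nonzero[OF \<tau>] by (simp add: power2_eq_square)
    finally show "E4 \<tau> ^ m * E6 \<tau> * (f \<tau> - ?R \<tau>) = 0" .
  qed (use t in \<open>auto intro!: holomorphic_intros hol\<close>)
  then show ?thesis by (intro that) auto
qed

text \<open>The values 0 and 1728 at the elliptic points show that j is not constant, so its image
  is open. Injectivity later draws infinitely many eigenvalues from this.\<close>

lemma klein_j_infinite_range: "infinite (klein_j ` \<H>)"
proof
  assume fin: "finite (klein_j ` \<H>)"
  have "\<not> klein_j constant_on \<H>"
  proof
    assume "klein_j constant_on \<H>"
    then obtain y where y: "\<And>\<tau>. \<tau> \<in> \<H> \<Longrightarrow> klein_j \<tau> = y"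
      by (auto simp: constant_on_def)
    have "\<i> \<in> \<H>" by (simp add: upper_half_plane_def)
    from y[OF this] y[OF rho_uhp] show False by (simp add: klein_j_at_i klein_j_at_rho)
  qed
  then have "open (klein_j ` \<H>)"
    by (intro open_mapping_thm[OF klein_j_holomorphic open_upper_half_plane upper_half_plane_connected])
       auto
  moreover have "klein_j ` \<H> \<noteq> {}" using rho_uhp by auto
  ultimately show False
    using fin finite_imp_not_open by blast
qed

section \<open>The modular group and its adjoint action\<close>

no_notation fps_nth (infixl "$" 75)

abbreviation mat2 :: "'a::zero \<Rightarrow> 'a \<Rightarrow> 'a \<Rightarrow> 'a \<Rightarrow> 'a^2^2" where
  "mat2 a b c d \<equiv> vector [vector [a, b], vector [c, d]]"

lemma mat2_eq_iff: "A = B \<longleftrightarrow> A$1$1 = B$1$1 \<and> A$1$2 = B$1$2 \<and> A$2$1 = B$2$1 \<and> A$2$2 = B$2$2"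
  for A B :: "'a^2^2"
  by (auto simp: vec_eq_iff forall_2)

lemma matrix_mult_2: "(A ** B)$i$j = A$i$1 * B$1$j + A$i$2 * B$2$j"
  for A B :: "'a::semiring_1^2^2"
  by (simp add: matrix_matrix_mult_def sum_2)

lemma mat2_mult: "mat2 a b c d ** mat2 a' b' c' d' = mat2 (a*a' + b*c') (a*b' + b*d') (c*a' + d*c') (c*b' + d*d')"
  for a :: "'a::semiring_1"
  by (simp add: mat2_eq_iff matrix_mult_2)

lemma mat_2: "mat k = mat2 k 0 0 k"
  by (simp add: mat2_eq_iff mat_def)

lemma mscale_nth [simp]: "mscale c A $ i $ j = c * A $ i $ j"
  by (simp add: mscale_def map_matrix_def)

lemma mscale_mult_left: "mscale c A ** B = mscale c (A ** B)"
  and mscale_mult_right: "A ** mscale c B = mscale c (A ** B)"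
  by (simp_all add: vec_eq_iff matrix_matrix_mult_def sum_distrib_left mult_ac)

lemma trace_2: "trace A = A$1$1 + A$2$2" for A :: "'a::semiring_1^2^2"
  by (simp add: trace_def sum_2)

lemma matrix_inv_eqI:
  fixes A B :: "'a::field^'n^'n"
  assumes "A ** B = mat 1"
  shows "matrix_inv A = B"
proof -
  have "B ** A = mat 1" using assms by (simp add: matrix_left_right_inverse)
  with assms have "matrix_inv A ** A = mat 1"
    unfolding matrix_inv_def by (metis (mono_tags, lifting) someI_ex)
  then have "matrix_inv A ** (A ** B) = B" by (simp add: matrix_mul_assoc)
  then show ?thesis using assms by simp
qed

definition cmat :: "int^2^2 \<Rightarrow> complex^2^2" where
  "cmat \<gamma> = map_matrix of_int \<gamma>"

lemma cmat_nth [simp]: "cmat \<gamma> $ i $ j = of_int (\<gamma> $ i $ j)"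
  by (simp add: cmat_def map_matrix_def)

lemma cmat_mult: "cmat (\<gamma> ** \<delta>) = cmat \<gamma> ** cmat \<delta>"
  by (simp add: mat2_eq_iff matrix_mult_2)

lemma cmat_1: "cmat (mat 1) = mat 1"
  by (simp add: mat2_eq_iff mat_def)

text \<open>The adjugate is the inverse in determinant 1 and is given by a formula over any
  commutative ring, so inverses stay integral.\<close>

definition adj2 :: "'a::comm_ring_1^2^2 \<Rightarrow> 'a^2^2" where
  "adj2 A = mat2 (A$2$2) (- A$1$2) (- A$2$1) (A$1$1)"

lemma SL2Z_adj2:
  assumes "\<gamma> \<in> SL2Z"
  shows "\<gamma> ** adj2 \<gamma> = mat 1" "adj2 \<gamma> ** \<gamma> = mat 1" "adj2 \<gamma> \<in> SL2Z"
  using assms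
  by (auto simp: SL2Z_def det_2 adj2_def mat2_eq_iff matrix_mult_2 mat_def algebra_simps)

lemma SL2Z_mult: "\<gamma> \<in> SL2Z \<Longrightarrow> \<delta> \<in> SL2Z \<Longrightarrow> \<gamma> ** \<delta> \<in> SL2Z"
  by (simp add: SL2Z_def det_mul)

lemma Ad_eq:
  assumes "\<gamma> \<in> SL2Z"
  shows "Ad \<gamma> A = cmat \<gamma> ** A ** cmat (adj2 \<gamma>)"
proof -
  have "cmat \<gamma> ** cmat (adj2 \<gamma>) = mat 1"
    by (simp add: SL2Z_adj2[OF assms] cmat_1 flip: cmat_mult)
  then show ?thesis by (simp add: Ad_def matrix_inv_eqI flip: cmat_def)
qed

lemma adj2_mult: "adj2 (A ** B) = adj2 B ** adj2 A"
  by (simp add: adj2_def mat2_eq_iff matrix_mult_2 algebra_simps)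

lemma Ad_mult:
  assumes "\<gamma> \<in> SL2Z" "\<delta> \<in> SL2Z"
  shows "Ad (\<gamma> ** \<delta>) A = Ad \<gamma> (Ad \<delta> A)"
  using assms by (simp add: Ad_eq SL2Z_mult adj2_mult cmat_mult matrix_mul_assoc)

lemma Ad_adj2:
  assumes "\<gamma> \<in> SL2Z"
  shows "Ad (adj2 \<gamma>) (Ad \<gamma> A) = A"
proof -
  have "mat 1 \<in> SL2Z" "adj2 (mat 1 :: int^2^2) = mat 1"
    by (auto simp: SL2Z_def det_2 mat_def adj2_def mat2_eq_iff)
  then have "Ad (mat 1) A = A" by (simp add: Ad_eq cmat_1)
  then show ?thesis using SL2Z_adj2[OF assms] assms by (simp flip: Ad_mult)
qed

lemma moebius_denominator_nonzero:
  assumes "\<gamma> \<in> SL2Z" "\<tau> \<in> \<H>"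
  shows "of_int (\<gamma>$2$1) * \<tau> + of_int (\<gamma>$2$2) \<noteq> (0 :: complex)"
proof
  assume *: "of_int (\<gamma>$2$1) * \<tau> + of_int (\<gamma>$2$2) = (0 :: complex)"
  then have "Im (of_int (\<gamma>$2$1) * \<tau> + of_int (\<gamma>$2$2)) = 0" by simp
  then have "\<gamma>$2$1 = 0" using assms(2) by (simp add: upper_half_plane_def)
  with * have "\<gamma>$2$2 = 0" by simp
  with \<open>\<gamma>$2$1 = 0\<close> assms(1) show False by (simp add: SL2Z_def det_2)
qed

lemma moebius_uhp:
  assumes "\<gamma> \<in> SL2Z" "\<tau> \<in> \<H>"
  shows "moebius \<gamma> \<tau> \<in> \<H>"
proof -
  let ?d = "of_int (\<gamma>$2$1) * \<tau> + of_int (\<gamma>$2$2)"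
  have det: "real_of_int (\<gamma>$1$1) * real_of_int (\<gamma>$2$2) - real_of_int (\<gamma>$1$2) * real_of_int (\<gamma>$2$1) = 1"
    using assms(1) unfolding SL2Z_def det_2 by (simp flip: of_int_mult of_int_diff)
  have "Im (moebius \<gamma> \<tau>) = (real_of_int (\<gamma>$1$1) * real_of_int (\<gamma>$2$2) - real_of_int (\<gamma>$1$2) * real_of_int (\<gamma>$2$1)) * Im \<tau> / (cmod ?d)\<^sup>2"
    unfolding moebius_def Im_divide cmod_power2 by (simp add: algebra_simps)
  then have "Im (moebius \<gamma> \<tau>) = Im \<tau> / (cmod ?d)\<^sup>2" using det by simp
  then show ?thesis
    using assms(2) moebius_denominator_nonzero[OF assms] by (simp add: upper_half_plane_def)
qed

lemma moebius_mult:
  assumes "\<delta> \<in> SL2Z" "\<gamma> ** \<delta> \<in> SL2Z" "\<tau> \<in> \<H>"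
  shows "moebius (\<gamma> ** \<delta>) \<tau> = moebius \<gamma> (moebius \<delta> \<tau>)"
proof -
  let ?d = "of_int (\<delta>$2$1) * \<tau> + of_int (\<delta>$2$2)"
  have nz: "?d \<noteq> 0" using moebius_denominator_nonzero[OF assms(1,3)] .
  have eq: "of_int (\<gamma>$i$1) * moebius \<delta> \<tau> + of_int (\<gamma>$i$2) =
      (of_int ((\<gamma> ** \<delta>)$i$1) * \<tau> + of_int ((\<gamma> ** \<delta>)$i$2)) / ?d" for i
    using nz by (simp add: moebius_def matrix_mult_2 field_simps)
  show ?thesis unfolding moebius_def[of \<gamma>] eq using nz by (simp add: moebius_def[of "\<gamma> ** \<delta>"])
qed

section \<open>Generators of the modular group and equivariance\<close>

definition SL2Z_S :: "int^2^2" where "SL2Z_S = mat2 0 (-1) 1 0"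
definition SL2Z_T :: "int \<Rightarrow> int^2^2" where "SL2Z_T n = mat2 1 n 0 1"

lemma SL2Z_S: "SL2Z_S \<in> SL2Z" and SL2Z_T: "SL2Z_T n \<in> SL2Z"
  by (auto simp: SL2Z_S_def SL2Z_T_def SL2Z_def det_2)

lemma moebius_S: "moebius SL2Z_S \<tau> = - 1 / \<tau>" and moebius_T: "moebius (SL2Z_T n) \<tau> = \<tau> + of_int n"
  by (simp_all add: moebius_def SL2Z_S_def SL2Z_T_def)

text \<open>Euclid's algorithm on the first column: removing a translation and an inversion replaces
  the lower left entry by a remainder modulo itself, up to sign. Once it is 0, the matrix is a
  translation or its negative, and the square of \<open>SL2Z_S\<close> is minus the identity.
  Admitting all integers in case \<open>T\<close> makes one division a single step and spares a case
  for inverses.\<close>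

lemma SL2Z_induct [consumes 1, case_names S T mult]:
  assumes "\<gamma> \<in> SL2Z"
    and S: "P SL2Z_S" and T: "\<And>n. P (SL2Z_T n)"
    and mult: "\<And>\<gamma> \<delta>. \<gamma> \<in> SL2Z \<Longrightarrow> \<delta> \<in> SL2Z \<Longrightarrow> P \<gamma> \<Longrightarrow> P \<delta> \<Longrightarrow> P (\<gamma> ** \<delta>)"
  shows "P \<gamma>"
  using assms(1)
proof (induction "nat \<bar>\<gamma>$2$1\<bar>" arbitrary: \<gamma> rule: less_induct)
  case less
  have det: "\<gamma>$1$1 * \<gamma>$2$2 - \<gamma>$1$2 * \<gamma>$2$1 = 1" using less.prems by (simp add: SL2Z_def det_2)
  show ?case
  proof (cases "\<gamma>$2$1 = 0")
    case True
    with det have "\<gamma>$1$1 * \<gamma>$2$2 = 1" by simp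
    then consider "\<gamma>$1$1 = 1" "\<gamma>$2$2 = 1" | "\<gamma>$1$1 = -1" "\<gamma>$2$2 = -1"
      by (auto simp: zmult_eq_1_iff)
    then show ?thesis
    proof cases
      case 1
      then have "\<gamma> = SL2Z_T (\<gamma>$1$2)" using True by (simp add: SL2Z_T_def mat2_eq_iff)
      then show ?thesis using T by metis
    next
      case 2
      then have "\<gamma> = (SL2Z_S ** SL2Z_S) ** SL2Z_T (- \<gamma>$1$2)" using True
        by (simp add: SL2Z_T_def SL2Z_S_def mat2_eq_iff matrix_mult_2)
      moreover have "P ((SL2Z_S ** SL2Z_S) ** SL2Z_T (- \<gamma>$1$2))"
        by (intro mult S T SL2Z_S SL2Z_T SL2Z_mult)
      ultimately show ?thesis by simp
    qed
  next
    case False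
    define n where "n = \<gamma>$1$1 div \<gamma>$2$1"
    define \<delta> where "\<delta> = adj2 SL2Z_S ** (adj2 (SL2Z_T n) ** \<gamma>)"
    have d: "\<delta> \<in> SL2Z" unfolding \<delta>_def by (intro SL2Z_mult SL2Z_adj2 SL2Z_S SL2Z_T less.prems)
    have "\<delta>$2$1 = - (\<gamma>$1$1 mod \<gamma>$2$1)"
      by (simp add: \<delta>_def adj2_def SL2Z_S_def SL2Z_T_def matrix_mult_2 n_def minus_mult_div_eq_mod algebra_simps
          minus_div_mult_eq_mod)
    then have "nat \<bar>\<delta>$2$1\<bar> < nat \<bar>\<gamma>$2$1\<bar>" using False abs_mod_less[of "\<gamma>$2$1" "\<gamma>$1$1"] by simp
    then have "P \<delta>" using d by (rule less.hyps)
    have "\<gamma> = SL2Z_T n ** (SL2Z_S ** \<delta>)"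
      unfolding \<delta>_def matrix_mul_assoc
      by (simp add: matrix_mul_assoc[symmetric, of "adj2 SL2Z_S"] matrix_mul_assoc[symmetric, of "SL2Z_T n"]
          SL2Z_adj2[OF SL2Z_S] SL2Z_adj2[OF SL2Z_T])
    moreover have "P (SL2Z_T n ** (SL2Z_S ** \<delta>))"
      by (intro mult S T SL2Z_S SL2Z_T SL2Z_mult d \<open>P \<delta>\<close>)
    ultimately show ?thesis by metis
  qed
qed

text \<open>The laws for the generators propagate along products. Backward translations are obtained
  from the forward law at the shifted point, where \<open>Ad (SL2Z_T 1)\<close> is cancelled with
  \<open>Ad_adj2\<close>.\<close>

lemma Ad_equivariant_iff:
  "(\<forall>\<gamma>\<in>SL2Z. \<forall>\<tau>\<in>\<H>. f (moebius \<gamma> \<tau>) = Ad \<gamma> (f \<tau>)) \<longleftrightarrow>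
   (\<forall>\<tau>\<in>\<H>. f (\<tau> + 1) = Ad (SL2Z_T 1) (f \<tau>) \<and> f (- 1 / \<tau>) = Ad SL2Z_S (f \<tau>))"
  (is "?L \<longleftrightarrow> ?R")
proof
  assume ?L
  then have "\<forall>\<tau>\<in>\<H>. f (moebius (SL2Z_T 1) \<tau>) = Ad (SL2Z_T 1) (f \<tau>)"
    "\<forall>\<tau>\<in>\<H>. f (moebius SL2Z_S \<tau>) = Ad SL2Z_S (f \<tau>)"
    using SL2Z_S SL2Z_T by blast+
  then show ?R by (simp add: moebius_S moebius_T)
next
  assume R: ?R
  show ?L
  proof
    fix \<gamma> assume "\<gamma> \<in> SL2Z"
    then show "\<forall>\<tau>\<in>\<H>. f (moebius \<gamma> \<tau>) = Ad \<gamma> (f \<tau>)"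
    proof (induction rule: SL2Z_induct)
      case S
      then show ?case using R by (simp add: moebius_S)
    next
      case (T n)
      have T_add: "Ad (SL2Z_T (m + n)) A = Ad (SL2Z_T m) (Ad (SL2Z_T n) A)" for m n A
      proof -
        have "SL2Z_T (m + n) = SL2Z_T m ** SL2Z_T n"
          by (simp add: SL2Z_T_def mat2_eq_iff matrix_mult_2)
        then show ?thesis by (simp add: Ad_mult SL2Z_T)
      qed
      have step: "f (\<tau> + 1) = Ad (SL2Z_T 1) (f \<tau>)" if "\<tau> \<in> \<H>" for \<tau>
        using R that by blast
      show ?case
      proof (induction n rule: int_induct[where k = 0])
        case base
        have "SL2Z_T 0 = mat 1" by (simp add: SL2Z_T_def mat_2)
        moreover have "adj2 (mat 1 :: int^2^2) = mat 1" by (simp add: adj2_def mat_2)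
        ultimately show ?case using SL2Z_T[of 0] moebius_T[of 0] by (simp add: Ad_eq cmat_1)
      next
        case (step1 n)
        show ?case
        proof
          fix \<tau> assume \<tau>: "\<tau> \<in> \<H>"
          then have "f (\<tau> + of_int n + 1) = Ad (SL2Z_T 1) (Ad (SL2Z_T n) (f \<tau>))"
            using step1 step[of "\<tau> + of_int n"] by (simp add: moebius_T upper_half_plane_def)
          then show "f (moebius (SL2Z_T (n + 1)) \<tau>) = Ad (SL2Z_T (n + 1)) (f \<tau>)"
            using T_add[of 1 n] by (simp add: moebius_T add_ac)
        qed
      next
        case (step2 n)
        show ?case
        proof
          fix \<tau> assume \<tau>: "\<tau> \<in> \<H>"
          then have "Ad (SL2Z_T 1) (f (\<tau> + of_int n - 1)) = Ad (SL2Z_T n) (f \<tau>)"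
            using step2 step[of "\<tau> + of_int n - 1"] by (simp add: moebius_T upper_half_plane_def)
          also have "\<dots> = Ad (SL2Z_T 1) (Ad (SL2Z_T (n - 1)) (f \<tau>))"
            using T_add[of 1 "n - 1"] by simp
          finally have "f (\<tau> + of_int n - 1) = Ad (SL2Z_T (n - 1)) (f \<tau>)"
            using Ad_adj2[OF SL2Z_T[of 1]] by metis
          then show "f (moebius (SL2Z_T (n - 1)) \<tau>) = Ad (SL2Z_T (n - 1)) (f \<tau>)"
            by (simp add: moebius_T algebra_simps)
        qed
      qed
    next
      case (mult \<gamma> \<delta>)
      then show ?case by (simp add: moebius_mult SL2Z_mult moebius_uhp Ad_mult)
    qed
  qed
qed

lemma Ad_bounded:
  assumes "\<gamma> \<in> SL2Z"
  obtains K where "K > 0" "\<And>A. norm (Ad \<gamma> A) \<le> K * norm A"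
proof -
  have "linear (Ad \<gamma>)"
    unfolding Ad_eq[OF assms, abs_def]
    by (intro linearI) (simp_all add: vec_eq_iff matrix_mult_2 algebra_simps)
  then show ?thesis using linear_bounded_pos[of "Ad \<gamma>"] that by blast
qed

text \<open>Equivariance writes \<open>f \<tau>\<close> as \<open>Ad (adj2 g)\<close> applied to the
  value of \<open>f\<close> at \<open>moebius g \<tau>\<close>, and \<open>Ad\<close> of a fixed
  matrix is a bounded operator. So the bound at infinity carries over to every cusp, with a constant
  that depends on \<open>g\<close>.\<close>

lemma exp_growth_at_cusps_iff:
  assumes f: "\<forall>\<gamma>\<in>SL2Z. \<forall>\<tau>\<in>\<H>. f (moebius \<gamma> \<tau>) = Ad \<gamma> (f \<tau>)"
  shows "exp_growth_at_cusps f \<longleftrightarrow> exp_bounded f"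
proof
  assume g: "exp_growth_at_cusps f"
  have 1: "mat 1 \<in> SL2Z" by (simp add: SL2Z_def)
  have 2: "cusp_act (mat 1) Cusp_Inf = Cusp_Inf" by (simp add: mat_def)
  have 3: "moebius (mat 1) \<tau> = \<tau>" for \<tau> by (simp add: moebius_def mat_def)
  obtain C M Y where *: "\<forall>\<tau>\<in>\<H>. Im (moebius (mat 1) \<tau>) > Y \<longrightarrow>
      norm (f \<tau>) < C * exp (M * cmod (moebius (mat 1) \<tau>))"
    using g 1 2 unfolding exp_growth_at_cusps_def by blast
  show "exp_bounded f"
    by (rule exp_boundedI[of Y _ C M]) (use * in \<open>auto simp: 3 upper_half_plane_def intro: less_imp_le\<close>)
next
  assume "exp_bounded f"
  then obtain C M Y where b: "C \<ge> 0" "M \<ge> 0" "Y \<ge> 0" "\<And>\<tau>. Im \<tau> > Y \<Longrightarrow> norm (f \<tau>) \<le> C * exp (M * cmod \<tau>)"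
    using exp_boundedE by blast
  show "exp_growth_at_cusps f" unfolding exp_growth_at_cusps_def
  proof (intro allI ballI impI)
    fix s g assume g: "g \<in> SL2Z"
    obtain K where K: "K > 0" "\<And>A. norm (Ad (adj2 g) A) \<le> K * norm A"
      using Ad_bounded[OF SL2Z_adj2(3)[OF g]] by blast
    \<comment> \<open>The summand 1 makes the bound strict, also for \<open>C = 0\<close>.\<close>
    have "norm (f \<tau>) < (K * C + 1) * exp (M * cmod (moebius g \<tau>))"
      if \<tau>: "\<tau> \<in> \<H>" and "Im (moebius g \<tau>) > Y" for \<tau>
    proof -
      have "norm (f \<tau>) = norm (Ad (adj2 g) (f (moebius g \<tau>)))"
        using f g \<tau> by (simp add: Ad_adj2)
      also have "\<dots> \<le> K * norm (f (moebius g \<tau>))" by (rule K)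
      also have "\<dots> \<le> K * (C * exp (M * cmod (moebius g \<tau>)))"
        using K(1) by (intro mult_left_mono b that) auto
      also have "\<dots> < (K * C + 1) * exp (M * cmod (moebius g \<tau>))"
        by (simp add: algebra_simps)
      finally show ?thesis .
    qed
    then show "\<exists>C M Y. \<forall>\<tau>\<in>\<H>. Im (moebius g \<tau>) > Y \<longrightarrow>
        norm (f \<tau>) < C * exp (M * cmod (moebius g \<tau>))" by blast
  qed
qed

lemma norm_matrix_le_sum: "norm A \<le> (\<Sum>i\<in>UNIV. \<Sum>j\<in>UNIV. norm (A$i$j))" for A :: "complex^'n^'m"
proof -
  have "norm A \<le> (\<Sum>i\<in>UNIV. norm (A$i))" unfolding norm_vec_def by (rule L2_set_le_sum) simp
  also have "\<dots> \<le> (\<Sum>i\<in>UNIV. \<Sum>j\<in>UNIV. norm (A$i$j))"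
    by (intro sum_mono) (simp add: norm_vec_def L2_set_le_sum)
  finally show ?thesis .
qed

lemma exp_bounded_matrix_iff: "exp_bounded f \<longleftrightarrow> (\<forall>i j. exp_bounded (\<lambda>\<tau>. f \<tau> $ i $ j))"
  for f :: "complex \<Rightarrow> complex^2^2"
proof
  assume f: "exp_bounded f"
  have "norm (f \<tau> $ i $ j) \<le> 1 * norm (f \<tau>)" for \<tau> i j
    by (metis Finite_Cartesian_Product.norm_nth_le mult_1 order_trans)
  then show "\<forall>i j. exp_bounded (\<lambda>\<tau>. f \<tau> $ i $ j)"
    by (intro allI exp_bounded_norm_le[OF f, of _ 1])
next
  assume f: "\<forall>i j. exp_bounded (\<lambda>\<tau>. f \<tau> $ i $ j)"
  have nb: "exp_bounded (\<lambda>\<tau>. norm (f \<tau> $ i $ j))" for i j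
    using f unfolding exp_bounded_def by simp
  have "exp_bounded (\<lambda>\<tau>. (norm (f \<tau> $ 1 $ 1) + norm (f \<tau> $ 1 $ 2)) + (norm (f \<tau> $ 2 $ 1) + norm (f \<tau> $ 2 $ 2)))"
    by (intro exp_bounded_add nb)
  then show "exp_bounded f"
  proof (rule exp_bounded_norm_le[where K = 1])
    fix \<tau>
    show "norm (f \<tau>) \<le> 1 * norm ((norm (f \<tau> $ 1 $ 1) + norm (f \<tau> $ 1 $ 2)) + (norm (f \<tau> $ 2 $ 1) + norm (f \<tau> $ 2 $ 2)))"
      using norm_matrix_le_sum[of "f \<tau>"] by (simp add: sum_2)
  qed
qed

abbreviation modular_lie :: "(complex \<Rightarrow> complex^2^2) lie_struct" where
  "modular_lie \<equiv> automorphic_lie_algebra sl SL2Z Ad"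

lemma modular_lie_carrier_iff:
  "f \<in> lie_carrier modular_lie \<longleftrightarrow>
     (\<forall>\<tau>. \<tau> \<notin> \<H> \<longrightarrow> f \<tau> = 0) \<and>
     (\<forall>\<tau>\<in>\<H>. f \<tau>$2$2 = - f \<tau>$1$1) \<and>
     (\<forall>i j. (\<lambda>\<tau>. f \<tau> $ i $ j) holomorphic_on \<H>) \<and>
     (\<forall>\<tau>\<in>\<H>. f (\<tau> + 1) = Ad (SL2Z_T 1) (f \<tau>) \<and> f (- 1 / \<tau>) = Ad SL2Z_S (f \<tau>)) \<and>
     (\<forall>i j. exp_bounded (\<lambda>\<tau>. f \<tau> $ i $ j))"
  unfolding automorphic_lie_algebra_def sl_def trace_2 Ad_equivariant_iff[symmetric] exp_bounded_matrix_iff[symmetric]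
  using exp_growth_at_cusps_iff[of f] by (auto simp: eq_neg_iff_add_eq_0 add.commute)

section \<open>Decomposition of automorphic maps\<close>

lemma a_fun_plus_1: "a_fun (\<tau> + 1) = a_fun \<tau>"
  by (simp add: a_fun_def E2_plus_1)

text \<open>The factor 2 pi i / 12 in \<open>a_fun\<close> reduces the anomalous summand of the law
  for \<open>E2\<close> to \<tau> itself, which is what the entries of \<open>Phi1\<close>
  require.\<close>

lemma a_fun_inverse:
  assumes "\<tau> \<in> \<H>"
  shows "a_fun (- 1 / \<tau>) = \<tau>\<^sup>2 * a_fun \<tau> + \<tau>"
  unfolding a_fun_def E2_inverse[OF assms] by (simp add: field_simps)

lemma a_fun_holomorphic [holomorphic_intros]: "a_fun holomorphic_on \<H>"
  unfolding a_fun_def[abs_def] by (intro holomorphic_intros) auto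

lemma exp_bounded_a_fun: "exp_bounded a_fun"
proof -
  have e: "a_fun = (\<lambda>\<tau>. (2 * of_real pi * \<i> / 12) * E2 \<tau>)" by (simp add: a_fun_def fun_eq_iff)
  show ?thesis unfolding e by (intro exp_bounded_intros exp_bounded_E2)
qed

section \<open>Conjugation by \<open>Phi1\<close>\<close>

definition Phi1_inv :: "complex \<Rightarrow> complex^2^2" where
  "Phi1_inv \<tau> = mat2 1 (- \<tau>) (- a_fun \<tau>) (1 + \<tau> * a_fun \<tau>)"

lemma Phi1_mult_inv: "Phi1 \<tau> ** Phi1_inv \<tau> = mat 1" and Phi1_inv_mult: "Phi1_inv \<tau> ** Phi1 \<tau> = mat 1"
  by (simp_all add: Phi1_def Phi1_inv_def mat2_mult mat_2 algebra_simps)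

lemma matrix_inv_Phi1: "matrix_inv (Phi1 \<tau>) = Phi1_inv \<tau>"
  by (rule matrix_inv_eqI[OF Phi1_mult_inv])

definition frame :: "complex \<Rightarrow> complex^2^2 \<Rightarrow> complex^2^2" where
  "frame \<tau> X = Phi1 \<tau> ** X ** Phi1_inv \<tau>"

definition unframe :: "complex \<Rightarrow> complex^2^2 \<Rightarrow> complex^2^2" where
  "unframe \<tau> A = Phi1_inv \<tau> ** A ** Phi1 \<tau>"

lemma unframe_frame: "unframe \<tau> (frame \<tau> X) = X"
  unfolding unframe_def frame_def matrix_mul_assoc Phi1_inv_mult
  by (simp add: Phi1_inv_mult flip: matrix_mul_assoc)

lemma frame_unframe: "frame \<tau> (unframe \<tau> X) = X"
  unfolding unframe_def frame_def matrix_mul_assoc Phi1_mult_inv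
  by (simp add: Phi1_mult_inv flip: matrix_mul_assoc)

lemma frame_mult: "frame \<tau> X ** frame \<tau> Y = frame \<tau> (X ** Y)"
proof -
  have "frame \<tau> X ** frame \<tau> Y = Phi1 \<tau> ** X ** (Phi1_inv \<tau> ** Phi1 \<tau>) ** Y ** Phi1_inv \<tau>"
    by (simp only: frame_def matrix_mul_assoc)
  then show ?thesis by (simp add: Phi1_inv_mult frame_def matrix_mul_assoc)
qed

lemma frame_mat_1: "frame \<tau> (mat 1) = mat 1"
  by (simp add: frame_def Phi1_mult_inv)

lemma frame_add: "frame \<tau> (X + Y) = frame \<tau> X + frame \<tau> Y"
  and frame_diff: "frame \<tau> (X - Y) = frame \<tau> X - frame \<tau> Y"
  and frame_mscale: "frame \<tau> (mscale c X) = mscale c (frame \<tau> X)"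
  by (simp_all add: frame_def mat2_eq_iff matrix_mult_2 algebra_simps)

lemma trace_frame: "trace (frame \<tau> X) = trace X"
  unfolding frame_def by (subst trace_mul_sym) (simp add: matrix_mul_assoc Phi1_inv_mult)

lemma trace_unframe: "trace (unframe \<tau> X) = trace X"
  using trace_frame[of \<tau> "unframe \<tau> X"] by (simp add: frame_unframe)

lemma Phi1_plus_1:
  "Phi1 (\<tau> + 1) = cmat (SL2Z_T 1) ** Phi1 \<tau>"
  "Phi1_inv (\<tau> + 1) = Phi1_inv \<tau> ** cmat (adj2 (SL2Z_T 1))"
  unfolding Phi1_def Phi1_inv_def a_fun_plus_1
  by (simp_all add: mat2_eq_iff matrix_mult_2 SL2Z_T_def adj2_def algebra_simps)

text \<open>The columns of \<open>Phi1\<close> are vector-valued forms of weights 1 and -1: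
  inversion acts by \<open>SL2Z_S\<close> and by the scalars \<tau> and 1/\<tau>. In the conjugated
  matrix the off-diagonal entries therefore acquire the factors 1/\<tau>^2 and \<tau>^2.\<close>

lemma Phi1_inverse:
  assumes "\<tau> \<in> \<H>"
  shows "Phi1 (- 1 / \<tau>) = cmat SL2Z_S ** Phi1 \<tau> ** mat2 \<tau> 0 0 (1 / \<tau>)"
    "Phi1_inv (- 1 / \<tau>) = mat2 (1 / \<tau>) 0 0 \<tau> ** Phi1_inv \<tau> ** cmat (adj2 SL2Z_S)"
proof -
  have "\<tau> \<noteq> 0" by (rule uhp_nonzero[OF assms])
  then show "Phi1 (- 1 / \<tau>) = cmat SL2Z_S ** Phi1 \<tau> ** mat2 \<tau> 0 0 (1 / \<tau>)"
    "Phi1_inv (- 1 / \<tau>) = mat2 (1 / \<tau>) 0 0 \<tau> ** Phi1_inv \<tau> ** cmat (adj2 SL2Z_S)"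
    unfolding Phi1_def Phi1_inv_def a_fun_inverse[OF assms]
    by (simp_all add: mat2_eq_iff matrix_mult_2 SL2Z_S_def adj2_def field_simps power2_eq_square)
qed

lemma frame_plus_1: "frame (\<tau> + 1) X = Ad (SL2Z_T 1) (frame \<tau> X)"
  by (simp add: frame_def Phi1_plus_1 Ad_eq SL2Z_T matrix_mul_assoc)

lemma frame_inverse:
  assumes "\<tau> \<in> \<H>"
  shows "frame (- 1 / \<tau>) X = Ad SL2Z_S (frame \<tau> (mat2 \<tau> 0 0 (1 / \<tau>) ** X ** mat2 (1 / \<tau>) 0 0 \<tau>))"
  unfolding frame_def Phi1_inverse[OF assms] by (simp add: Ad_eq SL2Z_S matrix_mul_assoc)

lemma holomorphic_on_all_2:
  fixes X :: "complex \<Rightarrow> complex^2^2"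
  assumes "(\<lambda>\<tau>. X \<tau> $ 1 $ 1) holomorphic_on S" "(\<lambda>\<tau>. X \<tau> $ 1 $ 2) holomorphic_on S"
    "(\<lambda>\<tau>. X \<tau> $ 2 $ 1) holomorphic_on S" "(\<lambda>\<tau>. X \<tau> $ 2 $ 2) holomorphic_on S"
  shows "\<forall>i j. (\<lambda>\<tau>. X \<tau> $ i $ j) holomorphic_on S"
  using assms by (simp add: forall_2)

lemma exp_bounded_all_2:
  fixes X :: "complex \<Rightarrow> complex^2^2"
  assumes "exp_bounded (\<lambda>\<tau>. X \<tau> $ 1 $ 1)" "exp_bounded (\<lambda>\<tau>. X \<tau> $ 1 $ 2)"
    "exp_bounded (\<lambda>\<tau>. X \<tau> $ 2 $ 1)" "exp_bounded (\<lambda>\<tau>. X \<tau> $ 2 $ 2)"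
  shows "\<forall>i j. exp_bounded (\<lambda>\<tau>. X \<tau> $ i $ j)"
  using assms by (simp add: forall_2)

lemma holomorphic_on_matrix_mult:
  fixes X Y :: "complex \<Rightarrow> complex^2^2"
  assumes "\<forall>i j. (\<lambda>\<tau>. X \<tau> $ i $ j) holomorphic_on S" "\<forall>i j. (\<lambda>\<tau>. Y \<tau> $ i $ j) holomorphic_on S"
  shows "\<forall>i j. (\<lambda>\<tau>. (X \<tau> ** Y \<tau>) $ i $ j) holomorphic_on S"
  unfolding matrix_mult_2 using assms by (auto intro!: holomorphic_intros)

lemma exp_bounded_matrix_mult:
  fixes X Y :: "complex \<Rightarrow> complex^2^2"
  assumes "\<forall>i j. exp_bounded (\<lambda>\<tau>. X \<tau> $ i $ j)" "\<forall>i j. exp_bounded (\<lambda>\<tau>. Y \<tau> $ i $ j)"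
  shows "\<forall>i j. exp_bounded (\<lambda>\<tau>. (X \<tau> ** Y \<tau>) $ i $ j)"
  unfolding matrix_mult_2 using assms by (auto intro!: exp_bounded_intros)

lemma Phi1_holomorphic:
  "\<forall>i j. (\<lambda>\<tau>. Phi1 \<tau> $ i $ j) holomorphic_on \<H>"
  "\<forall>i j. (\<lambda>\<tau>. Phi1_inv \<tau> $ i $ j) holomorphic_on \<H>"
  unfolding Phi1_def Phi1_inv_def
  by (rule holomorphic_on_all_2; auto intro!: holomorphic_intros)+

lemma Phi1_exp_bounded:
  "\<forall>i j. exp_bounded (\<lambda>\<tau>. Phi1 \<tau> $ i $ j)"
  "\<forall>i j. exp_bounded (\<lambda>\<tau>. Phi1_inv \<tau> $ i $ j)"
  unfolding Phi1_def Phi1_inv_def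
  by (rule exp_bounded_all_2; auto intro!: exp_bounded_intros exp_bounded_a_fun)+

lemma frame_in_carrier:
  assumes hol: "x holomorphic_on \<H>" "y holomorphic_on \<H>" "z holomorphic_on \<H>"
    and bd: "exp_bounded x" "exp_bounded y" "exp_bounded z"
    and T: "\<And>\<tau>. \<tau> \<in> \<H> \<Longrightarrow> x (\<tau> + 1) = x \<tau> \<and> y (\<tau> + 1) = y \<tau> \<and> z (\<tau> + 1) = z \<tau>"
    and S: "\<And>\<tau>. \<tau> \<in> \<H> \<Longrightarrow> x (- 1 / \<tau>) = x \<tau> \<and> y (- 1 / \<tau>) = y \<tau> / \<tau>\<^sup>2 \<and> z (- 1 / \<tau>) = \<tau>\<^sup>2 * z \<tau>"
  shows "(\<lambda>\<tau>. if \<tau> \<in> \<H> then frame \<tau> (mat2 (x \<tau>) (y \<tau>) (z \<tau>) (- x \<tau>)) else 0) \<in> lie_carrier modular_lie"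
proof -
  define X where "X \<tau> = mat2 (x \<tau>) (y \<tau>) (z \<tau>) (- x \<tau>)" for \<tau>
  define F where "F \<tau> = (if \<tau> \<in> \<H> then frame \<tau> (X \<tau>) else 0)" for \<tau>
  have f: "F \<tau> = frame \<tau> (X \<tau>)" if "\<tau> \<in> \<H>" for \<tau> using that by (simp add: F_def)
  have "\<forall>i j. (\<lambda>\<tau>. X \<tau> $ i $ j) holomorphic_on \<H>"
    unfolding X_def by (rule holomorphic_on_all_2; auto intro!: holomorphic_intros hol)
  then have h: "\<forall>i j. (\<lambda>\<tau>. frame \<tau> (X \<tau>) $ i $ j) holomorphic_on \<H>"
    unfolding frame_def by (intro holomorphic_on_matrix_mult Phi1_holomorphic)
  have "\<forall>i j. exp_bounded (\<lambda>\<tau>. X \<tau> $ i $ j)"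
    unfolding X_def by (rule exp_bounded_all_2; auto intro!: exp_bounded_minus bd)
  then have b: "\<forall>i j. exp_bounded (\<lambda>\<tau>. frame \<tau> (X \<tau>) $ i $ j)"
    unfolding frame_def by (intro exp_bounded_matrix_mult Phi1_exp_bounded)
  have "F \<in> lie_carrier modular_lie" unfolding modular_lie_carrier_iff
  proof (intro conjI ballI allI impI)
    fix \<tau> assume \<tau>: "\<tau> \<in> \<H>"
    have "trace (frame \<tau> (X \<tau>)) = 0" unfolding trace_frame by (simp add: X_def trace_2)
    then show "F \<tau> $ 2 $ 2 = - F \<tau> $ 1 $ 1"
      unfolding f[OF \<tau>] by (simp add: trace_2 add_eq_0_iff)
    have "X (\<tau> + 1) = X \<tau>" using T[OF \<tau>] by (simp add: X_def)
    then show "F (\<tau> + 1) = Ad (SL2Z_T 1) (F \<tau>)"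
      unfolding f[OF \<tau>] f[OF uhp_plus_1[THEN iffD2, OF \<tau>]] by (simp only: frame_plus_1)
    have "\<tau> \<noteq> 0" by (rule uhp_nonzero[OF \<tau>])
    then have "mat2 \<tau> 0 0 (1 / \<tau>) ** X (- 1 / \<tau>) ** mat2 (1 / \<tau>) 0 0 \<tau> = X \<tau>"
      using S[OF \<tau>] unfolding X_def by (simp add: mat2_mult power2_eq_square)
    then show "F (- 1 / \<tau>) = Ad SL2Z_S (F \<tau>)"
      unfolding f[OF \<tau>] f[OF uhp_inverse[OF \<tau>]] frame_inverse[OF \<tau>] by (simp only:)
  next
    fix i j
    show "(\<lambda>\<tau>. F \<tau> $ i $ j) holomorphic_on \<H>"
      by (rule holomorphic_transform[of "\<lambda>\<tau>. frame \<tau> (X \<tau>) $ i $ j"]) (use h f in auto)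
    have "exp_bounded (\<lambda>\<tau>. F \<tau> $ i $ j) \<longleftrightarrow> exp_bounded (\<lambda>\<tau>. frame \<tau> (X \<tau>) $ i $ j)"
      by (rule exp_bounded_cong) (use f in auto)
    then show "exp_bounded (\<lambda>\<tau>. F \<tau> $ i $ j)" using b by simp
  qed (simp add: F_def)
  then show ?thesis unfolding F_def[abs_def] X_def .
qed

definition e_coeff :: "complex \<Rightarrow> complex" where
  "e_coeff \<tau> = inverse (mod_discr \<tau>) * E4 \<tau> * E6 \<tau>"

definition f_coeff :: "complex \<Rightarrow> complex" where
  "f_coeff \<tau> = inverse (mod_discr \<tau>) * E4 \<tau> ^ 2 * E6 \<tau>"

lemma carrier_decomposition:
  assumes f: "f \<in> lie_carrier modular_lie"
  obtains p r s where "\<And>\<tau>. \<tau> \<in> \<H> \<Longrightarrow> f \<tau> =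
    frame \<tau> (mat2 (poly p (klein_j \<tau>)) (poly r (klein_j \<tau>) * e_coeff \<tau>)
      (poly s (klein_j \<tau>) * f_coeff \<tau>) (- poly p (klein_j \<tau>)))"
proof -
  note f = f[unfolded modular_lie_carrier_iff]
  define X where "X \<tau> = unframe \<tau> (f \<tau>)" for \<tau>
  have fX: "f \<tau> = frame \<tau> (X \<tau>)" for \<tau> by (simp add: X_def frame_unframe)
  have h: "(\<lambda>\<tau>. X \<tau> $ i $ j) holomorphic_on \<H>" for i j
  proof -
    have "\<forall>i j. (\<lambda>\<tau>. X \<tau> $ i $ j) holomorphic_on \<H>"
      unfolding X_def unframe_def using f by (intro holomorphic_on_matrix_mult Phi1_holomorphic) auto
    then show ?thesis by blast
  qed
  have b: "exp_bounded (\<lambda>\<tau>. X \<tau> $ i $ j)" for i j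
  proof -
    have "\<forall>i j. exp_bounded (\<lambda>\<tau>. X \<tau> $ i $ j)"
      unfolding X_def unframe_def using f by (intro exp_bounded_matrix_mult Phi1_exp_bounded) auto
    then show ?thesis by blast
  qed
  have tr: "X \<tau> $ 2 $ 2 = - X \<tau> $ 1 $ 1" if "\<tau> \<in> \<H>" for \<tau>
  proof -
    have "trace (f \<tau>) = 0" using f that by (simp add: trace_2)
    then have "trace (X \<tau>) = 0" by (simp add: X_def trace_unframe)
    then show ?thesis by (simp add: trace_2 add_eq_0_iff)
  qed
  have Ad_inj: "Ad \<gamma> A = Ad \<gamma> B \<Longrightarrow> A = B" if "\<gamma> \<in> SL2Z" for \<gamma> A B
    using Ad_adj2[OF that] by metis
  have frame_inj: "frame \<tau> A = frame \<tau> B \<Longrightarrow> A = B" for \<tau> A B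
    using unframe_frame by metis
  have T: "X (\<tau> + 1) = X \<tau>" if "\<tau> \<in> \<H>" for \<tau>
  proof -
    have "f (\<tau> + 1) = Ad (SL2Z_T 1) (f \<tau>)" using f that by blast
    then show ?thesis unfolding fX frame_plus_1 by (rule frame_inj[OF Ad_inj[OF SL2Z_T]])
  qed
  have S: "X (- 1 / \<tau>) = mat2 (1 / \<tau>) 0 0 \<tau> ** X \<tau> ** mat2 \<tau> 0 0 (1 / \<tau>)" if \<tau>: "\<tau> \<in> \<H>" for \<tau>
  proof -
    have nz: "\<tau> \<noteq> 0" by (rule uhp_nonzero[OF \<tau>])
    have "f (- 1 / \<tau>) = Ad SL2Z_S (f \<tau>)" using f that by blast
    then have "mat2 \<tau> 0 0 (1 / \<tau>) ** X (- 1 / \<tau>) ** mat2 (1 / \<tau>) 0 0 \<tau> = X \<tau>"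
      unfolding fX frame_inverse[OF \<tau>] by (rule frame_inj[OF Ad_inj[OF SL2Z_S]])
    then show ?thesis using nz
      by (simp add: mat2_eq_iff matrix_mult_2) (auto simp: field_simps)
  qed
  have S': "X (- 1 / \<tau>) $ 1 $ 1 = X \<tau> $ 1 $ 1" "X (- 1 / \<tau>) $ 1 $ 2 = X \<tau> $ 1 $ 2 / \<tau>\<^sup>2"
    "X (- 1 / \<tau>) $ 2 $ 1 = \<tau>\<^sup>2 * X \<tau> $ 2 $ 1" if \<tau>: "\<tau> \<in> \<H>" for \<tau>
  proof -
    have nz: "\<tau> \<noteq> 0" by (rule uhp_nonzero[OF \<tau>])
    then show "X (- 1 / \<tau>) $ 1 $ 1 = X \<tau> $ 1 $ 1" "X (- 1 / \<tau>) $ 1 $ 2 = X \<tau> $ 1 $ 2 / \<tau>\<^sup>2"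
      "X (- 1 / \<tau>) $ 2 $ 1 = \<tau>\<^sup>2 * X \<tau> $ 2 $ 1"
      unfolding S[OF \<tau>] by (simp_all add: matrix_mult_2 power2_eq_square)
  qed
  obtain p where p: "\<And>\<tau>. \<tau> \<in> \<H> \<Longrightarrow> X \<tau> $ 1 $ 1 = poly p (klein_j \<tau>)"
    by (rule weight_0_polynomial[of "\<lambda>\<tau>. X \<tau> $ 1 $ 1", OF h _ _ b], simp add: T, simp add: S'[simplified], blast)
  \<comment> \<open>The weight 6 - 4m is -2 for m = 2, and the remaining exponent 1 is that of
    \<open>E4\<close> in \<open>e_coeff\<close>. Below the diagonal m = 1 gives weight 2 and the
    exponent 2 of \<open>f_coeff\<close>.\<close>
  obtain r where r: "\<And>\<tau>. \<tau> \<in> \<H> \<Longrightarrow> X \<tau> $ 1 $ 2 = poly r (klein_j \<tau>) * e_coeff \<tau>"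
  proof (rule weight_polynomial[of "\<lambda>\<tau>. X \<tau> $ 1 $ 2" 2 1, OF h _ _ b])
    fix \<tau> assume \<tau>: "\<tau> \<in> \<H>"
    then show "X (\<tau> + 1) $ 1 $ 2 = X \<tau> $ 1 $ 2" by (simp add: T)
    have "\<tau> \<noteq> 0" by (rule uhp_nonzero[OF \<tau>])
    then show "X (- 1 / \<tau>) $ 1 $ 2 * \<tau> ^ (4 * 2 + 6) = \<tau> ^ 12 * X \<tau> $ 1 $ 2"
      unfolding S'[OF \<tau>] by (simp add: eval_nat_numeral)
  qed (simp, simp, unfold e_coeff_def power_one_right, blast)
  obtain s where s: "\<And>\<tau>. \<tau> \<in> \<H> \<Longrightarrow> X \<tau> $ 2 $ 1 = poly s (klein_j \<tau>) * f_coeff \<tau>"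
  proof (rule weight_polynomial[of "\<lambda>\<tau>. X \<tau> $ 2 $ 1" 1 2, OF h _ _ b])
    fix \<tau> assume \<tau>: "\<tau> \<in> \<H>"
    then show "X (\<tau> + 1) $ 2 $ 1 = X \<tau> $ 2 $ 1" by (simp add: T)
    show "X (- 1 / \<tau>) $ 2 $ 1 * \<tau> ^ (4 * 1 + 6) = \<tau> ^ 12 * X \<tau> $ 2 $ 1"
      unfolding S'[OF \<tau>] by (simp add: eval_nat_numeral)
  qed (simp, simp, unfold f_coeff_def, blast)
  show ?thesis
  proof (rule that)
    fix \<tau> assume \<tau>: "\<tau> \<in> \<H>"
    have "X \<tau> = mat2 (poly p (klein_j \<tau>)) (poly r (klein_j \<tau>) * e_coeff \<tau>)
      (poly s (klein_j \<tau>) * f_coeff \<tau>) (- poly p (klein_j \<tau>))"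
      using p[OF \<tau>] r[OF \<tau>] s[OF \<tau>] tr[OF \<tau>] by (simp add: mat2_eq_iff)
    then show "f \<tau> = frame \<tau> (mat2 (poly p (klein_j \<tau>)) (poly r (klein_j \<tau>) * e_coeff \<tau>)
      (poly s (klein_j \<tau>) * f_coeff \<tau>) (- poly p (klein_j \<tau>)))" by (simp add: fX)
  qed
qed

section \<open>The images of the two generators as automorphic maps\<close>

lemma h_bar_frame: "\<tau> \<in> \<H> \<Longrightarrow> h_bar \<tau> = frame \<tau> (mat2 1 0 0 (-1))"
  and e_bar_frame: "\<tau> \<in> \<H> \<Longrightarrow> e_bar \<tau> = frame \<tau> (mat2 0 (e_coeff \<tau>) 0 0)"
  and f_bar_frame: "\<tau> \<in> \<H> \<Longrightarrow> f_bar \<tau> = frame \<tau> (mat2 0 0 (f_coeff \<tau>) 0)"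
proof -
  assume \<tau>: "\<tau> \<in> \<H>"
  have e: "mat2 0 (e_coeff \<tau>) 0 0 = mscale (e_coeff \<tau>) (mat2 0 1 0 0)"
    and f: "mat2 0 0 (f_coeff \<tau>) 0 = mscale (f_coeff \<tau>) (mat2 0 0 1 0)"
    by (simp_all add: mat2_eq_iff)
  show "h_bar \<tau> = frame \<tau> (mat2 1 0 0 (-1))" "e_bar \<tau> = frame \<tau> (mat2 0 (e_coeff \<tau>) 0 0)"
    "f_bar \<tau> = frame \<tau> (mat2 0 0 (f_coeff \<tau>) 0)"
    unfolding e f frame_mscale
    using \<tau> by (simp_all add: h_bar_def e_bar_def f_bar_def matrix_inv_Phi1 e_coeff_def f_coeff_def frame_def)
qed

lemma h_bar_in_carrier: "h_bar \<in> lie_carrier modular_lie"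
proof -
  have "h_bar = (\<lambda>\<tau>. if \<tau> \<in> \<H> then frame \<tau> (mat2 1 0 0 (-1)) else 0)"
    using h_bar_frame by (auto simp: fun_eq_iff h_bar_def)
  also have "\<dots> \<in> lie_carrier modular_lie"
    using frame_in_carrier[of "\<lambda>_. 1" "\<lambda>_. 0" "\<lambda>_. 0"] by (simp add: exp_bounded_const)
  finally show ?thesis .
qed

text \<open>Half the trace of the rotation \<open>A1_bar \<tau> ** h_bar \<tau>\<close>. The
  elliptic values 0 and 1728 of j go to -1 and 1, where the two eigenvalues of the rotation
  coincide.\<close>

definition s_coeff :: "complex \<Rightarrow> complex" where
  "s_coeff \<tau> = (2 * klein_j \<tau> - 1728) / 1728"

lemma A1_bar_frame:
  assumes "\<tau> \<in> \<H>"
  shows "A1_bar \<tau> = frame \<tau> (mat2 (s_coeff \<tau>) (- (e_coeff \<tau> / 864)) (f_coeff \<tau> / 864) (- s_coeff \<tau>))"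
proof -
  have "A1_bar \<tau> = frame \<tau> (mscale (1 / 1728) (mscale (2 * klein_j \<tau> - 1728) (mat2 1 0 0 (-1))
      - mscale 2 (mat2 0 (e_coeff \<tau>) 0 0) + mscale 2 (mat2 0 0 (f_coeff \<tau>) 0)))"
    by (simp add: A1_bar_def h_bar_frame e_bar_frame f_bar_frame assms frame_add frame_diff frame_mscale)
  also have "mscale (1 / 1728) (mscale (2 * klein_j \<tau> - 1728) (mat2 1 0 0 (-1))
      - mscale 2 (mat2 0 (e_coeff \<tau>) 0 0) + mscale 2 (mat2 0 0 (f_coeff \<tau>) 0)) =
      mat2 (s_coeff \<tau>) (- (e_coeff \<tau> / 864)) (f_coeff \<tau> / 864) (- s_coeff \<tau>)"
    by (simp add: mat2_eq_iff s_coeff_def field_simps)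
  finally show ?thesis .
qed

lemma A1_bar_in_carrier: "A1_bar \<in> lie_carrier modular_lie"
proof -
  have "A1_bar = (\<lambda>\<tau>. if \<tau> \<in> \<H> then
      frame \<tau> (mat2 (s_coeff \<tau>) (- (e_coeff \<tau> / 864)) (f_coeff \<tau> / 864) (- s_coeff \<tau>)) else 0)"
    using A1_bar_frame by (auto simp: fun_eq_iff A1_bar_def h_bar_def e_bar_def f_bar_def mat2_eq_iff)
  also have "\<dots> \<in> lie_carrier modular_lie"
  proof (rule frame_in_carrier)
    show "s_coeff holomorphic_on \<H>" unfolding s_coeff_def[abs_def]
      by (intro holomorphic_intros) auto
    show "(\<lambda>\<tau>. - (e_coeff \<tau> / 864)) holomorphic_on \<H>"
      "(\<lambda>\<tau>. f_coeff \<tau> / 864) holomorphic_on \<H>"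
      unfolding e_coeff_def f_coeff_def
      by (intro holomorphic_intros; simp)+
    have s: "s_coeff = (\<lambda>\<tau>. (1 / 864) * klein_j \<tau> - 1)" by (simp add: s_coeff_def fun_eq_iff diff_divide_distrib)
    show "exp_bounded s_coeff"
      unfolding s by (intro exp_bounded_intros exp_bounded_klein_j)
    have "exp_bounded (\<lambda>\<tau>. (- 1 / 864) * e_coeff \<tau>)" "exp_bounded (\<lambda>\<tau>. (1 / 864) * f_coeff \<tau>)"
      unfolding e_coeff_def f_coeff_def
      by (intro exp_bounded_intros exp_bounded_E4 exp_bounded_E6 exp_bounded_inverse_mod_discr)+
    then show "exp_bounded (\<lambda>\<tau>. - (e_coeff \<tau> / 864))" "exp_bounded (\<lambda>\<tau>. f_coeff \<tau> / 864)" by simp_all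
    fix \<tau> assume \<tau>: "\<tau> \<in> \<H>"
    show "s_coeff (\<tau> + 1) = s_coeff \<tau> \<and> - (e_coeff (\<tau> + 1) / 864) = - (e_coeff \<tau> / 864) \<and> f_coeff (\<tau> + 1) / 864 = f_coeff \<tau> / 864"
      by (simp add: s_coeff_def e_coeff_def f_coeff_def klein_j_plus_1 E4_plus_1 E6_plus_1 mod_discr_plus_1)
    have "\<tau> \<noteq> 0" by (rule uhp_nonzero[OF \<tau>])
    then show "s_coeff (- 1 / \<tau>) = s_coeff \<tau> \<and> - (e_coeff (- 1 / \<tau>) / 864) = - (e_coeff \<tau> / 864) / \<tau>\<^sup>2 \<and>
        f_coeff (- 1 / \<tau>) / 864 = \<tau>\<^sup>2 * (f_coeff \<tau> / 864)"
      unfolding s_coeff_def e_coeff_def f_coeff_def klein_j_inverse[OF \<tau>] E4_inverse[OF \<tau>] E6_inverse[OF \<tau>] mod_discr_inverse[OF \<tau>]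
      by (simp add: field_simps eval_nat_numeral)
  qed
  finally show ?thesis .
qed

lemma e_coeff_mult_f_coeff:
  assumes "\<tau> \<in> \<H>"
  shows "e_coeff \<tau> * f_coeff \<tau> = klein_j \<tau> * (klein_j \<tau> - 1728)"
  unfolding klein_j_minus_1728[OF assms]
  by (simp add: e_coeff_def f_coeff_def klein_j_def divide_inverse eval_nat_numeral)

text \<open>Since the product of \<open>e_coeff\<close> and \<open>f_coeff\<close> is j (j - 1728)
  and 746496 = 864^2, this is a quadratic identity in j. It says that \<open>A1_bar\<close> squares
  to the identity, equivalently that the rotation has determinant 1.\<close>

lemma s_coeff_square:
  assumes "\<tau> \<in> \<H>"
  shows "(s_coeff \<tau>)\<^sup>2 - (e_coeff \<tau> / 864) * (f_coeff \<tau> / 864) = 1"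
proof -
  have e: "(e_coeff \<tau> / 864) * (f_coeff \<tau> / 864) = klein_j \<tau> * (klein_j \<tau> - 1728) / 746496"
    using e_coeff_mult_f_coeff[OF assms] by simp
  show ?thesis unfolding e by (simp add: s_coeff_def power2_eq_square field_simps)
qed

section \<open>The Onsager relations in the infinite dihedral group\<close>

lemma matrix_mult_linear:
  fixes A B C :: "complex^'n^'n"
  shows "(A + B) ** C = A ** C + B ** C" "C ** (A + B) = C ** A + C ** B"
    "(A - B) ** C = A ** C - B ** C" "C ** (A - B) = C ** A - C ** B"
  by (simp_all add: vec_eq_iff matrix_matrix_mult_def algebra_simps sum.distrib sum_subtractf)

text \<open>\<open>V\<close> stands for the inverse of \<open>U\<close>. Passing it as an argument
  gives negative powers by iteration and keeps them computable for the zero matrices that occur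
  outside the upper half-plane.\<close>

definition zpow :: "complex^'n^'n \<Rightarrow> complex^'n^'n \<Rightarrow> int \<Rightarrow> complex^'n^'n" where
  "zpow U V k = (if k \<ge> 0 then ((**) U ^^ nat k) (mat 1) else ((**) V ^^ nat (- k)) (mat 1))"

lemma zpow_0 [simp]: "zpow U V 0 = mat 1"
  by (simp add: zpow_def)

lemma zpow_plus_1:
  assumes "U ** V = mat 1"
  shows "zpow U V (k + 1) = U ** zpow U V k"
proof (cases "k \<ge> 0")
  case True
  then have "nat (k + 1) = Suc (nat k)" by simp
  then show ?thesis using True by (simp add: zpow_def)
next
  case False
  then have e: "nat (- k) = Suc (nat (- (k + 1)))" by simp
  have "zpow U V k = V ** zpow U V (k + 1)"
    using False unfolding zpow_def e by (cases "k = -1") auto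
  then show ?thesis using assms by (simp add: matrix_mul_assoc)
qed

lemma zpow_minus_1:
  assumes "U ** V = mat 1" "V ** U = mat 1"
  shows "zpow U V (k - 1) = V ** zpow U V k"
  using zpow_plus_1[OF assms(1), of "k - 1"] assms(2) by (simp add: matrix_mul_assoc)

lemma zpow_add:
  assumes "U ** V = mat 1" "V ** U = mat 1"
  shows "zpow U V (k + l) = zpow U V k ** zpow U V l"
proof (induction k rule: int_induct[where k = 0])
  case (step1 i)
  then show ?case using zpow_plus_1[OF assms(1), of "i + l"] zpow_plus_1[OF assms(1), of i]
    by (simp add: matrix_mul_assoc algebra_simps)
next
  case (step2 i)
  then show ?case using zpow_minus_1[OF assms, of "i + l"] zpow_minus_1[OF assms, of i]
    by (simp add: matrix_mul_assoc algebra_simps)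
qed simp

lemma zpow_conjugate:
  assumes UV: "U ** V = mat 1" "V ** U = mat 1" and h: "h ** h = mat 1" "h ** U ** h = V"
  shows "h ** zpow U V k = zpow U V (- k) ** h"
proof (induction k rule: int_induct[where k = 0])
  case (step1 i)
  have "h ** zpow U V (i + 1) = h ** U ** (h ** h) ** zpow U V i"
    using h(1) by (simp add: zpow_plus_1[OF UV(1)] matrix_mul_assoc)
  also have "\<dots> = V ** (h ** zpow U V i)" using h(2) by (simp add: matrix_mul_assoc)
  also have "\<dots> = zpow U V (- (i + 1)) ** h"
    unfolding step1 using zpow_minus_1[OF UV, of "- i"] by (simp add: matrix_mul_assoc)
  finally show ?case .
next
  case (step2 i)
  have "h ** V = (h ** h) ** U ** h" unfolding h(2)[symmetric] by (simp add: matrix_mul_assoc)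
  then have hV: "h ** V = U ** h" using h(1) by simp
  have "h ** zpow U V (i - 1) = h ** V ** zpow U V i"
    by (simp add: zpow_minus_1[OF UV] matrix_mul_assoc)
  also have "\<dots> = U ** (h ** zpow U V i)" by (simp add: hV matrix_mul_assoc)
  also have "\<dots> = zpow U V (- (i - 1)) ** h"
    unfolding step2 using zpow_plus_1[OF UV(1), of "- i"] by (simp add: matrix_mul_assoc)
  finally show ?case .
qed simp

definition involutions :: "complex^'n^'n \<Rightarrow> complex^'n^'n \<Rightarrow> bool" where
  "involutions h a \<longleftrightarrow> h ** h = mat 1 \<and> a ** a = mat 1"

definition dih_A :: "complex^'n^'n \<Rightarrow> complex^'n^'n \<Rightarrow> int \<Rightarrow> complex^'n^'n" where
  "dih_A h a k = zpow (a ** h) (h ** a) k ** h"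

definition dih_G :: "complex^'n^'n \<Rightarrow> complex^'n^'n \<Rightarrow> int \<Rightarrow> complex^'n^'n" where
  "dih_G h a m = zpow (a ** h) (h ** a) m - zpow (a ** h) (h ** a) (- m)"

context
  fixes h a :: "complex^'n^'n"
  assumes ha: "involutions h a"
begin

lemma h_square: "h ** h = mat 1" and a_square: "a ** a = mat 1"
  using ha by (auto simp: involutions_def)

lemma rotation_inverse: "(a ** h) ** (h ** a) = mat 1" "(h ** a) ** (a ** h) = mat 1"
proof -
  have "(a ** h) ** (h ** a) = a ** (h ** h) ** a" "(h ** a) ** (a ** h) = h ** (a ** a) ** h"
    by (simp_all only: matrix_mul_assoc)
  then show "(a ** h) ** (h ** a) = mat 1" "(h ** a) ** (a ** h) = mat 1" by (simp_all add: h_square a_square)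
qed

abbreviation "rot \<equiv> zpow (a ** h) (h ** a)"

lemma rot_add: "rot (k + l) = rot k ** rot l"
  by (rule zpow_add[OF rotation_inverse])

lemma h_rot: "h ** rot k = rot (- k) ** h"
proof (rule zpow_conjugate[OF rotation_inverse h_square])
  have "h ** (a ** h) ** h = h ** a ** (h ** h)" by (simp only: matrix_mul_assoc)
  then show "h ** (a ** h) ** h = h ** a" by (simp add: h_square)
qed

lemma dih_A_mult: "dih_A h a k ** dih_A h a l = rot (k - l)"
proof -
  have "dih_A h a k ** dih_A h a l = rot k ** (h ** rot l) ** h"
    by (simp only: dih_A_def matrix_mul_assoc)
  also have "\<dots> = rot k ** rot (- l) ** (h ** h)" by (simp only: h_rot matrix_mul_assoc)
  finally show ?thesis by (simp add: h_square flip: rot_add)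
qed

lemma rot_mult_dih_A: "rot m ** dih_A h a k = dih_A h a (k + m)"
  by (simp add: dih_A_def matrix_mul_assoc add.commute flip: rot_add)

lemma dih_A_mult_rot: "dih_A h a k ** rot m = dih_A h a (k - m)"
proof -
  have "dih_A h a k ** rot m = rot k ** (h ** rot m)" by (simp only: dih_A_def matrix_mul_assoc)
  also have "\<dots> = rot k ** rot (- m) ** h" by (simp only: h_rot matrix_mul_assoc)
  finally show ?thesis by (simp add: dih_A_def flip: rot_add)
qed

lemma commutator_dih_A_A: "commutator (dih_A h a k) (dih_A h a l) = dih_G h a (k - l)"
  by (simp add: commutator_def dih_A_mult dih_G_def)

text \<open>Multiplying a reflection by the m-th power of the rotation raises its index by m on the
  left and lowers it by m on the right. The four resulting terms agree in pairs, whence the factor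
  2.\<close>

lemma commutator_dih_G_A:
  "commutator (dih_G h a m) (dih_A h a k) = mscale 2 (dih_A h a (k + m)) - mscale 2 (dih_A h a (k - m))"
  by (simp add: commutator_def dih_G_def matrix_mult_linear rot_mult_dih_A dih_A_mult_rot
      vec_eq_iff)

lemma commutator_dih_G_G: "commutator (dih_G h a m) (dih_G h a n) = 0"
  by (simp add: commutator_def dih_G_def matrix_mult_linear algebra_simps flip: rot_add)

lemma dih_A_0: "dih_A h a 0 = h" and dih_A_1: "dih_A h a 1 = a"
proof -
  show "dih_A h a 0 = h" by (simp add: dih_A_def)
  have "rot 1 = a ** h" using zpow_plus_1[OF rotation_inverse(1), of 0] by simp
  then have "dih_A h a 1 = a ** (h ** h)" by (simp add: dih_A_def matrix_mul_assoc)
  then show "dih_A h a 1 = a" by (simp add: h_square)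
qed

end

text \<open>The power with exponent 0 is the identity even for the zero matrix. It is multiplied by
  \<open>h = 0\<close> in \<open>dih_A\<close> and cancels in \<open>dih_G\<close>, so all images
  vanish.\<close>

lemma dih_0: "dih_A 0 0 k = 0" "dih_G 0 0 m = 0"
proof -
  show "dih_A 0 0 k = 0" by (simp add: dih_A_def)
  have "((**) (0 :: complex^'n^'n) ^^ n) (mat 1) = (if n = 0 then mat 1 else 0)" for n
    by (cases n) auto
  then show "dih_G (0 :: complex^'n^'n) 0 m = 0" by (simp add: dih_G_def zpow_def)
qed

lemma dih_G_minus: "dih_G h a (- m) = - dih_G h a m"
  by (simp add: dih_G_def)

section \<open>Linear extension from the basis of the Onsager algebra\<close>

fun ons_image :: "complex^'n^'n \<Rightarrow> complex^'n^'n \<Rightarrow> onsager_index \<Rightarrow> complex^'n^'n" where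
  "ons_image h a (OA k) = dih_A h a k"
| "ons_image h a (OG n) = dih_G h a (int n + 1)"

definition ons_lin :: "(onsager_index \<Rightarrow> complex^'n^'n) \<Rightarrow> onsager \<Rightarrow> complex^'n^'n" where
  "ons_lin b x = (\<Sum>i\<in>Poly_Mapping.keys x. mscale (Poly_Mapping.lookup x i) (b i))"

lemma mscale_zero [simp]: "mscale 0 A = 0" "mscale c 0 = 0" and mscale_one [simp]: "mscale 1 A = A"
  and mscale_mscale: "mscale c (mscale d A) = mscale (c * d) A"
  and mscale_add_left: "mscale (c + d) A = mscale c A + mscale d A"
  and mscale_add_right: "mscale c (A + B) = mscale c A + mscale c B"
  and mscale_diff_right: "mscale c (A - B) = mscale c A - mscale c B"
  by (simp_all add: vec_eq_iff algebra_simps)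

lemma mscale_sum: "mscale c (sum f S) = (\<Sum>i\<in>S. mscale c (f i))"
  by (induction S rule: infinite_finite_induct) (simp_all add: mscale_add_right)

lemma lookup_ons_scale [simp]: "Poly_Mapping.lookup (ons_scale c x) i = c * Poly_Mapping.lookup x i"
  by (simp add: ons_scale_def Poly_Mapping.map.rep_eq when_def)

lemma ons_lin_superset:
  assumes "finite K" "Poly_Mapping.keys x \<subseteq> K"
  shows "ons_lin b x = (\<Sum>i\<in>K. mscale (Poly_Mapping.lookup x i) (b i))"
  unfolding ons_lin_def using assms by (intro sum.mono_neutral_left) (auto simp: in_keys_iff)

lemma ons_lin_add: "ons_lin b (x + y) = ons_lin b x + ons_lin b y"
proof -
  let ?K = "Poly_Mapping.keys x \<union> Poly_Mapping.keys y"
  have "Poly_Mapping.keys (x + y) \<subseteq> ?K" by (rule Poly_Mapping.keys_add)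
  then show ?thesis
    by (simp add: ons_lin_superset[of ?K] lookup_add mscale_add_left sum.distrib)
qed

lemma ons_lin_scale: "ons_lin b (ons_scale c x) = mscale c (ons_lin b x)"
proof -
  have "Poly_Mapping.keys (ons_scale c x) \<subseteq> Poly_Mapping.keys x" by (auto simp: in_keys_iff)
  then show ?thesis
    by (simp add: ons_lin_superset[of "Poly_Mapping.keys x"] mscale_sum mscale_mscale)
qed

lemma ons_lin_0 [simp]: "ons_lin b 0 = 0"
  by (simp add: ons_lin_def)

lemma ons_lin_minus: "ons_lin b (- x) = - ons_lin b x"
  using ons_lin_add[of b x "- x"] by (simp add: eq_neg_iff_add_eq_0 add.commute)

lemma ons_lin_diff: "ons_lin b (x - y) = ons_lin b x - ons_lin b y"
  using ons_lin_add[of b x "- y"] by (simp add: ons_lin_minus)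

lemma ons_lin_sum: "ons_lin b (sum f S) = (\<Sum>i\<in>S. ons_lin b (f i))"
  by (induction S rule: infinite_finite_induct) (simp_all add: ons_lin_add)

lemma ons_lin_single: "ons_lin b (Poly_Mapping.single i 1) = b i"
  by (simp add: ons_lin_def)

lemma commutator_sum_left: "commutator (sum f S) B = (\<Sum>i\<in>S. commutator (f i) B)"
  and commutator_sum_right: "commutator B (sum f S) = (\<Sum>i\<in>S. commutator B (f i))"
  by (induction S rule: infinite_finite_induct)
     (simp_all add: commutator_def matrix_mult_linear)

lemma commutator_mscale: "commutator (mscale c A) B = mscale c (commutator A B)"
  "commutator A (mscale c B) = mscale c (commutator A B)"
  by (simp_all add: commutator_def mscale_mult_left mscale_mult_right mscale_diff_right)

lemma ons_lin_bracket:
  assumes "\<And>i j. ons_lin b (ons_basis_bracket i j) = commutator (b i) (b j)"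
  shows "ons_lin b (ons_bracket x y) = commutator (ons_lin b x) (ons_lin b y)"
  unfolding ons_bracket_def ons_lin_sum ons_lin_scale assms
  unfolding ons_lin_def commutator_sum_left
  by (simp add: commutator_sum_right commutator_mscale mscale_mscale mscale_sum mult.commute)

lemma ons_lin_ons_A: "ons_lin (ons_image h a) (ons_A k) = dih_A h a k"
  by (simp add: ons_A_def ons_lin_single)

lemma ons_lin_ons_G: "ons_lin (ons_image h a) (ons_G m) = dih_G h a m"
proof -
  consider "m > 0" | "m < 0" | "m = 0" by linarith
  then show ?thesis
  proof cases
    case 2
    then show ?thesis using dih_G_minus[of h a "- m"] by (simp add: ons_G_def ons_lin_minus ons_lin_single)
  qed (auto simp: ons_G_def ons_lin_single dih_G_def)
qed

lemma commutator_anti: "commutator A B = - commutator B A"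
  by (simp add: commutator_def)

text \<open>The case \<open>h = a = 0\<close> occurs outside the upper half-plane, where maps are extended by \<open>0\<close>.\<close>

lemma ons_lin_basis_bracket:
  assumes "involutions h a \<or> h = 0 \<and> a = 0"
  shows "ons_lin (ons_image h a) (ons_basis_bracket i j) = commutator (ons_image h a i) (ons_image h a j)"
proof (cases "involutions h a")
  case True
  show ?thesis
  proof (cases i; cases j)
    fix k n assume "i = OA k" "j = OG n"
    then show ?thesis
      using commutator_anti[of "dih_A h a k" "dih_G h a (int n + 1)"]
      by (simp add: ons_lin_ons_A ons_lin_diff ons_lin_minus ons_lin_scale commutator_dih_G_A[OF True])
  qed (simp_all add: ons_lin_ons_A ons_lin_ons_G ons_lin_diff ons_lin_scale
      commutator_dih_A_A[OF True] commutator_dih_G_A[OF True] commutator_dih_G_G[OF True])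
next
  case False
  with assms have 0: "h = 0" "a = 0" by auto
  have im: "ons_image h a i = 0" for i unfolding 0 by (cases i) (simp_all add: dih_0)
  then show ?thesis by (simp add: ons_lin_def commutator_def)
qed

section \<open>The homomorphism and its surjectivity\<close>

lemma modular_lie_simps:
  "lie_scale modular_lie = (\<lambda>c f \<tau>. mscale c (f \<tau>))"
  "lie_bracket modular_lie = (\<lambda>f g \<tau>. commutator (f \<tau>) (g \<tau>))"
  by (simp_all add: automorphic_lie_algebra_def)

lemma Ad_linear:
  assumes "\<gamma> \<in> SL2Z"
  shows "Ad \<gamma> 0 = 0" "Ad \<gamma> (A + B) = Ad \<gamma> A + Ad \<gamma> B" "Ad \<gamma> (mscale c A) = mscale c (Ad \<gamma> A)"
    "Ad \<gamma> (commutator A B) = commutator (Ad \<gamma> A) (Ad \<gamma> B)"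
proof -
  have "cmat (adj2 \<gamma>) ** cmat \<gamma> = mat 1" by (simp add: SL2Z_adj2[OF assms] cmat_1 flip: cmat_mult)
  then have m: "Ad \<gamma> A ** Ad \<gamma> B = Ad \<gamma> (A ** B)" for A B
    unfolding Ad_eq[OF assms]
    by (metis (no_types, lifting) matrix_mul_assoc matrix_mul_rid)
  show "Ad \<gamma> 0 = 0" "Ad \<gamma> (A + B) = Ad \<gamma> A + Ad \<gamma> B" "Ad \<gamma> (mscale c A) = mscale c (Ad \<gamma> A)"
    by (simp_all add: Ad_eq[OF assms] matrix_mult_linear mscale_mult_left mscale_mult_right)
  show "Ad \<gamma> (commutator A B) = commutator (Ad \<gamma> A) (Ad \<gamma> B)"
    unfolding commutator_def m by (simp add: Ad_eq[OF assms] matrix_mult_linear)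
qed

lemma carrier_zero: "0 \<in> lie_carrier modular_lie"
  unfolding modular_lie_carrier_iff
  by (simp add: Ad_linear SL2Z_S SL2Z_T exp_bounded_const)

lemma carrier_add:
  assumes "f \<in> lie_carrier modular_lie" "g \<in> lie_carrier modular_lie"
  shows "f + g \<in> lie_carrier modular_lie"
  using assms unfolding modular_lie_carrier_iff
  by (auto simp: Ad_linear SL2Z_S SL2Z_T intro!: holomorphic_intros exp_bounded_add)

lemma carrier_scale:
  assumes "f \<in> lie_carrier modular_lie"
  shows "(\<lambda>\<tau>. mscale c (f \<tau>)) \<in> lie_carrier modular_lie"
  using assms unfolding modular_lie_carrier_iff
  by (auto simp: Ad_linear SL2Z_S SL2Z_T intro!: holomorphic_intros exp_bounded_intros)

lemma carrier_bracket:
  assumes f: "f \<in> lie_carrier modular_lie" and g: "g \<in> lie_carrier modular_lie"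
  shows "(\<lambda>\<tau>. commutator (f \<tau>) (g \<tau>)) \<in> lie_carrier modular_lie"
proof -
  note f = f[unfolded modular_lie_carrier_iff] and g = g[unfolded modular_lie_carrier_iff]
  have h: "\<forall>i j. (\<lambda>\<tau>. (f \<tau> ** g \<tau>) $ i $ j) holomorphic_on \<H>"
    "\<forall>i j. (\<lambda>\<tau>. (g \<tau> ** f \<tau>) $ i $ j) holomorphic_on \<H>"
    using f g by (intro holomorphic_on_matrix_mult; blast)+
  have b: "\<forall>i j. exp_bounded (\<lambda>\<tau>. (f \<tau> ** g \<tau>) $ i $ j)"
    "\<forall>i j. exp_bounded (\<lambda>\<tau>. (g \<tau> ** f \<tau>) $ i $ j)"
    using f g by (intro exp_bounded_matrix_mult; blast)+
  show ?thesis unfolding modular_lie_carrier_iff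
  proof (intro conjI ballI allI impI)
    fix \<tau> assume \<tau>: "\<tau> \<in> \<H>"
    show "commutator (f \<tau>) (g \<tau>) $ 2 $ 2 = - commutator (f \<tau>) (g \<tau>) $ 1 $ 1"
      by (simp add: commutator_def matrix_mult_2)
    have "f (\<tau> + 1) = Ad (SL2Z_T 1) (f \<tau>)" "g (\<tau> + 1) = Ad (SL2Z_T 1) (g \<tau>)"
      "f (- 1 / \<tau>) = Ad SL2Z_S (f \<tau>)" "g (- 1 / \<tau>) = Ad SL2Z_S (g \<tau>)"
      using f g \<tau> by blast+
    then show "commutator (f (\<tau> + 1)) (g (\<tau> + 1)) = Ad (SL2Z_T 1) (commutator (f \<tau>) (g \<tau>))"
      "commutator (f (- 1 / \<tau>)) (g (- 1 / \<tau>)) = Ad SL2Z_S (commutator (f \<tau>) (g \<tau>))"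
      by (simp_all only: Ad_linear SL2Z_S SL2Z_T)
  next
    fix i j
    show "(\<lambda>\<tau>. commutator (f \<tau>) (g \<tau>) $ i $ j) holomorphic_on \<H>"
      "exp_bounded (\<lambda>\<tau>. commutator (f \<tau>) (g \<tau>) $ i $ j)"
      using h b unfolding commutator_def vector_minus_component
      by (auto intro!: holomorphic_intros exp_bounded_diff)
  qed (use f g in \<open>simp add: commutator_def\<close>)
qed

lemma modular_lie_algebra: "lie_algebra modular_lie"
proof -
  have vs: "vector_space (\<lambda>c (f :: complex \<Rightarrow> complex^2^2) \<tau>. mscale c (f \<tau>))"
    by unfold_locales (simp_all add: fun_eq_iff mscale_add_left mscale_add_right mscale_mscale)
  then have "module (\<lambda>c (f :: complex \<Rightarrow> complex^2^2) \<tau>. mscale c (f \<tau>))"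
    by (simp add: module_iff_vector_space)
  then have sub: "module.subspace (\<lambda>c f \<tau>. mscale c (f \<tau>)) (lie_carrier modular_lie)"
    using carrier_zero carrier_add carrier_scale by (simp add: module.subspace_def)
  show ?thesis
    unfolding lie_algebra_def Let_def modular_lie_simps
    by (intro conjI vs sub ballI allI carrier_bracket)
       (simp_all add: fun_eq_iff commutator_def matrix_mult_linear matrix_mul_assoc mscale_mult_left
          mscale_mult_right mscale_diff_right)
qed

text \<open>The inner bracket is \<open>ons_G 1\<close>, and its bracket with \<open>ons_A k\<close>
  is twice the difference of the two neighbours. Solving for either neighbour moves the index up or
  down, using brackets with \<open>ons_A 0\<close> and \<open>ons_A 1\<close>.\<close>

lemma bracket_onsager_step:
  "ons_A (k + 1) = ons_A (k - 1) + ons_scale (1 / 2) (ons_bracket (ons_bracket (ons_A 1) (ons_A 0)) (ons_A k))"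
  "ons_A (k - 1) = ons_A (k + 1) + ons_scale (- 1 / 2) (ons_bracket (ons_bracket (ons_A 1) (ons_A 0)) (ons_A k))"
proof -
  have e: "ons_bracket (ons_bracket (ons_A 1) (ons_A 0)) (ons_A k) = ons_scale 2 (ons_A (k + 1)) - ons_scale 2 (ons_A (k - 1))"
    by (simp add: onsager_relations)
  show "ons_A (k + 1) = ons_A (k - 1) + ons_scale (1 / 2) (ons_bracket (ons_bracket (ons_A 1) (ons_A 0)) (ons_A k))"
    "ons_A (k - 1) = ons_A (k + 1) + ons_scale (- 1 / 2) (ons_bracket (ons_bracket (ons_A 1) (ons_A 0)) (ons_A k))"
    unfolding e by (rule poly_mapping_eqI; simp add: lookup_add lookup_minus algebra_simps)+
qed

lemma onsager_span_induct [case_names A G add scale]: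
  assumes A: "\<And>k. P (ons_A k)" and G: "\<And>m. P (ons_G m)"
    and add: "\<And>x y. P x \<Longrightarrow> P y \<Longrightarrow> P (x + y)" and scale: "\<And>c x. P x \<Longrightarrow> P (ons_scale c x)"
  shows "P x"
proof -
  have single: "P (Poly_Mapping.single i 1)" for i
  proof (cases i)
    case (OA k)
    then show ?thesis using A[of k] by (simp add: ons_A_def)
  next
    case (OG n)
    then show ?thesis using G[of "int n + 1"] by (simp add: ons_G_def nat_add_distrib)
  qed
  have zero: "P 0"
  proof -
    have "ons_scale 0 (ons_A 0) = 0" by (rule poly_mapping_eqI) simp
    then show ?thesis using scale[OF A, of 0 0] by simp
  qed
  have sums: "P (\<Sum>i\<in>S. ons_scale (c i) (Poly_Mapping.single i 1))" for c S
    by (induction S rule: infinite_finite_induct) (simp_all add: zero add scale single)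
  have "x = (\<Sum>i\<in>Poly_Mapping.keys x. ons_scale (Poly_Mapping.lookup x i) (Poly_Mapping.single i 1))"
  proof (rule poly_mapping_eqI)
    fix k
    show "Poly_Mapping.lookup x k = Poly_Mapping.lookup
        (\<Sum>i\<in>Poly_Mapping.keys x. ons_scale (Poly_Mapping.lookup x i) (Poly_Mapping.single i 1)) k"
      by (simp add: lookup_sum lookup_single when_def in_keys_iff if_distrib[of "(*) _"] cong: if_cong)
  qed
  then show ?thesis using sums by metis
qed

text \<open>Two neighbouring \<open>ons_A\<close> are carried through the induction, because the
  recurrence reaches two steps back; \<open>ons_G m\<close> is then the bracket of
  \<open>ons_A m\<close> and \<open>ons_A 0\<close>. Both the membership of the image in the target
  and the uniqueness of the homomorphism reduce in this way to the two generators.\<close>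

lemma onsager_generated [case_names A0 A1 add scale bracket]:
  assumes A0: "P (ons_A 0)" and A1: "P (ons_A 1)"
    and add: "\<And>x y. P x \<Longrightarrow> P y \<Longrightarrow> P (x + y)" and scale: "\<And>c x. P x \<Longrightarrow> P (ons_scale c x)"
    and bracket: "\<And>x y. P x \<Longrightarrow> P y \<Longrightarrow> P (ons_bracket x y)"
  shows "P x"
proof -
  have "P (ons_A k) \<and> P (ons_A (k + 1))" for k
  proof (induction k rule: int_induct[where k = 0])
    case base
    then show ?case using A0 A1 by simp
  next
    case (step1 k)
    then have "P (ons_A (k + 1 + 1))"
      unfolding bracket_onsager_step(1)[of "k + 1"] using A0 A1 by (intro add scale bracket) simp_all
    then show ?case using step1 by simp
  next
    case (step2 k)
    then have "P (ons_A (k - 1))"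
      unfolding bracket_onsager_step(2)[of k] using A0 A1 by (intro add scale bracket) simp_all
    then show ?case using step2 by simp
  qed
  then have A: "P (ons_A k)" for k by blast
  have "P (ons_G m)" for m
    using bracket[OF A A, of m 0] by (simp add: onsager_relations)
  with A show ?thesis using add scale by (rule onsager_span_induct)
qed

section \<open>The map given by the two involutions\<close>

definition onsager_map :: "onsager \<Rightarrow> complex \<Rightarrow> complex^2^2" where
  "onsager_map x = (\<lambda>\<tau>. ons_lin (ons_image (h_bar \<tau>) (A1_bar \<tau>)) x)"

lemma bar_involutions:
  assumes "\<tau> \<in> \<H>"
  shows "involutions (h_bar \<tau>) (A1_bar \<tau>)"
proof -
  have "mat2 1 0 0 (-1) ** mat2 1 0 0 (-1) = (mat 1 :: complex^2^2)"
    by (simp add: mat2_mult mat_2)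
  moreover have "mat2 (s_coeff \<tau>) (- (e_coeff \<tau> / 864)) (f_coeff \<tau> / 864) (- s_coeff \<tau>) **
      mat2 (s_coeff \<tau>) (- (e_coeff \<tau> / 864)) (f_coeff \<tau> / 864) (- s_coeff \<tau>) = mat 1"
    using s_coeff_square[OF assms] by (simp add: mat2_mult mat_2 power2_eq_square mult.commute)
  ultimately show ?thesis
    unfolding involutions_def h_bar_frame[OF assms] A1_bar_frame[OF assms] frame_mult
    by (simp add: frame_mat_1)
qed

lemma bar_outside:
  assumes "\<tau> \<notin> \<H>"
  shows "h_bar \<tau> = 0" "A1_bar \<tau> = 0"
  using assms by (simp_all add: A1_bar_def h_bar_def e_bar_def f_bar_def)

lemma onsager_map_bracket:
  "onsager_map (ons_bracket x y) = (\<lambda>\<tau>. commutator (onsager_map x \<tau>) (onsager_map y \<tau>))"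
proof
  fix \<tau>
  have "involutions (h_bar \<tau>) (A1_bar \<tau>) \<or> h_bar \<tau> = 0 \<and> A1_bar \<tau> = 0"
    using bar_involutions bar_outside by blast
  then show "onsager_map (ons_bracket x y) \<tau> = commutator (onsager_map x \<tau>) (onsager_map y \<tau>)"
    unfolding onsager_map_def by (intro ons_lin_bracket ons_lin_basis_bracket)
qed

lemma onsager_map_add: "onsager_map (x + y) = onsager_map x + onsager_map y"
  and onsager_map_scale: "onsager_map (ons_scale c x) = (\<lambda>\<tau>. mscale c (onsager_map x \<tau>))"
  and onsager_map_diff: "onsager_map (x - y) = onsager_map x - onsager_map y"
  by (simp_all add: onsager_map_def fun_eq_iff ons_lin_add ons_lin_scale ons_lin_diff)

lemma onsager_map_A: "onsager_map (ons_A k) \<tau> = dih_A (h_bar \<tau>) (A1_bar \<tau>) k"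
  and onsager_map_G: "onsager_map (ons_G k) \<tau> = dih_G (h_bar \<tau>) (A1_bar \<tau>) k"
  by (simp_all add: onsager_map_def ons_lin_ons_A ons_lin_ons_G)

lemma onsager_map_A0: "onsager_map (ons_A 0) = h_bar" and onsager_map_A1: "onsager_map (ons_A 1) = A1_bar"
proof -
  have "onsager_map (ons_A 0) \<tau> = h_bar \<tau> \<and> onsager_map (ons_A 1) \<tau> = A1_bar \<tau>" for \<tau>
    using dih_A_0[OF bar_involutions] dih_A_1[OF bar_involutions]
    by (cases "\<tau> \<in> \<H>") (simp_all add: onsager_map_A bar_outside dih_0)
  then show "onsager_map (ons_A 0) = h_bar" "onsager_map (ons_A 1) = A1_bar" by (simp_all add: fun_eq_iff)
qed

lemma onsager_map_outside: "\<tau> \<notin> \<H> \<Longrightarrow> onsager_map x \<tau> = 0"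
proof (induction x rule: onsager_span_induct)
  case (A k)
  then show ?case by (simp add: onsager_map_A bar_outside dih_0)
next
  case (G m)
  then show ?case by (simp add: onsager_map_G bar_outside dih_0)
qed (simp_all add: onsager_map_add onsager_map_scale)

lemma onsager_map_in_carrier: "onsager_map x \<in> lie_carrier modular_lie"
proof (induction x rule: onsager_generated)
  case A0
  then show ?case by (simp add: onsager_map_A0 h_bar_in_carrier)
next
  case A1
  then show ?case by (simp add: onsager_map_A1 A1_bar_in_carrier)
next
  case (add x y)
  then show ?case unfolding onsager_map_add by (rule carrier_add)
next
  case (scale c x)
  then show ?case unfolding onsager_map_scale by (rule carrier_scale)
next
  case (bracket x y)
  then show ?case unfolding onsager_map_bracket by (rule carrier_bracket)
qed

lemma A1_bar_h_bar:
  assumes "\<tau> \<in> \<H>"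
  shows "A1_bar \<tau> ** h_bar \<tau> = frame \<tau> (mat2 (s_coeff \<tau>) (e_coeff \<tau> / 864) (f_coeff \<tau> / 864) (s_coeff \<tau>))"
    "h_bar \<tau> ** A1_bar \<tau> = frame \<tau> (mat2 (s_coeff \<tau>) (- (e_coeff \<tau> / 864)) (- (f_coeff \<tau> / 864)) (s_coeff \<tau>))"
  unfolding A1_bar_frame[OF assms] h_bar_frame[OF assms] frame_mult by (simp_all add: mat2_mult)

text \<open>In the frame the rotation and its inverse have the same diagonal and opposite
  off-diagonal entries, so their sum is the scalar \<open>2 * s_coeff \<tau>\<close>. Multiplication
  by a power of the rotation gives this recurrence of Chebyshev type.\<close>

lemma zpow_three_term:
  assumes "\<tau> \<in> \<H>"
  defines "z \<equiv> zpow (A1_bar \<tau> ** h_bar \<tau>) (h_bar \<tau> ** A1_bar \<tau>)"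
  shows "z (k + 1) + z (k - 1) = mscale (2 * s_coeff \<tau>) (z k)"
proof -
  let ?U = "A1_bar \<tau> ** h_bar \<tau>" and ?V = "h_bar \<tau> ** A1_bar \<tau>"
  have "?U + ?V = frame \<tau> (mscale (2 * s_coeff \<tau>) (mat 1))"
    unfolding A1_bar_h_bar[OF assms(1)] frame_add[symmetric]
    by (rule arg_cong[of _ _ "frame \<tau>"]) (simp add: mat2_eq_iff mat_def)
  then have UV: "?U + ?V = mscale (2 * s_coeff \<tau>) (mat 1)" by (simp add: frame_mscale frame_mat_1)
  note rot = rotation_inverse[OF bar_involutions[OF assms(1)]]
  have "z (k + 1) + z (k - 1) = (?U + ?V) ** z k"
    unfolding z_def zpow_plus_1[OF rot(1)] zpow_minus_1[OF rot] matrix_mult_linear ..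
  then show ?thesis unfolding UV by (simp add: mscale_mult_left)
qed

text \<open>Multiplication by \<open>s_coeff\<close> replaces a basis vector by the mean of its two
  neighbours. The convention for nonpositive indices of \<open>ons_G\<close> keeps this true for all
  integers, and off the upper half-plane both sides are 0.\<close>

lemma s_coeff_mult_onsager_map:
  "(\<lambda>\<tau>. mscale (s_coeff \<tau>) (onsager_map x \<tau>)) \<in> range onsager_map"
proof (induction x rule: onsager_span_induct)
  case (A k)
  have "mscale (s_coeff \<tau>) (onsager_map (ons_A k) \<tau>) =
      onsager_map (ons_scale (1 / 2) (ons_A (k + 1) + ons_A (k - 1))) \<tau>" for \<tau>
  proof (cases "\<tau> \<in> \<H>")
    case True
    have "dih_A (h_bar \<tau>) (A1_bar \<tau>) (k + 1) + dih_A (h_bar \<tau>) (A1_bar \<tau>) (k - 1) =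
        mscale (2 * s_coeff \<tau>) (dih_A (h_bar \<tau>) (A1_bar \<tau>) k)"
      unfolding dih_A_def matrix_mult_linear(1)[symmetric] zpow_three_term[OF True] mscale_mult_left ..
    then show ?thesis by (simp add: onsager_map_scale onsager_map_add onsager_map_A mscale_mscale)
  qed (simp add: onsager_map_outside)
  then show ?case by (metis (no_types, lifting) rangeI ext)
next
  case (G m)
  have "mscale (s_coeff \<tau>) (onsager_map (ons_G m) \<tau>) =
      onsager_map (ons_scale (1 / 2) (ons_G (m + 1) + ons_G (m - 1))) \<tau>" for \<tau>
  proof (cases "\<tau> \<in> \<H>")
    case True
    have "dih_G (h_bar \<tau>) (A1_bar \<tau>) (m + 1) + dih_G (h_bar \<tau>) (A1_bar \<tau>) (m - 1) =
        mscale (2 * s_coeff \<tau>) (dih_G (h_bar \<tau>) (A1_bar \<tau>) m)"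
    proof -
      have e: "- (m + 1) = - m - 1" "- (m - 1) = - m + 1" by simp_all
      show ?thesis
        unfolding dih_G_def e mscale_diff_right zpow_three_term[OF True, symmetric] by (simp add: algebra_simps)
    qed
    then show ?thesis by (simp add: onsager_map_scale onsager_map_add onsager_map_G mscale_mscale)
  qed (simp add: onsager_map_outside)
  then show ?case by (metis (no_types, lifting) rangeI ext)
next
  case (add x y)
  then obtain x' y' where "(\<lambda>\<tau>. mscale (s_coeff \<tau>) (onsager_map x \<tau>)) = onsager_map x'"
    "(\<lambda>\<tau>. mscale (s_coeff \<tau>) (onsager_map y \<tau>)) = onsager_map y'" by blast
  then have "(\<lambda>\<tau>. mscale (s_coeff \<tau>) (onsager_map (x + y) \<tau>)) = onsager_map (x' + y')"
    by (simp add: onsager_map_add mscale_add_right fun_eq_iff)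
  then show ?case by blast
next
  case (scale c x)
  then obtain x' where "(\<lambda>\<tau>. mscale (s_coeff \<tau>) (onsager_map x \<tau>)) = onsager_map x'" by blast
  then have "(\<lambda>\<tau>. mscale (s_coeff \<tau>) (onsager_map (ons_scale c x) \<tau>)) = onsager_map (ons_scale c x')"
    by (simp add: onsager_map_scale mscale_mscale fun_eq_iff mult.commute flip: mscale_mscale[of c])
  then show ?case by blast
qed

lemma poly_mult_onsager_map:
  "\<exists>y. \<forall>\<tau>. onsager_map y \<tau> = mscale (poly p (klein_j \<tau>)) (onsager_map x \<tau>)"
proof -
  have "\<exists>y. \<forall>\<tau>. onsager_map y \<tau> = mscale (poly p (s_coeff \<tau>)) (onsager_map x \<tau>)" for p
  proof (induction p)
    case 0
    have "onsager_map (ons_scale 0 x) = 0" by (simp add: onsager_map_scale fun_eq_iff)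
    then show ?case by (intro exI[of _ "ons_scale 0 x"]) simp
  next
    case (pCons a p)
    then obtain y where y: "\<And>\<tau>. onsager_map y \<tau> = mscale (poly p (s_coeff \<tau>)) (onsager_map x \<tau>)" by blast
    obtain y' where "(\<lambda>\<tau>. mscale (s_coeff \<tau>) (onsager_map y \<tau>)) = onsager_map y'"
      using s_coeff_mult_onsager_map[of y] by blast
    then have "onsager_map y' \<tau> = mscale (s_coeff \<tau>) (onsager_map y \<tau>)" for \<tau> by metis
    then show ?case
      by (intro exI[of _ "ons_scale a x + y'"])
         (simp add: onsager_map_add onsager_map_scale y mscale_mscale mscale_add_left)
  qed
  \<comment> \<open>Inverting the definition of \<open>s_coeff\<close> gives j = 864 s +
    864.\<close>
  from this[of "pcompose p [:864, 864:]"] show ?thesis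
    by (simp add: poly_pcompose s_coeff_def field_simps)
qed

lemma onsager_map_surj:
  assumes "f \<in> lie_carrier modular_lie"
  shows "f \<in> range onsager_map"
proof -
  obtain p r s where f: "\<And>\<tau>. \<tau> \<in> \<H> \<Longrightarrow> f \<tau> =
    frame \<tau> (mat2 (poly p (klein_j \<tau>)) (poly r (klein_j \<tau>) * e_coeff \<tau>)
      (poly s (klein_j \<tau>) * f_coeff \<tau>) (- poly p (klein_j \<tau>)))"
    using carrier_decomposition[OF assms] by blast
  \<comment> \<open>In the frame \<open>ons_A 1\<close> and \<open>ons_A (-1)\<close> have opposite
    off-diagonal entries and equal diagonals. Adding or subtracting their difference cancels one
    entry of \<open>ons_G 1\<close> and doubles the other, to \<open>4 / 864\<close> times
    \<open>e_coeff\<close> or \<open>f_coeff\<close>; hence 216 = 864 / 4.\<close>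
  define E where "E = ons_scale 216 (ons_G 1 - ons_A 1 + ons_A (-1))"
  define F where "F = ons_scale 216 (ons_G 1 + ons_A 1 - ons_A (-1))"
  obtain x1 where x1: "\<And>\<tau>. onsager_map x1 \<tau> = mscale (poly p (klein_j \<tau>)) (onsager_map (ons_A 0) \<tau>)"
    using poly_mult_onsager_map by blast
  obtain x2 where x2: "\<And>\<tau>. onsager_map x2 \<tau> = mscale (poly r (klein_j \<tau>)) (onsager_map E \<tau>)"
    using poly_mult_onsager_map by blast
  obtain x3 where x3: "\<And>\<tau>. onsager_map x3 \<tau> = mscale (poly s (klein_j \<tau>)) (onsager_map F \<tau>)"
    using poly_mult_onsager_map by blast
  have "f \<tau> = onsager_map (x1 + x2 + x3) \<tau>" for \<tau>
  proof (cases "\<tau> \<in> \<H>")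
    case True
    note inv = bar_involutions[OF True]
    let ?s = "s_coeff \<tau>" and ?y = "e_coeff \<tau> / 864" and ?w = "f_coeff \<tau> / 864"
    have G: "onsager_map (ons_G 1) \<tau> = frame \<tau> (mat2 0 (2 * ?y) (2 * ?w) 0)"
    proof -
      have "onsager_map (ons_G 1) \<tau> = A1_bar \<tau> ** h_bar \<tau> - h_bar \<tau> ** A1_bar \<tau>"
        unfolding onsager_map_G commutator_dih_A_A[OF inv, of 1 0, simplified, symmetric]
        by (simp add: commutator_def dih_A_0[OF inv] dih_A_1[OF inv])
      also have "\<dots> = frame \<tau> (mat2 ?s ?y ?w ?s - mat2 ?s (- ?y) (- ?w) ?s)"
        unfolding A1_bar_h_bar[OF True] frame_diff ..
      also have "mat2 ?s ?y ?w ?s - mat2 ?s (- ?y) (- ?w) ?s = mat2 0 (2 * ?y) (2 * ?w) 0"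
        by (simp add: mat2_eq_iff)
      finally show ?thesis .
    qed
    have Am: "onsager_map (ons_A (-1)) \<tau> = frame \<tau> (mat2 ?s ?y (- ?w) (- ?s))"
    proof -
      have "onsager_map (ons_A (-1)) \<tau> = h_bar \<tau> ** A1_bar \<tau> ** h_bar \<tau>"
        using zpow_minus_1[OF rotation_inverse[OF inv], of 0] by (simp add: onsager_map_A dih_A_def)
      also have "\<dots> = frame \<tau> (mat2 ?s ?y (- ?w) (- ?s))"
        unfolding A1_bar_h_bar[OF True] unfolding h_bar_frame[OF True] frame_mult by (simp add: mat2_mult)
      finally show ?thesis .
    qed
    have E: "onsager_map E \<tau> = frame \<tau> (mat2 0 (e_coeff \<tau>) 0 0)"
      unfolding E_def onsager_map_scale onsager_map_add onsager_map_diff plus_fun_apply minus_apply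
        onsager_map_A1 A1_bar_frame[OF True] G Am frame_diff[symmetric] frame_add[symmetric] frame_mscale[symmetric]
      by (rule arg_cong[of _ _ "frame \<tau>"]) (simp add: mat2_eq_iff)
    have F: "onsager_map F \<tau> = frame \<tau> (mat2 0 0 (f_coeff \<tau>) 0)"
      unfolding F_def onsager_map_scale onsager_map_add onsager_map_diff plus_fun_apply minus_apply
        onsager_map_A1 A1_bar_frame[OF True] G Am frame_diff[symmetric] frame_add[symmetric] frame_mscale[symmetric]
      by (rule arg_cong[of _ _ "frame \<tau>"]) (simp add: mat2_eq_iff)
    show ?thesis
      unfolding f[OF True] onsager_map_add plus_fun_apply x1 x2 x3 E F onsager_map_A0 h_bar_frame[OF True]
        frame_add[symmetric] frame_mscale[symmetric]
      by (rule arg_cong[of _ _ "frame \<tau>"]) (simp add: mat2_eq_iff)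
  next
    case False
    then have "f \<tau> = 0" using assms by (simp add: modular_lie_carrier_iff)
    then show ?thesis using False by (simp add: onsager_map_outside)
  qed
  then have "f = onsager_map (x1 + x2 + x3)" by blast
  then show ?thesis by blast
qed

section \<open>Injectivity\<close>

text \<open>Multiplication by a large power of z leaves a polynomial with infinitely many roots.
  Injectivity of \<open>e\<close> keeps the exponents apart, so each \<open>c i\<close> is one of
  its coefficients. The arbitrary index type allows basis indices of the Onsager algebra to be used
  directly.\<close>

lemma laurent_polynomial_eq_0:
  fixes c :: "'a \<Rightarrow> complex" and e :: "'a \<Rightarrow> int"
  assumes S: "finite S" "inj_on e S" and Z: "infinite Z" "0 \<notin> Z"
    and eq: "\<And>z. z \<in> Z \<Longrightarrow> (\<Sum>i\<in>S. c i * z powi e i) = 0" and i: "i \<in> S"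
  shows "c i = 0"
proof -
  define N where "N = (\<Sum>i\<in>S. \<bar>e i\<bar>)"
  have N: "0 \<le> e i + N" if "i \<in> S" for i
  proof -
    have "\<bar>e i\<bar> \<le> N" unfolding N_def using S(1) that by (intro member_le_sum) auto
    then show ?thesis by linarith
  qed
  define P where "P = (\<Sum>i\<in>S. monom (c i) (nat (e i + N)))"
  have "poly P z = 0" if z: "z \<in> Z" for z
  proof -
    have "z \<noteq> 0" using z Z by auto
    have t: "c i * z ^ nat (e i + N) = z powi N * (c i * z powi e i)" if "i \<in> S" for i
      using N[OF that] \<open>z \<noteq> 0\<close> by (simp add: power_int_add power_int_def[of _ "e i + N", symmetric] flip: power_int_of_nat)
    have "poly P z = z powi N * (\<Sum>i\<in>S. c i * z powi e i)"
      unfolding P_def poly_sum poly_monom sum_distrib_left by (intro sum.cong refl t)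
    then show ?thesis using eq[OF z] by simp
  qed
  then have "Z \<subseteq> {z. poly P z = 0}" by auto
  then have "P = 0" using Z(1) poly_roots_finite[of P] finite_subset by blast
  have "coeff P (nat (e i + N)) = (\<Sum>k\<in>S. if k = i then c k else 0)"
    unfolding P_def coeff_sum coeff_monom
  proof (intro sum.cong refl)
    fix k assume k: "k \<in> S"
    have "nat (e k + N) = nat (e i + N) \<longleftrightarrow> k = i"
      using N[OF k] N[OF i] inj_onD[OF S(2) _ k i] by (auto simp: eq_nat_nat_iff)
    then show "(if nat (e k + N) = nat (e i + N) then c k else 0) = (if k = i then c k else 0)" by simp
  qed
  then show ?thesis using \<open>P = 0\<close> S(1) i by simp
qed

section \<open>Eigenvectors of the rotation\<close>

lemma mscale_mult_vec: "mscale c A *v v = c *s (A *v v)"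
  by (simp add: vec_eq_iff matrix_vector_mult_def sum_distrib_left mult_ac)

lemma matrix_vector_mult_sum: "sum f S *v v = (\<Sum>i\<in>S. f i *v v)"
  for f :: "_ \<Rightarrow> complex^'n^'m"
  by (induction S rule: infinite_finite_induct) (simp_all add: matrix_vector_mult_add_rdistrib)

lemma vector_scale_sum: "(\<Sum>i\<in>S. c i *s v) = (\<Sum>i\<in>S. c i) *s v" for v :: "complex^'n"
  by (simp add: vec_eq_iff sum_distrib_right)

lemma zpow_eigenvector:
  assumes UV: "U ** V = mat 1" "V ** U = mat 1" and v: "U *v v = w *s v" "w \<noteq> 0"
  shows "zpow U V k *v v = (w powi k) *s v"
proof -
  have "V *v (U *v v) = v" using UV by (simp add: matrix_vector_mul_assoc)
  then have "w *s (V *v v) = v" using v(1) by (simp add: vector_scalar_commute)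
  then have "(1 / w) *s (w *s (V *v v)) = (1 / w) *s v" by simp
  then have V: "V *v v = (1 / w) *s v" using v(2) by (simp add: vector_smult_assoc)
  show ?thesis
  proof (induction k rule: int_induct[where k = 0])
    case (step1 i)
    then show ?case using v
      by (simp add: zpow_plus_1[OF UV(1)] vector_scalar_commute vector_smult_assoc power_int_add mult.commute
          flip: matrix_vector_mul_assoc)
  next
    case (step2 i)
    then show ?case using v
      by (simp add: zpow_minus_1[OF UV] V vector_scalar_commute vector_smult_assoc power_int_diff mult.commute
          flip: matrix_vector_mul_assoc)
  qed simp
qed

lemma frame_vector: "frame \<tau> X *v (Phi1 \<tau> *v v) = Phi1 \<tau> *v (X *v v)"
  by (simp add: frame_def matrix_vector_mul_assoc Phi1_inv_mult flip: matrix_mul_assoc)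

text \<open>The vector \<open>v0\<close> solves the first row of the eigenvalue equation in the
  frame, and the second row follows from determinant 1. Since \<open>w = s\<close> would force
  \<open>w = 1 / w\<close>, the condition on \<open>w\<^sup>2\<close> keeps \<open>v0\<close>
  nonzero even at zeros of \<open>e_coeff\<close>.\<close>

lemma rotation_eigenvector:
  assumes \<tau>: "\<tau> \<in> \<H>" and w: "w \<noteq> 0" "w\<^sup>2 \<noteq> 1" "w + 1 / w = 2 * s_coeff \<tau>"
  obtains v where "v \<noteq> 0" "(A1_bar \<tau> ** h_bar \<tau>) *v v = w *s v"
proof -
  let ?s = "s_coeff \<tau>" and ?y = "e_coeff \<tau> / 864" and ?z = "f_coeff \<tau> / 864"
  have quad: "w * w + 1 = 2 * ?s * w" using w by (simp add: field_simps)
  define v0 :: "complex^2" where "v0 = vector [?y, w - ?s]"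
  have "w \<noteq> ?s"
  proof
    assume "w = ?s"
    then have "w\<^sup>2 = 1" using quad by (simp add: power2_eq_square algebra_simps)
    then show False using w by simp
  qed
  then have "v0 \<noteq> 0" by (auto simp: v0_def vec_eq_iff forall_2)
  have "?s * ?s - ?y * ?z = 1" using s_coeff_square[OF \<tau>] by (simp add: power2_eq_square)
  then have "?z * ?y + ?s * (w - ?s) = w * (w - ?s)" using quad by algebra
  then have ev: "mat2 ?s ?y ?z ?s *v v0 = w *s v0"
    by (simp add: v0_def vec_eq_iff forall_2 matrix_vector_mult_def sum_2 algebra_simps)
  show ?thesis
  proof (rule that)
    have "Phi1_inv \<tau> *v (Phi1 \<tau> *v v0) = v0" by (simp add: matrix_vector_mul_assoc Phi1_inv_mult)
    then show "Phi1 \<tau> *v v0 \<noteq> 0" using \<open>v0 \<noteq> 0\<close> by auto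
    show "(A1_bar \<tau> ** h_bar \<tau>) *v (Phi1 \<tau> *v v0) = w *s (Phi1 \<tau> *v v0)"
      unfolding A1_bar_h_bar[OF \<tau>] frame_vector ev by (simp add: vector_scalar_commute)
  qed
qed

lemma eigenvectors_independent:
  fixes u v :: "complex^'n"
  assumes u: "U *v u = a *s u" "u \<noteq> 0" and v: "U *v v = b *s v" "v \<noteq> 0" and "a \<noteq> b"
    and eq: "x *s u + y *s v = 0"
  shows "x = 0" "y = 0"
proof -
  have "U *v (x *s u + y *s v) = (x * a) *s u + (y * b) *s v"
    by (simp add: matrix_vector_right_distrib vector_scalar_commute u v vector_smult_assoc)
  then have eq2: "(x * a) *s u + (y * b) *s v = 0" by (simp add: eq)
  have "(x * a) *s u + (y * b) *s v - b *s (x *s u + y *s v) = (x * (a - b)) *s u"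
    "(x * a) *s u + (y * b) *s v - a *s (x *s u + y *s v) = (y * (b - a)) *s v"
    by (simp_all add: vec_eq_iff algebra_simps)
  then show "x = 0" "y = 0" using assms(5) u(2) v(2) unfolding eq eq2 by (auto simp: vec_eq_iff)
qed

text \<open>The values 1 and -1 are left out because there \<open>w\<close> and \<open>1 / w\<close>
  coincide and eigenvectors for the two need not be independent.\<close>

definition rotation_eigenvalues :: "complex set" where
  "rotation_eigenvalues = {w. w \<noteq> 0 \<and> w\<^sup>2 \<noteq> 1 \<and> (\<exists>\<tau>\<in>\<H>. w + 1 / w = 2 * s_coeff \<tau>)}"

text \<open>Every s is half of w + 1/w for a root w of w^2 - 2 s w + 1, and j = 432 (w + 1/w) + 864.
  Finitely many w, even with 1 and -1 restored, would give j a finite range.\<close>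

lemma infinite_rotation_eigenvalues: "infinite rotation_eigenvalues"
proof
  assume fin: "finite rotation_eigenvalues"
  have "klein_j ` \<H> \<subseteq> (\<lambda>w. 432 * (w + 1 / w) + 864) ` (rotation_eigenvalues \<union> {1, -1})"
  proof
    fix x assume "x \<in> klein_j ` \<H>"
    then obtain \<tau> where \<tau>: "\<tau> \<in> \<H>" "x = klein_j \<tau>" by blast
    define s w where "s = s_coeff \<tau>" and "w = s + csqrt (s\<^sup>2 - 1)"
    have "(w - s)\<^sup>2 = s\<^sup>2 - 1" by (simp add: w_def)
    then have q: "w * (2 * s - w) = 1" by (simp add: power2_eq_square algebra_simps)
    then have w0: "w \<noteq> 0" by auto
    have "w + 1 / w = 2 * s" using q w0 by (simp add: field_simps)
    then have "w \<in> rotation_eigenvalues \<union> {1, -1}"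
      using w0 \<tau> by (auto simp: rotation_eigenvalues_def s_def power2_eq_1_iff)
    moreover have "x = 432 * (w + 1 / w) + 864"
      unfolding \<open>w + 1 / w = 2 * s\<close> by (simp add: s_def s_coeff_def \<tau> field_simps)
    ultimately show "x \<in> (\<lambda>w. 432 * (w + 1 / w) + 864) ` (rotation_eigenvalues \<union> {1, -1})" by blast
  qed
  then have "finite (klein_j ` \<H>)" by (rule finite_subset) (use fin in simp)
  then show False using klein_j_infinite_range by simp
qed

text \<open>If \<open>v\<close> is an eigenvector of the rotation with eigenvalue \<open>w\<close> and \<open>u = h v\<close>, then \<open>A\<^sub>k\<close> maps
  \<open>u\<close> to \<open>w\<^sup>k v\<close>, and \<open>G\<^sub>m\<close> multiplies it by \<open>w\<^sup>-\<^sup>m - w\<^sup>m\<close>.\<close>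

lemma onsager_map_eq_0:
  assumes x: "onsager_map x = 0"
  shows "x = 0"
proof (rule poly_mapping_eqI)
  let ?K = "Poly_Mapping.keys x" and ?c = "Poly_Mapping.lookup x"
  define KA where "KA = {i \<in> ?K. \<exists>k. i = OA k}"
  define KG where "KG = {i \<in> ?K. \<exists>n. i = OG n}"
  have K: "?K = KA \<union> KG" "KA \<inter> KG = {}" "finite KA" "finite KG"
    by (auto simp: KA_def KG_def) (metis onsager_index.exhaust)
  \<comment> \<open>The value 0 on the other kind of index is a filler, as \<open>eA\<close> is
    evaluated on \<open>KA\<close> and \<open>eG\<close> on \<open>KG\<close>.\<close>
  define eA where "eA i = (case i of OA k \<Rightarrow> k | OG n \<Rightarrow> 0)" for i
  define eG where "eG i = (case i of OA k \<Rightarrow> 0 | OG n \<Rightarrow> int n + 1)" for i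
  have "(\<Sum>i\<in>KA. ?c i * w powi eA i) = 0 \<and> (\<Sum>i\<in>KG. ?c i * (w powi (- eG i) - w powi eG i)) = 0"
    if w: "w \<in> rotation_eigenvalues" for w
  proof -
    obtain \<tau> where \<tau>: "\<tau> \<in> \<H>" "w + 1 / w = 2 * s_coeff \<tau>"
      using w by (auto simp: rotation_eigenvalues_def)
    have w0: "w \<noteq> 0" "w\<^sup>2 \<noteq> 1" using w by (auto simp: rotation_eigenvalues_def)
    define h where "h = h_bar \<tau>"
    define a where "a = A1_bar \<tau>"
    have inv: "involutions h a" unfolding h_def a_def by (rule bar_involutions[OF \<tau>(1)])
    obtain v where v: "v \<noteq> 0" "(a ** h) *v v = w *s v"
      using rotation_eigenvector[OF \<tau>(1) w0 \<tau>(2)] unfolding h_def a_def by blast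
    \<comment> \<open>Conjugation by \<open>h\<close> inverts the rotation, so \<open>u\<close> is
      an eigenvector for \<open>1 / w\<close> and independent of \<open>v\<close>. The vanishing
      image thus splits into the contribution of the \<open>A\<close> indices along \<open>v\<close>
      and that of the \<open>G\<close> indices along \<open>u\<close>.\<close>
    define u where "u = h *v v"
    have hu: "h *v u = v" by (simp add: u_def matrix_vector_mul_assoc h_square[OF inv])
    then have u: "u \<noteq> 0" using v(1) by auto
    have zv: "zpow (a ** h) (h ** a) k *v v = (w powi k) *s v" for k
      by (rule zpow_eigenvector[OF rotation_inverse[OF inv] v(2) w0(1)])
    have zu: "zpow (a ** h) (h ** a) k *v u = (w powi (- k)) *s u" for k
    proof -
      have "zpow (a ** h) (h ** a) k *v u = h *v (zpow (a ** h) (h ** a) (- k) *v v)"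
        using h_rot[OF inv, of "- k"] by (simp add: u_def matrix_vector_mul_assoc)
      then show ?thesis unfolding zv by (simp add: u_def vector_scalar_commute)
    qed
    have A: "ons_image h a i *v u = (w powi eA i) *s v" if "i \<in> KA" for i
      using that by (auto simp: KA_def eA_def dih_A_def hu zv simp flip: matrix_vector_mul_assoc)
    have G: "ons_image h a i *v u = (w powi (- eG i) - w powi eG i) *s u" if i: "i \<in> KG" for i
    proof -
      obtain n where n: "i = OG n" using i by (auto simp: KG_def)
      show ?thesis
        unfolding n eG_def ons_image.simps dih_G_def matrix_vector_mult_diff_rdistrib zu
        by (simp add: vector_sub_rdistrib add.commute)
    qed
    have "0 = onsager_map x \<tau> *v u" using x by simp
    also have "\<dots> = (\<Sum>i\<in>?K. ?c i *s (ons_image h a i *v u))"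
      by (simp add: onsager_map_def ons_lin_def h_def a_def matrix_vector_mult_sum mscale_mult_vec)
    also have "\<dots> = (\<Sum>i\<in>KA. ?c i *s (ons_image h a i *v u)) + (\<Sum>i\<in>KG. ?c i *s (ons_image h a i *v u))"
      unfolding K(1) by (rule sum.union_disjoint) (use K in auto)
    also have "\<dots> = (\<Sum>i\<in>KA. ?c i * w powi eA i) *s v + (\<Sum>i\<in>KG. ?c i * (w powi (- eG i) - w powi eG i)) *s u"
      unfolding vector_scale_sum[symmetric]
      by (intro arg_cong2[where f = "(+)"] sum.cong refl) (simp_all only: A G vector_smult_assoc)
    finally have eq: "(\<Sum>i\<in>KA. ?c i * w powi eA i) *s v + (\<Sum>i\<in>KG. ?c i * (w powi (- eG i) - w powi eG i)) *s u = 0" ..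
    have "(a ** h) *v u = (1 / w) *s u"
      using zu[of 1] zpow_plus_1[OF rotation_inverse(1)[OF inv], of 0] by (simp add: power_int_minus inverse_eq_divide)
    moreover have "w \<noteq> 1 / w" using w0 by (auto simp: field_simps power2_eq_square)
    ultimately show ?thesis
      using eigenvectors_independent[OF v(2,1) _ u _ eq] by blast
  qed
  then have sumA: "(\<Sum>i\<in>KA. ?c i * w powi eA i) = 0"
    and sumG: "(\<Sum>i\<in>KG. ?c i * (w powi (- eG i) - w powi eG i)) = 0"
    if "w \<in> rotation_eigenvalues" for w using that by blast+
  have Z0: "0 \<notin> rotation_eigenvalues" by (simp add: rotation_eigenvalues_def)
  have A0: "?c i = 0" if "i \<in> KA" for i
  proof (rule laurent_polynomial_eq_0[OF K(3) _ infinite_rotation_eigenvalues Z0 sumA that])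
    show "inj_on eA KA" by (auto simp: inj_on_def KA_def eA_def)
  qed
  \<comment> \<open>Each \<open>G\<close> index contributes two powers of \<open>w\<close>, with
    opposite exponents and opposite coefficients; the truth value selects one of them. All
    \<open>eG\<close> are positive on \<open>KG\<close>, so these exponents are pairwise
    distinct.\<close>
  define cG where "cG = (\<lambda>(i, b). if b then - ?c i else ?c i)"
  define e where "e = (\<lambda>(i, b). if b then eG i else - eG i)"
  have G0: "?c i = 0" if i: "i \<in> KG" for i
  proof -
    have "cG (i, False) = 0"
    proof (rule laurent_polynomial_eq_0[OF _ _ infinite_rotation_eigenvalues Z0, of "KG \<times> UNIV" e cG])
      show "finite (KG \<times> (UNIV :: bool set))" using K(4) by simp
      show "inj_on e (KG \<times> UNIV)" by (auto simp: inj_on_def KG_def e_def eG_def split: if_splits)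
      show "(\<Sum>i\<in>KG \<times> UNIV. cG i * w powi e i) = 0" if "w \<in> rotation_eigenvalues" for w
      proof -
        have "(\<Sum>i\<in>KG \<times> UNIV. cG i * w powi e i) = (\<Sum>i\<in>KG. \<Sum>b\<in>UNIV. cG (i, b) * w powi e (i, b))"
          by (simp add: sum.cartesian_product)
        also have "\<dots> = (\<Sum>i\<in>KG. ?c i * (w powi (- eG i) - w powi eG i))"
          by (intro sum.cong refl) (simp add: UNIV_bool cG_def e_def algebra_simps)
        finally show ?thesis using sumG[OF that] by simp
      qed
    qed (use i in auto)
    then show ?thesis by (simp add: cG_def)
  qed
  fix i
  show "?c i = Poly_Mapping.lookup 0 i"
  proof (cases "i \<in> ?K")
    case True
    then have "i \<in> KA \<or> i \<in> KG" unfolding K(1) by blast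
    then show ?thesis using A0 G0 by auto
  next
    case False
    then show ?thesis by (simp add: in_keys_iff)
  qed
qed

lemma onsager_map_inj: "inj onsager_map"
proof (rule injI)
  fix x y assume "onsager_map x = onsager_map y"
  then have "onsager_map (x - y) = 0" by (simp add: onsager_map_diff)
  then have "x - y = 0" by (rule onsager_map_eq_0)
  then show "x = y" by simp
qed

text \<open>There is no circle: the bracket formula for \<open>onsager_map\<close> and its
  injectivity are obtained without the axioms for \<open>ons_bracket\<close>. Each bracket axiom,
  bilinearity included, becomes an identity of matrices under the injective map.\<close>

lemma onsager_lie_algebra: "lie_algebra onsager_algebra"
proof -
  note inj = injD[OF onsager_map_inj]
  note hom = onsager_map_bracket onsager_map_add onsager_map_scale
  have vs: "vector_space ons_scale"
    by unfold_locales (rule poly_mapping_eqI; simp add: lookup_add algebra_simps)+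
  then have "module.subspace ons_scale UNIV"
    by (simp add: module.subspace_def module_iff_vector_space)
  moreover have "ons_bracket (x + y) z = ons_bracket x z + ons_bracket y z"
    "ons_bracket x (y + z) = ons_bracket x y + ons_bracket x z"
    "ons_bracket (ons_scale c x) y = ons_scale c (ons_bracket x y)"
    "ons_bracket x (ons_scale c y) = ons_scale c (ons_bracket x y)" for x y z c
    by (rule inj; simp add: hom fun_eq_iff commutator_def matrix_mult_linear mscale_mult_left
        mscale_mult_right mscale_diff_right)+
  moreover have "ons_bracket x x = 0" for x
    by (rule onsager_map_eq_0) (simp add: hom fun_eq_iff commutator_def)
  moreover have "ons_bracket x (ons_bracket y z) + ons_bracket y (ons_bracket z x) + ons_bracket z (ons_bracket x y) = 0"
    for x y z
    by (rule onsager_map_eq_0)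
       (simp add: hom fun_eq_iff commutator_def matrix_mult_linear matrix_mul_assoc)
  ultimately show ?thesis using vs
    by (simp add: lie_algebra_def onsager_algebra_def)
qed

theorem theorem2p5:
  shows "\<exists>\<phi>. lie_iso onsager_algebra (automorphic_lie_algebra sl SL2Z Ad) \<phi> \<and>
             \<phi> (ons_A 0) = h_bar \<and> \<phi> (ons_A 1) = A1_bar \<and>
             (\<forall>\<psi>. lie_hom onsager_algebra (automorphic_lie_algebra sl SL2Z Ad) \<psi> \<and>
                   \<psi> (ons_A 0) = h_bar \<and> \<psi> (ons_A 1) = A1_bar \<longrightarrow> \<psi> = \<phi>)"
proof (intro exI[of _ onsager_map] conjI allI impI)
  have ons: "lie_carrier onsager_algebra = UNIV" "lie_scale onsager_algebra = ons_scale"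
    "lie_bracket onsager_algebra = ons_bracket"
    by (simp_all add: onsager_algebra_def)
  have "lie_hom onsager_algebra modular_lie onsager_map"
    unfolding lie_hom_def ons modular_lie_simps
    using onsager_lie_algebra modular_lie_algebra onsager_map_in_carrier onsager_map_add onsager_map_scale
      onsager_map_bracket by blast
  moreover have "bij_betw onsager_map UNIV (lie_carrier modular_lie)"
    using onsager_map_inj onsager_map_surj onsager_map_in_carrier by (auto simp: bij_betw_def)
  ultimately show "lie_iso onsager_algebra modular_lie onsager_map"
    by (simp add: lie_iso_def ons)
  show "onsager_map (ons_A 0) = h_bar" "onsager_map (ons_A 1) = A1_bar"
    by (fact onsager_map_A0 onsager_map_A1)+
  \<comment> \<open>Uniqueness among all homomorphisms: two that agree on \<open>ons_A 0\<close> and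
    \<open>ons_A 1\<close> agree on everything these generate.\<close>
  fix \<psi> assume \<psi>: "lie_hom onsager_algebra modular_lie \<psi> \<and> \<psi> (ons_A 0) = h_bar \<and> \<psi> (ons_A 1) = A1_bar"
  then have hom: "\<psi> (x + y) = \<psi> x + \<psi> y" "\<psi> (ons_scale c x) = (\<lambda>\<tau>. mscale c (\<psi> x \<tau>))"
    "\<psi> (ons_bracket x y) = (\<lambda>\<tau>. commutator (\<psi> x \<tau>) (\<psi> y \<tau>))" for x y c
    unfolding lie_hom_def ons modular_lie_simps by blast+
  have "\<psi> x = onsager_map x" for x
  proof (induction x rule: onsager_generated)
    case A0
    then show ?case using \<psi> by (simp add: onsager_map_A0)
  next
    case A1
    then show ?case using \<psi> by (simp add: onsager_map_A1)
  qed (simp_all add: hom onsager_map_add onsager_map_scale onsager_map_bracket)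
  then show "\<psi> = onsager_map" by blast
qed

end
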